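(* Let $n\ge1$, let $w$ be a doubling weight (as defined in the context), and let $M>0$. There is a constant $C$ depending only on $M$, $w$ and $n$ such that the following holds. Let $u$ be a harmonic function in $\mathbb{R}^{n+1}_+=\mathbb{R}^n\times(0,\infty)$, and assume that there exist a constant $K>0$ and a set $\Sigma\subset\mathbb{R}^n$ of positive $n$-dimensional Lebesgue measure such that for every $x_0\in\Sigma$ $$|u(x,y)|\le K w(y)\quad\text{for all } (x,y)\in\mathbb{R}^{n+1}_+ \text{ with } |x-x_0|\le My.$$ For $x\in\mathbb{R}^n$ and $0<\delta\le1$ put $$I_0(x,\delta)=\int_{\delta}^1u(x,y)\,d\left(\frac{1}{w(y)}\right).$$ Then $$\limsup_{\delta\to0}\frac{I_0(x,\delta)}{\sqrt{\log w(\delta)\,\log\log\log w(\delta)}}\le CK\quad\text{for Lebesgue-a.e. } x\in\Sigma.$$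
   Context: Weight: $w:\mathbb{R}_+\to\mathbb{R}_+$ (with $\mathbb{R}_+=(0,\infty)$) is a continuous decreasing (i.e. non-increasing) function with $\lim_{y\to0+}w(y)=\infty$, $w(y)=1$ for $y>1$, satisfying the doubling condition $w(y)\le D\,w(2y)$ for all $y>0$, for some constant $D>0$. Integrals against $d(1/w(y))$ are Stieltjes integrals with respect to the non-decreasing continuous function $1/w$. *)

theory Defs
  imports "HOL-Analysis.Analysis"
begin

definition doubling_weight :: "(real \<Rightarrow> real) \<Rightarrow> bool" where
  "doubling_weight w \<longleftrightarrow>
     (\<forall>y>0. w y > 0) \<and>
     continuous_on {0<..} w \<and>
     antimono_on {0<..} w \<and>
     filterlim w at_top (at_right 0) \<and>
     (\<forall>y>1. w y = 1) \<and>
     (\<exists>D>0. \<forall>y>0. w y \<le> D * w (2 * y))"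

definition partial_deriv :: "'a::euclidean_space \<Rightarrow> ('a \<Rightarrow> real) \<Rightarrow> 'a \<Rightarrow> real" where
  "partial_deriv b f x = deriv (\<lambda>t. f (x + t *\<^sub>R b)) 0"

text \<open>
  The first three conjuncts after openness say that \<open>u\<close> is of class \<open>C\<^sup>2\<close>. The explicit
  differentiability requirements are needed because \<^const>\<open>deriv\<close> is total, so
  that continuity of \<^const>\<open>partial_deriv\<close> alone would not guarantee existence of
  the partial derivatives.
\<close>

definition harmonic_on :: "'a::euclidean_space set \<Rightarrow> ('a \<Rightarrow> real) \<Rightarrow> bool" where
  "harmonic_on S u \<longleftrightarrow>
     open S \<and>
     u differentiable_on S \<and>
     (\<forall>b\<in>Basis. partial_deriv b u differentiable_on S) \<and>
     (\<forall>b\<in>Basis. \<forall>c\<in>Basis. continuous_on S (partial_deriv c (partial_deriv b u))) \<and>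
     (\<forall>x\<in>S. (\<Sum>b\<in>Basis. partial_deriv b (partial_deriv b u) x) = 0)"

text \<open>
  A weight is only meaningful on \<open>(0,\<infinity>)\<close>, whereas \<^const>\<open>interval_measure\<close> needs a
  function on the whole line. Since \<open>1 / w y\<close> tends to \<open>0\<close> as \<open>y\<close> tends to \<open>0\<close> from the
  right, extension by \<open>0\<close> is continuous and non-decreasing, so
  \<^const>\<open>interval_measure\<close> yields the genuine (atomless) Lebesgue-Stieltjes measure.
\<close>

definition recip_weight :: "(real \<Rightarrow> real) \<Rightarrow> real \<Rightarrow> real" where
  "recip_weight w y = (if y > 0 then 1 / w y else 0)"

lemma mono_recip_weight:
  assumes "doubling_weight w"
  shows "mono (recip_weight w)"
proof (rule monoI)
  fix x y :: real
  assume "x \<le> y"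
  moreover have "w y \<le> w x" if "0 < x"
    using assms that \<open>x \<le> y\<close> unfolding doubling_weight_def monotone_on_def by auto
  moreover have "w z > 0" if "0 < z" for z
    using assms that unfolding doubling_weight_def by auto
  ultimately show "recip_weight w x \<le> recip_weight w y"
    by (auto simp: recip_weight_def less_imp_le intro!: divide_left_mono mult_pos_pos)
qed

lemma isCont_recip_weight:
  assumes "doubling_weight w"
  shows "isCont (recip_weight w) y"
proof -
  have pos: "\<And>z. z > 0 \<Longrightarrow> w z > 0" and cont: "continuous_on {0<..} w"
    and lim: "filterlim w at_top (at_right 0)"
    using assms by (auto simp: doubling_weight_def)
  consider "y > 0" | "y < 0" | "y = 0" by linarith
  then show ?thesis
  proof cases
    case 1
    have "isCont (\<lambda>z. 1 / w z) y"
      using 1 cont pos[OF 1] by (intro continuous_intros) (auto simp: continuous_on_eq_continuous_at)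
    moreover have "\<forall>\<^sub>F z in nhds y. recip_weight w z = 1 / w z"
      using eventually_nhds_in_open[of "{0<..}" y] 1
      by (auto elim!: eventually_mono simp: recip_weight_def)
    ultimately show ?thesis using isCont_cong[of "recip_weight w" "\<lambda>z. 1 / w z" y] by simp
  next
    case 2
    have "\<forall>\<^sub>F z in nhds y. recip_weight w z = 0"
      using eventually_nhds_in_open[of "{..<0}" y] 2
      by (auto elim!: eventually_mono simp: recip_weight_def)
    then show ?thesis using isCont_cong[of "recip_weight w" "\<lambda>_. 0" y] by auto
  next
    case 3
    have "((\<lambda>z. 1 / w z) \<longlongrightarrow> 0) (at_right 0)"
      using tendsto_inverse_0_at_top[OF lim] by (simp add: divide_inverse)
    moreover have "\<forall>\<^sub>F z in at_right 0. 1 / w z = recip_weight w z"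
      by (auto simp: eventually_at_filter recip_weight_def)
    ultimately have r: "(recip_weight w \<longlongrightarrow> 0) (at_right 0)"
      using Lim_transform_eventually by blast
    have "\<forall>\<^sub>F z in at_left 0. 0 = recip_weight w z"
      by (auto simp: eventually_at_filter recip_weight_def)
    then have l: "(recip_weight w \<longlongrightarrow> 0) (at_left 0)"
      using Lim_transform_eventually tendsto_const by blast
    show ?thesis
      using filterlim_split_at[OF l r] 3 by (simp add: isCont_def recip_weight_def)
  qed
qed

definition I0 :: "(real \<Rightarrow> real) \<Rightarrow> ('a \<times> real \<Rightarrow> real) \<Rightarrow> 'a \<Rightarrow> real \<Rightarrow> real" where
  "I0 w u x \<delta> = (LINT y:{\<delta>..1}|interval_measure (recip_weight w). u (x, y))"

end

theory Submission
  imports Defs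
begin

text \<open>
  Choose heights \<open>d j\<close> with \<open>w (d j) = \<theta> ^ j\<close>. Divided by \<open>K\<close>, the part of \<open>I0\<close> between
  consecutive heights is the boundary value of the harmonic function
  \<open>f j (x, t) = \<integral> u (x, y + t) d(1/w(y)) / K\<close>, which is bounded over \<open>S\<close>, decays geometrically in \<open>j\<close> at
  heights \<open>t\<close> far above \<open>d j\<close>, and has gradient \<open>O(1 / d (j + 1))\<close>. Hence the \<open>f j\<close> behave like
  bounded, weakly dependent random variables: for small \<open>l\<close> the exponential \<open>exp (l * F)\<close> of
  \<open>F = f a + \<dots> + f (b - 1)\<close> becomes superharmonic after adding to the exponent an explicit correction
  of size \<open>O(l\<^sup>2 (b - a))\<close>. The minimum principle on the sawtooth domain over the set where the
  partial sums are too large then plays the role of Chebyshev's inequality, a chaining through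
  base 16 digits replaces the maximal inequality, and a Borel-Cantelli
  argument at a point of near-full density gives the iterated logarithm.
\<close>

section \<open>Second-order jets and Laplacians\<close>

text \<open>If \<open>F\<close> is harmonic, \<open>exp (l * F)\<close> is subharmonic: its
  Laplacian contains \<open>l\<^sup>2\<close> times the squared gradient of \<open>F\<close>. No
  mean value bound for exponential moments comes for free, and this term is what the correction in
  the exponent has to cancel. Moreover the layers are controlled only inside the cones over
  \<open>S\<close>, so the estimate must stay in the sawtooth region, and escape through its sides
  is charged to a Poisson barrier. The analytic input is reduced to the second derivative test at a
  minimum, for which derivatives along coordinate lines at a single point suffice.

  Scales: \<open>w\<close> gains a factor \<theta> per layer, so \<open>N\<close> layers correspond
  to log w(\<delta>) of order \<open>N\<close>. In the block from \<open>16 ^ i\<close> to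
  \<open>16 ^ Suc i\<close> the target is \<open>4 ^ i * sqrt (ln i)\<close>, and the triple
  logarithm is \<open>ln i\<close> because only the block index \<open>i\<close> has to be summed
  over: the failure bound at the apex is a constant times \<open>1 / i ^ 2\<close>. Dividing by
  \<open>K\<close> leaves constants that depend on \<theta>, \<open>M\<close> and the dimension
  only.\<close>

definition jet :: "(real \<Rightarrow> real) \<Rightarrow> real \<Rightarrow> real \<Rightarrow> bool" where
  "jet \<phi> p q \<longleftrightarrow> (\<exists>\<phi>'. (\<forall>\<^sub>F s in nhds 0. (\<phi> has_real_derivative \<phi>' s) (at s)) \<and> \<phi>' 0 = p \<and>
     (\<phi>' has_real_derivative q) (at 0))"

lemma jetI:
  assumes "\<forall>\<^sub>F s in nhds 0. (\<phi> has_real_derivative \<phi>' s) (at s)" "\<phi>' 0 = p"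
    "(\<phi>' has_real_derivative q) (at 0)"
  shows "jet \<phi> p q"
  using assms unfolding jet_def by blast

lemma jet_DERIV: "jet \<phi> p q \<Longrightarrow> (\<phi> has_real_derivative p) (at 0)"
  unfolding jet_def using eventually_nhds_x_imp_x by blast

lemma jet_const: "jet (\<lambda>_. c) 0 0"
  by (rule jetI[of _ "\<lambda>_. 0"]) auto

lemma jet_affine: "jet (\<lambda>s. c + s * e) e 0"
  by (rule jetI[of _ "\<lambda>_. e"]) (auto intro!: derivative_eq_intros always_eventually)

lemma jet_add:
  assumes "jet \<phi> p q" "jet \<psi> p' q'"
  shows "jet (\<lambda>s. \<phi> s + \<psi> s) (p + p') (q + q')"
proof -
  obtain f g where f: "\<forall>\<^sub>F s in nhds 0. (\<phi> has_real_derivative f s) (at s)" "f 0 = p"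
      "(f has_real_derivative q) (at 0)"
    and g: "\<forall>\<^sub>F s in nhds 0. (\<psi> has_real_derivative g s) (at s)" "g 0 = p'"
      "(g has_real_derivative q') (at 0)"
    using assms unfolding jet_def by blast
  show ?thesis
  proof (rule jetI)
    show "\<forall>\<^sub>F s in nhds 0. ((\<lambda>s. \<phi> s + \<psi> s) has_real_derivative (f s + g s)) (at s)"
      using f(1) g(1) by eventually_elim (rule DERIV_add)
  qed (auto simp: f g intro!: DERIV_add)
qed

lemma jet_mult:
  assumes "jet \<phi> p q" "jet \<psi> p' q'"
  shows "jet (\<lambda>s. \<phi> s * \<psi> s) (p * \<psi> 0 + \<phi> 0 * p') (q * \<psi> 0 + 2 * p * p' + \<phi> 0 * q')"
proof -
  obtain f g where f: "\<forall>\<^sub>F s in nhds 0. (\<phi> has_real_derivative f s) (at s)" "f 0 = p"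
      "(f has_real_derivative q) (at 0)"
    and g: "\<forall>\<^sub>F s in nhds 0. (\<psi> has_real_derivative g s) (at s)" "g 0 = p'"
      "(g has_real_derivative q') (at 0)"
    using assms unfolding jet_def by blast
  show ?thesis
  proof (rule jetI)
    show "\<forall>\<^sub>F s in nhds 0. ((\<lambda>s. \<phi> s * \<psi> s) has_real_derivative (f s * \<psi> s + \<phi> s * g s)) (at s)"
      using f(1) g(1) by eventually_elim (auto intro!: derivative_eq_intros)
    show "((\<lambda>s. f s * \<psi> s + \<phi> s * g s) has_real_derivative
        (q * \<psi> 0 + 2 * p * p' + \<phi> 0 * q')) (at 0)"
      using f(2) g(2)
      by (auto intro!: derivative_eq_intros f(3) g(3) jet_DERIV[OF assms(1)] jet_DERIV[OF assms(2)]
          simp: algebra_simps)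
  qed (auto simp: f g)
qed

lemma jet_compose:
  assumes j: "jet \<phi> p q" and g: "\<forall>\<^sub>F y in nhds (\<phi> 0). (g has_real_derivative g' y) (at y)"
    and g': "(g' has_real_derivative r) (at (\<phi> 0))"
  shows "jet (\<lambda>s. g (\<phi> s)) (g' (\<phi> 0) * p) (r * p\<^sup>2 + g' (\<phi> 0) * q)"
proof -
  obtain f where f: "\<forall>\<^sub>F s in nhds 0. (\<phi> has_real_derivative f s) (at s)" "f 0 = p"
      "(f has_real_derivative q) (at 0)"
    using j unfolding jet_def by blast
  have D: "(\<phi> has_real_derivative p) (at 0)" by (rule jet_DERIV[OF j])
  have "filterlim \<phi> (nhds (\<phi> 0)) (nhds 0)"
    using DERIV_isCont[OF D] by (simp add: continuous_within tendsto_at_iff_tendsto_nhds)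
  then have ev: "\<forall>\<^sub>F s in nhds 0. (g has_real_derivative g' (\<phi> s)) (at (\<phi> s))"
    using g by (rule eventually_compose_filterlim[rotated])
  show ?thesis
  proof (rule jetI)
    show "\<forall>\<^sub>F s in nhds 0. ((\<lambda>s. g (\<phi> s)) has_real_derivative (g' (\<phi> s) * f s)) (at s)"
      using ev f(1) by eventually_elim (rule DERIV_chain2)
    have "((\<lambda>s. g' (\<phi> s)) has_real_derivative (r * p)) (at 0)"
      by (rule DERIV_chain2[OF g' D])
    then show "((\<lambda>s. g' (\<phi> s) * f s) has_real_derivative (r * p\<^sup>2 + g' (\<phi> 0) * q)) (at 0)"
      using f by (auto intro!: derivative_eq_intros simp: power2_eq_square)
  qed (simp add: f)
qed

lemma jet_reflect: "jet \<phi> p q \<Longrightarrow> jet (\<lambda>s. \<phi> (- s)) (- p) q"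
proof -
  assume "jet \<phi> p q"
  then obtain f where f: "\<forall>\<^sub>F s in nhds 0. (\<phi> has_real_derivative f s) (at s)" "f 0 = p"
      "(f has_real_derivative q) (at 0)"
    unfolding jet_def by blast
  have "((\<lambda>s::real. - s) \<longlongrightarrow> - 0) (nhds 0)" by (intro tendsto_intros filterlim_ident)
  then have "filterlim (\<lambda>s::real. - s) (nhds 0) (nhds 0)" by simp
  then have ev: "\<forall>\<^sub>F s in nhds 0. (\<phi> has_real_derivative f (- s)) (at (- s))"
    using f(1) by (rule eventually_compose_filterlim[rotated])
  show ?thesis
  proof (rule jetI)
    show "\<forall>\<^sub>F s in nhds 0. ((\<lambda>s. \<phi> (- s)) has_real_derivative (- f (- s))) (at s)"
      using ev by eventually_elim (simp add: DERIV_mirror)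
    show "((\<lambda>s. - f (- s)) has_real_derivative q) (at 0)"
      using f(3) DERIV_mirror[of f q 0] DERIV_minus[of "\<lambda>s. f (- s)" "- q" 0] by simp
  qed (simp add: f)
qed

lemma jet_local_min:
  assumes j: "jet \<phi> p q" and min: "\<forall>\<^sub>F s in nhds 0. \<phi> 0 \<le> \<phi> s"
  shows "p = 0" "0 \<le> q"
proof -
  obtain f where f: "\<forall>\<^sub>F s in nhds 0. (\<phi> has_real_derivative f s) (at s)" "f 0 = p"
      "(f has_real_derivative q) (at 0)"
    using j unfolding jet_def by blast
  obtain d where d: "d > 0" "\<And>s. \<bar>s\<bar> < d \<Longrightarrow> \<phi> 0 \<le> \<phi> s \<and> (\<phi> has_real_derivative f s) (at s)"
    using eventually_conj[OF min f(1)] unfolding eventually_nhds_metric by (auto simp: dist_real_def)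
  show p: "p = 0"
    by (rule DERIV_local_min[OF jet_DERIV[OF j] d(1)]) (use d in auto)
  show "0 \<le> q"
  proof (rule ccontr)
    assume "\<not> 0 \<le> q"
    then obtain e where e: "e > 0" "\<And>h. h > 0 \<Longrightarrow> h < e \<Longrightarrow> f h < 0"
      using DERIV_neg_dec_right[OF f(3)] f(2) p by auto
    define h where "h = min d e / 2"
    have h: "h > 0" "h < d" "h < e" using d(1) e(1) by (auto simp: h_def min_def)
    have "\<exists>z>0. z < h \<and> \<phi> h - \<phi> 0 = (h - 0) * f z"
      by (rule MVT2[OF h(1)]) (use d(2) h in auto)
    then obtain z where z: "0 < z" "z < h" "\<phi> h - \<phi> 0 = h * f z" by auto
    have "h * f z < 0" using e(2)[of z] z h by (simp add: mult_pos_neg)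
    then show False using z(3) d(2)[of h] h by auto
  qed
qed

text \<open>Records just what the second derivative test sees: jets along the coordinate lines
  through one point, with \<open>p\<close> the gradient on \<open>Basis\<close> and \<open>L\<close>
  the trace of the Hessian. Sums, products and compositions then reduce to one-variable
  calculus.\<close>

definition has_lap :: "('a::euclidean_space \<Rightarrow> real) \<Rightarrow> 'a \<Rightarrow> ('a \<Rightarrow> real) \<Rightarrow> real \<Rightarrow> bool" where
  "has_lap h z p L \<longleftrightarrow>
     (\<exists>q. (\<forall>b\<in>Basis. jet (\<lambda>s. h (z + s *\<^sub>R b)) (p b) (q b)) \<and> (\<Sum>b\<in>Basis. q b) = L)"

lemma has_lapI:
  "(\<And>b. b \<in> Basis \<Longrightarrow> jet (\<lambda>s. h (z + s *\<^sub>R b)) (p b) (q b)) \<Longrightarrow> has_lap h z p (\<Sum>b\<in>Basis. q b)"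
  unfolding has_lap_def by (intro exI[of _ q] conjI ballI refl)

lemma has_lap_const: "has_lap (\<lambda>_. c) z (\<lambda>_. 0) 0"
  using has_lapI[of "\<lambda>_. c" z "\<lambda>_. 0" "\<lambda>_. 0"] jet_const by simp

lemma has_lap_add:
  assumes "has_lap h z p L" "has_lap k z r M"
  shows "has_lap (\<lambda>z. h z + k z) z (\<lambda>b. p b + r b) (L + M)"
proof -
  obtain q q' where "\<forall>b\<in>Basis. jet (\<lambda>s. h (z + s *\<^sub>R b)) (p b) (q b)" "(\<Sum>b\<in>Basis. q b) = L"
    "\<forall>b\<in>Basis. jet (\<lambda>s. k (z + s *\<^sub>R b)) (r b) (q' b)" "(\<Sum>b\<in>Basis. q' b) = M"
    using assms unfolding has_lap_def by blast
  then show ?thesis unfolding has_lap_def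
    by (intro exI[of _ "\<lambda>b. q b + q' b"]) (auto intro: jet_add simp: sum.distrib)
qed

lemma has_lap_mult:
  assumes "has_lap h z p L" "has_lap k z r M"
  shows "has_lap (\<lambda>z. h z * k z) z (\<lambda>b. p b * k z + h z * r b)
    (L * k z + 2 * (\<Sum>b\<in>Basis. p b * r b) + h z * M)"
proof -
  obtain q q' where q: "\<forall>b\<in>Basis. jet (\<lambda>s. h (z + s *\<^sub>R b)) (p b) (q b)" "(\<Sum>b\<in>Basis. q b) = L"
    "\<forall>b\<in>Basis. jet (\<lambda>s. k (z + s *\<^sub>R b)) (r b) (q' b)" "(\<Sum>b\<in>Basis. q' b) = M"
    using assms unfolding has_lap_def by blast
  have "jet (\<lambda>s. h (z + s *\<^sub>R b) * k (z + s *\<^sub>R b)) (p b * k z + h z * r b)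
      (q b * k z + 2 * p b * r b + h z * q' b)" if "b \<in> Basis" for b
    using jet_mult[OF q(1)[rule_format, OF that] q(3)[rule_format, OF that]] by simp
  from has_lapI[of "\<lambda>z. h z * k z", OF this] show ?thesis
    unfolding q(2)[symmetric] q(4)[symmetric]
    by (simp add: sum.distrib sum_distrib_left sum_distrib_right mult.assoc)
qed

lemma has_lap_cmult: "has_lap h z p L \<Longrightarrow> has_lap (\<lambda>z. c * h z) z (\<lambda>b. c * p b) (c * L)"
proof -
  assume "has_lap h z p L"
  from has_lap_mult[OF has_lap_const[of c z] this]
  show "has_lap (\<lambda>z. c * h z) z (\<lambda>b. c * p b) (c * L)" by simp
qed

lemma has_lap_sum:
  assumes "\<And>i. i \<in> I \<Longrightarrow> has_lap (h i) z (p i) (L i)"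
  shows "has_lap (\<lambda>z. \<Sum>i\<in>I. h i z) z (\<lambda>b. \<Sum>i\<in>I. p i b) (sum L I)"
  using assms
  by (induction I rule: infinite_finite_induct) (auto intro!: has_lap_const has_lap_add)

lemma has_lap_compose:
  assumes "has_lap h z p L" "\<forall>\<^sub>F y in nhds (h z). (g has_real_derivative g' y) (at y)"
    "(g' has_real_derivative r) (at (h z))"
  shows "has_lap (\<lambda>z. g (h z)) z (\<lambda>b. g' (h z) * p b) (r * (\<Sum>b\<in>Basis. (p b)\<^sup>2) + g' (h z) * L)"
proof -
  obtain q where q: "\<forall>b\<in>Basis. jet (\<lambda>s. h (z + s *\<^sub>R b)) (p b) (q b)" "(\<Sum>b\<in>Basis. q b) = L"
    using assms(1) unfolding has_lap_def by blast
  have "jet (\<lambda>s. g (h (z + s *\<^sub>R b))) (g' (h z) * p b) (r * (p b)\<^sup>2 + g' (h z) * q b)"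
    if "b \<in> Basis" for b
    using jet_compose[OF q(1)[rule_format, OF that], of g g' r] assms(2,3) by simp
  from has_lapI[of "\<lambda>z. g (h z)", OF this] show ?thesis
    unfolding q(2)[symmetric] by (simp add: sum.distrib sum_distrib_left)
qed

lemma has_lap_power:
  assumes "has_lap h z p L"
  shows "has_lap (\<lambda>z. h z ^ n) z (\<lambda>b. real n * h z ^ (n - 1) * p b)
    (real n * (real n - 1) * h z ^ (n - 2) * (\<Sum>b\<in>Basis. (p b)\<^sup>2) + real n * h z ^ (n - 1) * L)"
proof -
  have "((\<lambda>y. real n * y ^ (n - 1)) has_real_derivative real n * (real n - 1) * y ^ (n - 2)) (at y)" for y :: real
    by (cases n) (auto intro!: derivative_eq_intros simp: Suc_diff_Suc)
  then show ?thesis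
    by (intro has_lap_compose[OF assms, of "\<lambda>y. y ^ n"])
       (auto intro!: derivative_eq_intros always_eventually simp: mult.commute)
qed

lemma has_lap_exp:
  assumes "has_lap h z p L"
  shows "has_lap (\<lambda>z. exp (h z)) z (\<lambda>b. exp (h z) * p b) (exp (h z) * (L + (\<Sum>b\<in>Basis. (p b)\<^sup>2)))"
proof -
  have "has_lap (\<lambda>z. exp (h z)) z (\<lambda>b. exp (h z) * p b)
      (exp (h z) * (\<Sum>b\<in>Basis. (p b)\<^sup>2) + exp (h z) * L)"
    by (rule has_lap_compose[OF assms]) (rule always_eventually, rule allI, rule DERIV_exp, rule DERIV_exp)
  then show ?thesis by (simp only: distrib_left add.commute)
qed

lemma has_lap_shift: "has_lap h (z + a) p L \<Longrightarrow> has_lap (\<lambda>z. h (z + a)) z p L"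
proof -
  have "z + s *\<^sub>R b + a = z + a + s *\<^sub>R b" for s b by (simp add: algebra_simps)
  then show "has_lap h (z + a) p L \<Longrightarrow> has_lap (\<lambda>z. h (z + a)) z p L"
    unfolding has_lap_def by (simp only:)
qed

lemma has_lap_inner: "has_lap (\<lambda>z. c + z \<bullet> e) z (\<lambda>b. b \<bullet> e) 0"
proof -
  have "jet (\<lambda>s. c + (z + s *\<^sub>R b) \<bullet> e) (b \<bullet> e) 0" for b
    using jet_affine[of "c + z \<bullet> e" "b \<bullet> e"] by (simp only: inner_add_left inner_scaleR_left add.assoc)
  from has_lapI[of "\<lambda>z. c + z \<bullet> e", OF this] show ?thesis by simp
qed

lemma has_lap_norm_sq:
  "has_lap (\<lambda>z::'a::euclidean_space. (norm z)\<^sup>2) z (\<lambda>b. 2 * (z \<bullet> b)) (2 * real DIM('a))"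
proof -
  have "jet (\<lambda>s. (norm (z + s *\<^sub>R b))\<^sup>2) (2 * (z \<bullet> b)) 2" if "b \<in> Basis" for b
  proof (rule jetI)
    have *: "(norm (z + s *\<^sub>R b))\<^sup>2 = (norm z)\<^sup>2 + 2 * s * (z \<bullet> b) + s\<^sup>2" for s
    proof -
      have "b \<bullet> b = 1" using that by simp
      then show ?thesis
        unfolding power2_norm_eq_inner inner_add_left inner_add_right inner_scaleR_left
          inner_scaleR_right inner_commute[of b z]
        by (simp add: power2_eq_square distrib_left)
    qed
    show "\<forall>\<^sub>F s in nhds 0. ((\<lambda>s. (norm (z + s *\<^sub>R b))\<^sup>2) has_real_derivative 2 * (z \<bullet> b) + 2 * s) (at s)"
    unfolding * by (intro always_eventually allI) (auto intro!: derivative_eq_intros)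
    show "2 * (z \<bullet> b) + 2 * 0 = 2 * (z \<bullet> b)" by simp
    show "((\<lambda>s. 2 * (z \<bullet> b) + 2 * s) has_real_derivative 2) (at 0)"
      by (auto intro!: derivative_eq_intros)
  qed
  from has_lapI[of "\<lambda>z. (norm z)\<^sup>2", OF this] show ?thesis by (simp add: mult.commute)
qed

lemma has_lap_min:
  assumes "has_lap h z p L" "\<forall>\<^sub>F x in nhds z. h z \<le> h x"
  shows "0 \<le> L"
proof -
  obtain q where q: "\<forall>b\<in>Basis. jet (\<lambda>s. h (z + s *\<^sub>R b)) (p b) (q b)" "(\<Sum>b\<in>Basis. q b) = L"
    using assms(1) unfolding has_lap_def by blast
  have "0 \<le> q b" if "b \<in> Basis" for b
  proof (rule jet_local_min(2)[OF q(1)[rule_format, OF that]])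
    have "filterlim (\<lambda>s. z + s *\<^sub>R b) (nhds (z + 0 *\<^sub>R b)) (nhds 0)"
      by (intro tendsto_intros filterlim_ident)
    then have "filterlim (\<lambda>s. z + s *\<^sub>R b) (nhds z) (nhds 0)" by simp
    from eventually_compose_filterlim[OF assms(2) this]
    show "\<forall>\<^sub>F s in nhds 0. h (z + 0 *\<^sub>R b) \<le> h (z + s *\<^sub>R b)" by simp
  qed
  then show ?thesis using q(2) by (auto intro: sum_nonneg)
qed

text \<open>A negative global minimum would be interior with strictly negative Laplacian, against
  the second derivative test. Asking for strictness avoids any perturbation argument; in the
  applications a quadratic barrier supplies it.\<close>

lemma minimum_principle:
  fixes h :: "'a::euclidean_space \<Rightarrow> real"
  assumes "compact D" "continuous_on D h"
    and alt: "\<And>z. z \<in> D \<Longrightarrow> 0 \<le> h z \<or> (z \<in> interior D \<and> (\<exists>p L. has_lap h z p L \<and> L < 0))"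
    and "x \<in> D"
  shows "0 \<le> h x"
proof -
  obtain z where z: "z \<in> D" "\<And>y. y \<in> D \<Longrightarrow> h z \<le> h y"
    using continuous_attains_inf[OF assms(1) _ assms(2)] \<open>x \<in> D\<close> by blast
  have "0 \<le> h z"
  proof (rule ccontr)
    assume "\<not> 0 \<le> h z"
    then obtain p L where L: "z \<in> interior D" "has_lap h z p L" "L < 0" using alt[OF z(1)] by auto
    have "\<forall>\<^sub>F y in nhds z. h z \<le> h y"
      using eventually_nhds_in_open[OF open_interior L(1)] interior_subset z(2)
      by (auto elim!: eventually_mono)
    from has_lap_min[OF L(2) this] L(3) show False by simp
  qed
  then show ?thesis using z(2)[OF \<open>x \<in> D\<close>] by simp
qed

section \<open>Interior gradient estimate for harmonic functions\<close>

text \<open>The reflection negates the coordinate along \<open>b\<close>, so only the jet along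
  \<open>b\<close> changes, by reversing its parameter: the first derivative flips sign, the second
  does not.\<close>

lemma has_lap_reflect:
  fixes h :: "'a::euclidean_space \<Rightarrow> real"
  assumes b: "b \<in> Basis" and "has_lap h (z + (x - (2 * (x \<bullet> b)) *\<^sub>R b)) p L"
  shows "\<exists>p'. has_lap (\<lambda>x. h (z + (x - (2 * (x \<bullet> b)) *\<^sub>R b))) x p' L"
proof -
  define r where "r x = x - (2 * (x \<bullet> b)) *\<^sub>R b" for x
  obtain q where q: "\<And>c. c \<in> Basis \<Longrightarrow> jet (\<lambda>s. h (z + r x + s *\<^sub>R c)) (p c) (q c)"
      "(\<Sum>b\<in>Basis. q b) = L"
    using assms(2) unfolding has_lap_def r_def by blast
  have "jet (\<lambda>s. h (z + r (x + s *\<^sub>R c))) (if c = b then - p b else p c) (q c)"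
    if c: "c \<in> Basis" for c
  proof (cases "c = b")
    case True
    have "z + r x + (- s) *\<^sub>R b = z + r (x + s *\<^sub>R c)" for s
      using b True by (simp add: r_def inner_add_left algebra_simps flip: scaleR_add_left)
    note eq = this
    from jet_reflect[OF q(1)[OF b]] show ?thesis unfolding eq using True by simp
  next
    case False
    have "z + r x + s *\<^sub>R c = z + r (x + s *\<^sub>R c)" for s
      using b c False by (simp add: r_def inner_add_left inner_not_same_Basis algebra_simps)
    note eq = this
    from q(1)[OF c] show ?thesis unfolding eq using False by simp
  qed
  from has_lapI[of "\<lambda>x. h (z + r x)", OF this] show ?thesis
    unfolding q(2) r_def by blast
qed

text \<open>
  The difference of \<open>h\<close> and its reflection is compared on a half ball with an explicit
  superharmonic barrier vanishing at the centre to first order.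
\<close>

lemma gradient_bound:
  fixes h :: "'a::euclidean_space \<Rightarrow> real"
  assumes d: "d > 0" and A: "A > 0" and bd: "\<And>y. norm y \<le> d \<Longrightarrow> \<bar>h (z + y)\<bar> \<le> A"
    and harm: "\<And>y. norm y \<le> d \<Longrightarrow> \<exists>p. has_lap h (z + y) p 0"
    and cont: "continuous_on (cball z d) h"
    and lap: "has_lap h z p L" and b: "b \<in> Basis"
  shows "\<bar>p b\<bar> \<le> (real DIM('a) + 1) * A / d"
proof -
  define N where "N = real DIM('a) + 1"
  define r where "r x = x - (2 * (x \<bullet> b)) *\<^sub>R b" for x
  \<comment> \<open>The odd part of \<open>h\<close> under the reflection vanishes on the flat face
    \<open>x \<bullet> b = 0\<close> and has the same derivative along \<open>b\<close> at the
    centre as \<open>h\<close>.\<close>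
  define \<phi> where "\<phi> x = (h (z + x) + (- 1) * h (z + r x)) / 2" for x
  \<comment> \<open>The Laplacian of this barrier is \<open>- 2 * A / d\<^sup>2\<close>, because
    \<open>N\<close> exceeds the dimension by one. The barrier is nonnegative on the flat face, at
    least \<open>A\<close> on the sphere, and at most \<open>N * A / d * s\<close> at
    \<open>s *\<^sub>R b\<close>, which is the slope claimed.\<close>
  define \<psi> where "\<psi> x = (A / d\<^sup>2) * ((norm x)\<^sup>2 + (0 + x \<bullet> (N *\<^sub>R b)) * (d + x \<bullet> (- b)))" for x
  define D where "D = {x. norm x \<le> d \<and> 0 \<le> x \<bullet> b}"
  have bb: "b \<bullet> b = 1" "norm b = 1" using b by auto
  have N: "N \<ge> 1" by (simp add: N_def)
  have nr: "norm (r x) = norm x" for x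
  proof -
    have "(norm (r x))\<^sup>2 = (norm x)\<^sup>2"
      unfolding power2_norm_eq_inner r_def using bb(1)
      by (simp add: inner_diff_left inner_diff_right inner_commute[of b x])
    then show ?thesis by simp
  qed
  have continuous_on_r: "continuous_on X r" for X :: "'a set" unfolding r_def by (intro continuous_intros)
  have compact: "compact D"
  proof -
    have "D = cball 0 d \<inter> {x. 0 \<le> b \<bullet> x}" by (auto simp: D_def inner_commute)
    then show ?thesis by (auto intro!: compact_Int_closed closed_halfspace_ge)
  qed
  have phib: "\<bar>\<phi> x\<bar> \<le> A" if "norm x \<le> d" for x
    using bd[OF that] bd[of "r x"] that by (simp add: nr \<phi>_def abs_le_iff)
  have main: "0 \<le> \<psi> x + \<sigma> * \<phi> x" if x: "x \<in> D" and \<sigma>: "\<bar>\<sigma>\<bar> = 1" for x \<sigma>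
  proof (rule minimum_principle[OF compact _ _ x])
    have c1: "continuous_on D (\<lambda>x. h (z + x))"
      by (rule continuous_on_compose2[OF cont]) (auto intro!: continuous_intros simp: D_def dist_norm)
    have c2: "continuous_on D (\<lambda>x. h (z + r x))"
      by (rule continuous_on_compose2[OF cont])
         (auto intro!: continuous_intros continuous_on_r simp: D_def dist_norm nr)
    show "continuous_on D (\<lambda>x. \<psi> x + \<sigma> * \<phi> x)"
      unfolding \<psi>_def \<phi>_def by (intro continuous_intros c1 c2) auto
  next
    fix x assume x: "x \<in> D"
    have s: "- \<bar>\<phi> x\<bar> \<le> \<sigma> * \<phi> x" using \<sigma> by (auto simp: abs_if split: if_splits)
    consider "x \<bullet> b = 0" | "norm x = d" | "norm x < d" "0 < x \<bullet> b" using x by (force simp: D_def)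
    then show "0 \<le> \<psi> x + \<sigma> * \<phi> x \<or>
        (x \<in> interior D \<and> (\<exists>p L. has_lap (\<lambda>x. \<psi> x + \<sigma> * \<phi> x) x p L \<and> L < 0))"
    proof cases
      case 1
      then show ?thesis using A by (simp add: \<psi>_def \<phi>_def r_def)
    next
      case 2
      have "x \<bullet> b \<le> d" using Cauchy_Schwarz_ineq2[of x b] bb 2 by simp
      then have "(norm x)\<^sup>2 + N * (x \<bullet> b) * (d - x \<bullet> b) \<ge> d\<^sup>2"
        using 2 x N by (auto simp: D_def)
      then have "(A / d\<^sup>2) * ((norm x)\<^sup>2 + N * (x \<bullet> b) * (d - x \<bullet> b)) \<ge> (A / d\<^sup>2) * d\<^sup>2"
        using A by (intro mult_left_mono) auto
      then have "\<psi> x \<ge> A" using d by (simp add: \<psi>_def)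
      then show ?thesis using phib[of x] 2 s by auto
    next
      case 3
      have "open ({x::'a. norm x < d} \<inter> {x. 0 < b \<bullet> x})"
        by (intro open_Int open_halfspace_gt open_Collect_less continuous_intros)
      then have int: "x \<in> interior D"
        by (rule interiorI) (use 3 in \<open>auto simp: D_def inner_commute\<close>)
      have psi: "\<exists>p. has_lap \<psi> x p ((A / d\<^sup>2) * (2 * real DIM('a) - 2 * N))"
      proof -
        have "has_lap \<psi> x (\<lambda>c. (A / d\<^sup>2) * (2 * (x \<bullet> c) +
            ((c \<bullet> (N *\<^sub>R b)) * (d + x \<bullet> (- b)) + (0 + x \<bullet> (N *\<^sub>R b)) * (c \<bullet> (- b)))))
          ((A / d\<^sup>2) * (2 * real DIM('a) +
            (0 * (d + x \<bullet> (- b)) + 2 * (\<Sum>c\<in>Basis. (c \<bullet> (N *\<^sub>R b)) * (c \<bullet> (- b)))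
              + (0 + x \<bullet> (N *\<^sub>R b)) * 0)))"
          unfolding \<psi>_def by (intro has_lap_cmult has_lap_add has_lap_norm_sq has_lap_mult has_lap_inner)
        moreover have "(\<Sum>c\<in>Basis. (c \<bullet> (N *\<^sub>R b)) * (c \<bullet> (- b))) = - N"
        proof -
          have "(\<Sum>c\<in>Basis. (c \<bullet> (N *\<^sub>R b)) * (c \<bullet> (- b))) = (\<Sum>c\<in>Basis. if c = b then - N else 0)"
            using b by (intro sum.cong) (auto simp: inner_Basis)
          then show ?thesis using b by simp
        qed
        ultimately show ?thesis by auto
      qed
      obtain p1 where p1: "has_lap h (z + x) p1 0" using harm[of x] 3 by auto
      obtain p2 where "has_lap h (z + r x) p2 0" using harm[of "r x"] 3 nr by auto
      then obtain p3 where p3: "has_lap (\<lambda>x. h (z + r x)) x p3 0"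
        using has_lap_reflect[OF b] unfolding r_def by blast
      have p1': "has_lap (\<lambda>x. h (z + x)) x p1 0"
        using has_lap_shift[of h x z] p1 by (simp add: add.commute)
      have "\<exists>p. has_lap \<phi> x p 0"
        using has_lap_cmult[OF has_lap_add[OF p1' has_lap_cmult[OF p3, of "- 1"]], of "1/2"]
        unfolding \<phi>_def by auto
      then obtain p4 p5 where "has_lap \<phi> x p4 0"
        "has_lap \<psi> x p5 ((A / d\<^sup>2) * (2 * real DIM('a) - 2 * N))" using psi by blast
      then have "has_lap (\<lambda>x. \<psi> x + \<sigma> * \<phi> x) x (\<lambda>b. p5 b + \<sigma> * p4 b)
          ((A / d\<^sup>2) * (2 * real DIM('a) - 2 * N) + \<sigma> * 0)"
        by (intro has_lap_add has_lap_cmult)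
      moreover have "(A / d\<^sup>2) * (2 * real DIM('a) - 2 * N) + \<sigma> * 0 < 0"
        using A d by (simp add: N_def mult_pos_neg)
      ultimately show ?thesis using int by blast
    qed
  qed
  have key: "\<bar>\<phi> (s *\<^sub>R b)\<bar> \<le> N * A / d * s" if s: "0 \<le> s" "s \<le> d" for s
  proof -
    have "s *\<^sub>R b \<in> D" using s bb by (simp add: D_def)
    from main[OF this, of 1] main[OF this, of "- 1"] have "\<bar>\<phi> (s *\<^sub>R b)\<bar> \<le> \<psi> (s *\<^sub>R b)" by auto
    also have "\<psi> (s *\<^sub>R b) = (A / d\<^sup>2) * (s\<^sup>2 + N * s * (d - s))"
      using bb by (simp add: \<psi>_def)
    also have "\<dots> \<le> (A / d\<^sup>2) * (N * s * d)"
    proof (rule mult_left_mono)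
      have "s\<^sup>2 \<le> N * s\<^sup>2" using N mult_right_mono[of 1 N "s\<^sup>2"] by simp
      then show "s\<^sup>2 + N * s * (d - s) \<le> N * s * d" by (simp add: algebra_simps power2_eq_square)
    qed (use A in auto)
    also have "\<dots> = N * A / d * s" using d by (simp add: power2_eq_square)
    finally show ?thesis .
  qed
  have j: "((\<lambda>s. h (z + s *\<^sub>R b)) has_real_derivative p b) (at 0)"
    using lap b unfolding has_lap_def using jet_DERIV by blast
  then have j': "((\<lambda>s. h (z + (- s) *\<^sub>R b)) has_real_derivative - p b) (at 0)"
    using DERIV_mirror[of "\<lambda>s. h (z + s *\<^sub>R b)" "p b" 0] by simp
  have "r (s *\<^sub>R b) = (- s) *\<^sub>R b" for s
    using bb by (simp add: r_def algebra_simps flip: scaleR_add_left)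
  then have "(\<lambda>s. \<phi> (s *\<^sub>R b)) = (\<lambda>s. (h (z + s *\<^sub>R b) + (- 1) * h (z + (- s) *\<^sub>R b)) / 2)"
    by (simp only: \<phi>_def)
  moreover have "((\<lambda>s. (h (z + s *\<^sub>R b) + (- 1) * h (z + (- s) *\<^sub>R b)) / 2) has_real_derivative
      (p b + (- 1) * (- p b)) / 2) (at 0)"
    by (rule DERIV_cdivide[OF DERIV_add[OF j DERIV_cmult[OF j']]])
  ultimately have "((\<lambda>s. \<phi> (s *\<^sub>R b)) has_real_derivative p b) (at 0)" by simp
  then have "((\<lambda>s. (\<phi> (s *\<^sub>R b) - \<phi> (0 *\<^sub>R b)) / (s - 0)) \<longlongrightarrow> p b) (at_right 0)"
    unfolding has_field_derivative_iff using filterlim_at_split by blast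
  then have lim: "((\<lambda>s. \<bar>\<phi> (s *\<^sub>R b) / s\<bar>) \<longlongrightarrow> \<bar>p b\<bar>) (at_right 0)"
    by (intro tendsto_rabs) (simp add: \<phi>_def r_def)
  have "\<bar>p b\<bar> \<le> N * A / d"
  proof (rule tendsto_upperbound[OF lim])
    have "\<forall>\<^sub>F s in at_right 0. s \<in> {0<..<d}" using d by (rule eventually_at_right_real)
    then show "\<forall>\<^sub>F s in at_right 0. \<bar>\<phi> (s *\<^sub>R b) / s\<bar> \<le> N * A / d"
    proof eventually_elim
      case (elim s)
      then show ?case using key[of s] by (simp add: abs_divide pos_divide_le_eq)
    qed
  qed simp
  then show ?thesis by (simp add: N_def)
qed

section \<open>The superharmonic exponential\<close>

text \<open>Since the scales at least halve, each new summand is at most the increment of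
  \<open>2 / (t + d k)\<close>, and the sum telescopes. The summands are the derivatives in
  \<open>t\<close> of \<open>t / (t + d j)\<close>.\<close>

lemma sum_scales_le:
  fixes d :: "nat \<Rightarrow> real"
  assumes pos: "\<And>k. d k > 0" and half: "\<And>k. d (Suc k) \<le> d k / 2" and t: "t \<ge> 0" and "a \<le> k"
  shows "(\<Sum>j=a..k. d j / (t + d j)\<^sup>2) \<le> 2 / (t + d k)"
  using \<open>a \<le> k\<close>
proof (induction k rule: dec_induct)
  case base
  show ?case using pos[of a] t by (simp add: divide_simps power2_eq_square)
next
  case (step k)
  define x y where "x = d k" and "y = d (Suc k)"
  have xy: "y > 0" "2 * y \<le> x" using pos[of "Suc k"] half[of k] by (auto simp: x_def y_def)
  have "(t + x) * y \<le> 2 * (x - y) * (t + y)"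
  proof -
    have "2 * y * t \<le> x * t" "2 * y * y \<le> x * y" "0 \<le> y * t"
      using xy t by (auto intro!: mult_right_mono mult_nonneg_nonneg)
    then show ?thesis by (simp add: algebra_simps)
  qed
  then have "y / (t + y)\<^sup>2 \<le> 2 * (x - y) / ((t + x) * (t + y))"
    using xy t by (simp add: frac_le_eq divide_simps power2_eq_square) (simp add: mult_ac mult_left_mono)
  also have "\<dots> = 2 / (t + y) - 2 / (t + x)"
    using xy t by (simp add: divide_simps)
  finally show ?case using step by (simp add: x_def y_def)
qed

text \<open>Bounds the squared gradient of a sum of height profiles by their total concavity, so
  that the first part of \<open>corrector\<close> can absorb its own gradient. One more scale adds a
  cross term of at most four and a square of at most one new summand, hence the factor 5.\<close>

lemma sum_scales_sq_le:
  fixes d :: "nat \<Rightarrow> real"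
  assumes pos: "\<And>k. d k > 0" and half: "\<And>k. d (Suc k) \<le> d k / 2" and t: "t \<ge> 0" and "a \<le> k"
  shows "(\<Sum>j=a..k. d j / (t + d j)\<^sup>2)\<^sup>2 \<le> 5 * (\<Sum>j=a..k. d j / (t + d j) ^ 3)"
  using \<open>a \<le> k\<close>
proof (induction k rule: dec_induct)
  case base
  have "(d a / (t + d a)\<^sup>2)\<^sup>2 = (d a / (t + d a) ^ 3) * (d a / (t + d a))"
    using pos[of a] t by (simp add: divide_simps eval_nat_numeral)
  also have "\<dots> \<le> (d a / (t + d a) ^ 3) * 1"
    using pos[of a] t by (intro mult_left_mono) auto
  also have "\<dots> \<le> 5 * (d a / (t + d a) ^ 3)"
    using pos[of a] t by (simp add: divide_right_mono)
  finally show ?case by simp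
next
  case (step k)
  define S y where "S = (\<Sum>j=a..k. d j / (t + d j)\<^sup>2)" and "y = d (Suc k)"
  define e where "e = y / (t + y)\<^sup>2"
  have y: "y > 0" "y \<le> d k" using pos[of "Suc k"] half[of k] pos[of k] by (auto simp: y_def)
  have "S \<le> 2 / (t + d k)" unfolding S_def by (rule sum_scales_le[of d, OF pos half t]) (use step in auto)
  also have "\<dots> \<le> 2 / (t + y)" using y t by (intro divide_left_mono mult_pos_pos) auto
  finally have "S * e \<le> 2 / (t + y) * e" using y t by (intro mult_right_mono) (auto simp: e_def)
  also have "\<dots> = 2 * (y / (t + y) ^ 3)" using y t by (simp add: e_def eval_nat_numeral)
  finally have 1: "S * e \<le> 2 * (y / (t + y) ^ 3)" .
  have "e\<^sup>2 = (y / (t + y) ^ 3) * (y / (t + y))"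
    using y t by (simp add: e_def divide_simps eval_nat_numeral)
  also have "\<dots> \<le> (y / (t + y) ^ 3) * 1"
    using y t by (intro mult_left_mono) auto
  finally have 2: "e\<^sup>2 \<le> y / (t + y) ^ 3" by simp
  have "(S + e)\<^sup>2 = S\<^sup>2 + 2 * (S * e) + e\<^sup>2" by (simp add: power2_sum)
  also have "\<dots> \<le> 5 * (\<Sum>j=a..k. d j / (t + d j) ^ 3) + 5 * (y / (t + y) ^ 3)"
    using 1 2 step unfolding S_def by linarith
  finally show ?case using step by (simp add: S_def e_def y_def algebra_simps)
qed

lemma has_lap_snd:
  fixes z :: "'a::euclidean_space \<times> real"
  shows "has_lap snd z snd 0"
proof -
  have "(\<lambda>z::'a \<times> real. 0 + z \<bullet> (0, 1)) = snd" "(\<lambda>b::'a \<times> real. b \<bullet> (0, 1)) = snd"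
    by (auto simp: inner_prod_def)
  then show ?thesis using has_lap_inner[of 0 "(0::'a, 1::real)" z] by simp
qed

lemma sum_snd_sq_Basis: "(\<Sum>b\<in>(Basis :: ('a::euclidean_space \<times> real) set). (snd b)\<^sup>2) = 1"
proof -
  have "(0::'a, 1::real) \<bullet> (0, 1) = (\<Sum>b\<in>Basis. ((0::'a, 1::real) \<bullet> b) * ((0, 1) \<bullet> b))"
    by (rule euclidean_inner)
  then show ?thesis by (simp add: inner_prod_def power2_eq_square)
qed

text \<open>The profile is concave in the height and takes values below 1: a bounded function whose
  negative Laplacian is felt at heights up to about \<open>c\<close>.\<close>

lemma has_lap_height_ratio:
  fixes z :: "'a::euclidean_space \<times> real"
  assumes "snd z > 0" "c > 0"
  shows "has_lap (\<lambda>z. snd z / (snd z + c)) z (\<lambda>b. c / (snd z + c)\<^sup>2 * snd b) (- 2 * (c / (snd z + c) ^ 3))"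
proof -
  have "has_lap (\<lambda>z. snd z / (snd z + c)) z (\<lambda>b. c / (snd z + c)\<^sup>2 * snd b)
      ((- 2 * (c / (snd z + c) ^ 3)) * (\<Sum>b\<in>(Basis :: ('a \<times> real) set). (snd b)\<^sup>2) + c / (snd z + c)\<^sup>2 * 0)"
  proof (rule has_lap_compose[OF has_lap_snd, where g="\<lambda>y. y / (y + c)" and g'="\<lambda>y. c / (y + c)\<^sup>2"
        and r="- 2 * (c / (snd z + c) ^ 3)"])
    have "\<forall>\<^sub>F y in nhds (snd z). y > 0"
      using assms(1) by (intro order_tendstoD(1)[OF filterlim_ident])
    then show "\<forall>\<^sub>F y in nhds (snd z). ((\<lambda>y. y / (y + c)) has_real_derivative c / (y + c)\<^sup>2) (at y)"
      by eventually_elim (use assms in \<open>auto intro!: derivative_eq_intros simp: divide_simps power2_eq_square\<close>)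
    have "((\<lambda>y. c / (y + c)\<^sup>2) has_real_derivative
        (0 * (snd z + c)\<^sup>2 - c * (2 * (snd z + c))) / ((snd z + c)\<^sup>2 * (snd z + c)\<^sup>2)) (at (snd z))"
      using assms by (intro DERIV_divide) (auto intro!: derivative_eq_intros)
    moreover have "(0 * (snd z + c)\<^sup>2 - c * (2 * (snd z + c))) / ((snd z + c)\<^sup>2 * (snd z + c)\<^sup>2)
        = - 2 * (c / (snd z + c) ^ 3)"
      using assms by (simp add: divide_simps eval_nat_numeral)
    ultimately show "((\<lambda>y. c / (y + c)\<^sup>2) has_real_derivative - 2 * (c / (snd z + c) ^ 3)) (at (snd z))"
      by simp
  qed
  then show ?thesis by (simp add: sum_snd_sq_Basis)
qed

lemma sum_sq_add_le:
  fixes x y :: "'b \<Rightarrow> real"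
  shows "(\<Sum>b\<in>I. (x b + y b)\<^sup>2) \<le> 2 * (\<Sum>b\<in>I. (x b)\<^sup>2) + 2 * (\<Sum>b\<in>I. (y b)\<^sup>2)"
proof -
  have "(x b + y b)\<^sup>2 \<le> 2 * (x b)\<^sup>2 + 2 * (y b)\<^sup>2" for b
    using sum_squares_ge_zero[of "x b - y b" 0] by (simp add: power2_eq_square algebra_simps)
  then have "(\<Sum>b\<in>I. (x b + y b)\<^sup>2) \<le> (\<Sum>b\<in>I. 2 * (x b)\<^sup>2 + 2 * (y b)\<^sup>2)" by (intro sum_mono)
  then show ?thesis by (simp add: sum.distrib sum_distrib_left)
qed

lemma weighted_Cauchy_Schwarz:
  fixes c g :: "'k \<Rightarrow> real" and p :: "'k \<Rightarrow> 'b \<Rightarrow> real"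
  assumes "\<And>k. k \<in> K \<Longrightarrow> c k \<ge> 0"
  shows "(\<Sum>b\<in>I. (\<Sum>k\<in>K. c k * g k * p k b)\<^sup>2) \<le> (\<Sum>k\<in>K. c k * (g k)\<^sup>2) * (\<Sum>k\<in>K. c k * (\<Sum>b\<in>I. (p k b)\<^sup>2))"
proof -
  have "(\<Sum>k\<in>K. c k * g k * p k b)\<^sup>2 \<le> (\<Sum>k\<in>K. c k * (g k)\<^sup>2) * (\<Sum>k\<in>K. c k * (p k b)\<^sup>2)" for b
  proof -
    have "(\<Sum>k\<in>K. (sqrt (c k) * g k) * (sqrt (c k) * p k b))\<^sup>2
        \<le> (\<Sum>k\<in>K. (sqrt (c k) * g k)\<^sup>2) * (\<Sum>k\<in>K. (sqrt (c k) * p k b)\<^sup>2)"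
      by (rule Cauchy_Schwarz_ineq_sum)
    moreover have "(\<Sum>k\<in>K. (sqrt (c k) * g k) * (sqrt (c k) * p k b)) = (\<Sum>k\<in>K. c k * g k * p k b)"
    proof (rule sum.cong[OF refl])
      fix k assume "k \<in> K"
      then have "sqrt (c k) * sqrt (c k) = c k" using assms by simp
      moreover have "(sqrt (c k) * g k) * (sqrt (c k) * p k b) = (sqrt (c k) * sqrt (c k)) * g k * p k b"
        by (simp only: mult_ac)
      ultimately show "(sqrt (c k) * g k) * (sqrt (c k) * p k b) = c k * g k * p k b" by simp
    qed
    ultimately show ?thesis using assms by (simp add: power_mult_distrib)
  qed
  then have "(\<Sum>b\<in>I. (\<Sum>k\<in>K. c k * g k * p k b)\<^sup>2)
      \<le> (\<Sum>b\<in>I. (\<Sum>k\<in>K. c k * (g k)\<^sup>2) * (\<Sum>k\<in>K. c k * (p k b)\<^sup>2))" by (intro sum_mono)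
  also have "\<dots> = (\<Sum>k\<in>K. c k * (g k)\<^sup>2) * (\<Sum>k\<in>K. c k * (\<Sum>b\<in>I. (p k b)\<^sup>2))"
    by (subst sum_distrib_left[symmetric], subst sum.swap) (simp add: sum_distrib_left)
  finally show ?thesis .
qed

definition corrector ::
  "(nat \<Rightarrow> real) \<Rightarrow> (nat \<Rightarrow> 'a::euclidean_space \<times> real \<Rightarrow> real) \<Rightarrow> real \<Rightarrow> nat \<Rightarrow> nat \<Rightarrow> 'a \<times> real \<Rightarrow> real" where
  "corrector d f B a b z = B * (\<Sum>k=a..b. snd z / (snd z + d k)) +
     (- 64) * (\<Sum>k=a..<b. (snd z / (snd z + d (Suc k))) ^ 3 * (\<Sum>j=k..<b. f j z)\<^sup>2)"

text \<open>
  The first sum in the corrector grows with the number of layers and pays for the energy of the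
  layers far above the point; the second one, whose Laplacian produces the squared
  gradients of the tail sums, stays bounded.
\<close>

lemma exp_corrected_superharmonic:
  fixes z :: "'a::euclidean_space \<times> real" and d :: "nat \<Rightarrow> real"
  assumes pos: "\<And>k. d k > 0" and half: "\<And>k. d (Suc k) \<le> d k / 2" and t: "snd z > 0" and ab: "a < b"
    and harm: "\<And>j. has_lap (f j) z (P j) 0"
    and tail: "\<And>k. k \<in> {a..<b} \<Longrightarrow> (\<Sum>j=k..<b. f j z)\<^sup>2 * (snd z / (snd z + d (Suc k))) \<le> \<alpha>"
    and tail_sum: "(\<Sum>k=a..<b. (snd z / (snd z + d (Suc k))) ^ 3 * (\<Sum>j=k..<b. f j z)\<^sup>2) \<le> \<beta>"
    and grad: "\<And>m. m \<in> {a..b} \<Longrightarrow> (\<Sum>i\<in>Basis. (\<Sum>j=a..<m. P j i)\<^sup>2) \<le> \<gamma> / (d m)\<^sup>2"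
    and \<alpha>: "\<alpha> \<ge> 0" and \<gamma>: "\<gamma> \<ge> 0" and B: "B \<ge> 2304 * \<alpha> + 32 * \<gamma>"
    and l1: "20 * l\<^sup>2 * (B + 192 * \<alpha>)\<^sup>2 \<le> B" and l2: "2048 * l\<^sup>2 * \<beta> \<le> 1"
  shows "\<exists>p L. has_lap (\<lambda>z. exp (l * (\<Sum>j=a..<b. f j z) + l\<^sup>2 * corrector d f B a b z)) z p L \<and> L \<le> 0"
proof -
  let ?I = "Basis :: ('a \<times> real) set"
  define t where "t = snd z"
  have t0: "t > 0" using t by (simp add: t_def)
  define g where "g k = (\<Sum>j=k..<b. f j z)" for k
  define p where "p k i = (\<Sum>j=k..<b. P j i)" for k i
  define \<mu> where "\<mu> k = t / (t + d k)" for k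
  define \<mu>1 where "\<mu>1 k = d k / (t + d k)\<^sup>2" for k
  define \<rho> where "\<rho> k = d k / (t + d k) ^ 3" for k
  define X where "X k = (\<Sum>i\<in>?I. (p k i)\<^sup>2)" for k
  define Y where "Y k = (\<Sum>i\<in>?I. snd i * p k i)" for k
  define R where "R = (\<Sum>k=a..b. \<rho> k)"
  define E where "E = (\<Sum>k=a..<b. \<mu> (Suc k) ^ 3 * X k)"
  have \<mu>: "0 \<le> \<mu> k" "\<mu> k \<le> 1" for k using t0 pos[of k] by (auto simp: \<mu>_def)
  have \<mu>1: "0 \<le> \<mu>1 k" for k using t0 pos[of k] by (auto simp: \<mu>1_def)
  have \<rho>: "0 \<le> \<rho> k" for k using t0 pos[of k] by (auto simp: \<rho>_def)
  have X: "0 \<le> X k" for k by (auto simp: X_def sum_nonneg)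
  have E: "0 \<le> E" unfolding E_def using \<mu> X by (auto intro!: sum_nonneg)
  have R: "0 \<le> R" unfolding R_def using \<rho> by (auto intro!: sum_nonneg)
  have \<mu>1\<rho>: "(\<mu>1 k)\<^sup>2 \<le> \<rho> k" for k
  proof -
    have "(\<mu>1 k)\<^sup>2 = \<rho> k * (d k / (t + d k))"
      using t0 pos[of k] by (simp add: \<mu>1_def \<rho>_def power2_eq_square power3_eq_cube)
    also have "\<dots> \<le> \<rho> k * 1" using t0 pos[of k] \<rho> by (intro mult_left_mono) auto
    finally show ?thesis by simp
  qed
  have YX: "(Y k)\<^sup>2 \<le> X k" for k
    using Cauchy_Schwarz_ineq_sum[of snd "p k" "Basis :: ('a \<times> real) set"]
    by (simp add: Y_def X_def sum_snd_sq_Basis)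
  have tail': "(g k)\<^sup>2 * \<mu> (Suc k) \<le> \<alpha>" if "k \<in> {a..<b}" for k
    using tail[OF that] by (simp add: g_def \<mu>_def t_def)
  \<comment> \<open>The three groups come from the cubed profile, from the product of the two
    gradients, and from the squared gradient of the tail. The cube is chosen so that, after
    completing the square, one factor \<open>\<mu> (Suc k)\<close> is still left beside
    \<open>(g k)\<^sup>2\<close>, as \<open>tail'\<close> requires.\<close>
  define Lk where "Lk k = (6 * \<mu> (Suc k) * (\<mu>1 (Suc k))\<^sup>2 - 6 * (\<mu> (Suc k))\<^sup>2 * \<rho> (Suc k)) * (g k)\<^sup>2
      + 12 * (\<mu> (Suc k))\<^sup>2 * \<mu>1 (Suc k) * g k * Y k + 2 * \<mu> (Suc k) ^ 3 * X k" for k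
  define pk where "pk k i = 3 * (\<mu> (Suc k))\<^sup>2 * \<mu>1 (Suc k) * (g k)\<^sup>2 * snd i
      + 2 * \<mu> (Suc k) ^ 3 * g k * p k i" for k i
  have lapg: "has_lap (\<lambda>z. \<Sum>j=k..<b. f j z) z (p k) 0" for k
    using has_lap_sum[of "{k..<b}" f z P "\<lambda>_. 0"] harm unfolding p_def[abs_def] by simp
  have lapm: "has_lap (\<lambda>z. snd z / (snd z + d k)) z (\<lambda>i. \<mu>1 k * snd i) (- 2 * \<rho> k)" for k
    using has_lap_height_ratio[OF t pos[of k]] unfolding \<mu>1_def \<rho>_def t_def .
  have lapk: "has_lap (\<lambda>z. (snd z / (snd z + d (Suc k))) ^ 3 * (\<Sum>j=k..<b. f j z)\<^sup>2) z (pk k) (Lk k)" for k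
  proof -
    define m where "m = Suc k"
    have 1: "has_lap (\<lambda>z. (snd z / (snd z + d m)) ^ 3 * (\<Sum>j=k..<b. f j z)\<^sup>2) z
       (\<lambda>i. (3 * (\<mu> m)\<^sup>2 * (\<mu>1 m * snd i)) * (g k)\<^sup>2 + \<mu> m ^ 3 * (2 * g k * p k i))
       ((3 * 2 * \<mu> m * (\<Sum>i\<in>?I. (\<mu>1 m * snd i)\<^sup>2) + 3 * (\<mu> m)\<^sup>2 * (- 2 * \<rho> m)) * (g k)\<^sup>2
        + 2 * (\<Sum>i\<in>?I. (3 * (\<mu> m)\<^sup>2 * (\<mu>1 m * snd i)) * (2 * g k * p k i))
        + \<mu> m ^ 3 * (2 * X k))"
      using has_lap_mult[OF has_lap_power[OF lapm[of m], of 3] has_lap_power[OF lapg[of k], of 2]]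
      by (simp add: \<mu>_def t_def g_def X_def)
    have 2: "(\<Sum>i\<in>?I. (\<mu>1 m * snd i)\<^sup>2) = (\<mu>1 m)\<^sup>2"
      by (simp add: power_mult_distrib sum_snd_sq_Basis flip: sum_distrib_left)
    have 3: "(\<Sum>i\<in>?I. (3 * (\<mu> m)\<^sup>2 * (\<mu>1 m * snd i)) * (2 * g k * p k i))
        = 6 * (\<mu> m)\<^sup>2 * \<mu>1 m * g k * Y k"
      unfolding Y_def sum_distrib_left by (intro sum.cong refl) simp
    have 4: "(\<lambda>i. (3 * (\<mu> m)\<^sup>2 * (\<mu>1 m * snd i)) * (g k)\<^sup>2 + \<mu> m ^ 3 * (2 * g k * p k i)) = pk k"
      by (auto simp: pk_def m_def)
    have 5: "(3 * 2 * \<mu> m * (\<mu>1 m)\<^sup>2 + 3 * (\<mu> m)\<^sup>2 * (- 2 * \<rho> m)) * (g k)\<^sup>2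
        + 2 * (6 * (\<mu> m)\<^sup>2 * \<mu>1 m * g k * Y k) + \<mu> m ^ 3 * (2 * X k) = Lk k"
      by (simp add: Lk_def m_def)
    show ?thesis using 1 unfolding 2 3 4 5 unfolding m_def .
  qed
  have Lk: "Lk k \<ge> \<mu> (Suc k) ^ 3 * X k - 36 * \<alpha> * \<rho> (Suc k)" if k: "k \<in> {a..<b}" for k
  proof -
    define m where "m = Suc k"
    \<comment> \<open>Completing the square spends one of the two copies of
      \<open>\<mu> m ^ 3 * X k\<close> on the cross term; the other one survives as energy.\<close>
    have "0 \<le> \<mu> m * (6 * \<mu>1 m * g k + \<mu> m * Y k)\<^sup>2" using \<mu> by simp
    then have 1: "12 * (\<mu> m)\<^sup>2 * \<mu>1 m * g k * Y k \<ge> - 36 * (\<mu> m * (g k)\<^sup>2 * (\<mu>1 m)\<^sup>2) - \<mu> m ^ 3 * (Y k)\<^sup>2"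
      by (simp add: power2_eq_square eval_nat_numeral algebra_simps)
    have 2: "\<mu> m ^ 3 * (Y k)\<^sup>2 \<le> \<mu> m ^ 3 * X k" using \<mu> YX by (intro mult_left_mono) auto
    have 3: "\<mu> m * (g k)\<^sup>2 * (\<mu>1 m)\<^sup>2 \<le> \<alpha> * \<rho> m"
      using tail'[OF k] \<mu>1\<rho>[of m] \<alpha> \<rho> by (intro mult_mono) (auto simp: m_def mult.commute)
    have "\<mu> m * ((g k)\<^sup>2 * \<mu> m) \<le> 1 * \<alpha>"
      using tail'[OF k] \<mu>[of m] by (intro mult_mono) (auto simp: m_def)
    then have 4: "(\<mu> m)\<^sup>2 * (g k)\<^sup>2 * \<rho> m \<le> \<alpha> * \<rho> m"
      using \<rho> by (intro mult_right_mono) (auto simp: power2_eq_square mult_ac)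
    have 5: "0 \<le> \<mu> m * (g k)\<^sup>2 * (\<mu>1 m)\<^sup>2" using \<mu> by simp
    have "Lk k = 6 * (\<mu> m * (g k)\<^sup>2 * (\<mu>1 m)\<^sup>2) - 6 * ((\<mu> m)\<^sup>2 * (g k)\<^sup>2 * \<rho> m)
      + 12 * (\<mu> m)\<^sup>2 * \<mu>1 m * g k * Y k + 2 * (\<mu> m ^ 3 * X k)"
      by (simp add: Lk_def m_def algebra_simps)
    then show ?thesis using 1 2 3 4 5 unfolding m_def[symmetric] by linarith
  qed
  have sum_Suc_le: "(\<Sum>k=a..<b. h (Suc k)) \<le> (\<Sum>k=a..b. h k)" if "\<And>k. (0::real) \<le> h k" for h
  proof -
    have "(\<Sum>k=a..<b. h (Suc k)) = sum h {Suc a..<Suc b}"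
      by (rule sum.shift_bounds_Suc_ivl[symmetric])
    also have "\<dots> \<le> (\<Sum>k=a..b. h k)" using that by (intro sum_mono2) auto
    finally show ?thesis .
  qed
  have sumLk: "(\<Sum>k=a..<b. Lk k) \<ge> E - 36 * \<alpha> * R"
  proof -
    have "(\<Sum>k=a..<b. Lk k) \<ge> (\<Sum>k=a..<b. \<mu> (Suc k) ^ 3 * X k - 36 * \<alpha> * \<rho> (Suc k))"
      by (intro sum_mono Lk)
    moreover have "36 * \<alpha> * (\<Sum>k=a..<b. \<rho> (Suc k)) \<le> 36 * \<alpha> * R"
      unfolding R_def using \<rho> \<alpha> by (intro mult_left_mono sum_Suc_le) auto
    ultimately show ?thesis by (simp add: sum_subtractf E_def sum_distrib_left)
  qed
  define q where "q i = B * (\<Sum>k=a..b. \<mu>1 k * snd i) + (- 64) * (\<Sum>k=a..<b. pk k i)" for i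
  have lapQ: "has_lap (corrector d f B a b) z q (B * (\<Sum>k=a..b. - 2 * \<rho> k) + (- 64) * (\<Sum>k=a..<b. Lk k))"
    unfolding corrector_def[abs_def] q_def[abs_def]
    by (intro has_lap_add has_lap_cmult has_lap_sum lapm lapk)
  \<comment> \<open>Collects the vertical components of the gradient of both parts of the corrector;
    what remains is a combination of the tail gradients \<open>p k\<close>.\<close>
  define V where "V = B * (\<Sum>k=a..b. \<mu>1 k) - 192 * (\<Sum>k=a..<b. (\<mu> (Suc k))\<^sup>2 * \<mu>1 (Suc k) * (g k)\<^sup>2)"
  have q: "q i = V * snd i + (- 128) * (\<Sum>k=a..<b. \<mu> (Suc k) ^ 3 * g k * p k i)" for i
    unfolding q_def V_def pk_def
    by (simp add: sum.distrib sum_distrib_left sum_distrib_right left_diff_distrib right_diff_distrib sum_negf mult_ac)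
  have B0: "B \<ge> 0" using B \<alpha> \<gamma> by linarith
  have V2: "V\<^sup>2 \<le> (B + 192 * \<alpha>)\<^sup>2 * (5 * R)"
  proof -
    define S where "S = (\<Sum>k=a..b. \<mu>1 k)"
    have S: "0 \<le> S" unfolding S_def using \<mu>1 by (auto intro!: sum_nonneg)
    define T where "T = (\<Sum>k=a..<b. (\<mu> (Suc k))\<^sup>2 * \<mu>1 (Suc k) * (g k)\<^sup>2)"
    have "T \<le> (\<Sum>k=a..<b. \<alpha> * \<mu>1 (Suc k))" unfolding T_def
    proof (rule sum_mono)
      fix k assume k: "k \<in> {a..<b}"
      have "\<mu> (Suc k) * ((g k)\<^sup>2 * \<mu> (Suc k)) \<le> 1 * \<alpha>"
        using tail'[OF k] \<mu>[of "Suc k"] by (intro mult_mono) auto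
      then have "(\<mu> (Suc k) * ((g k)\<^sup>2 * \<mu> (Suc k))) * \<mu>1 (Suc k) \<le> \<alpha> * \<mu>1 (Suc k)"
        using \<mu>1 by (intro mult_right_mono) auto
      then show "(\<mu> (Suc k))\<^sup>2 * \<mu>1 (Suc k) * (g k)\<^sup>2 \<le> \<alpha> * \<mu>1 (Suc k)"
        by (simp add: power2_eq_square mult_ac)
    qed
    also have "\<dots> \<le> \<alpha> * S"
      unfolding S_def sum_distrib_left[symmetric] using \<mu>1 \<alpha> by (intro mult_left_mono sum_Suc_le) auto
    finally have T: "T \<le> \<alpha> * S" .
    have T0: "0 \<le> T" unfolding T_def using \<mu>1 by (auto intro!: sum_nonneg)
    have V: "V = B * S - 192 * T" by (simp add: V_def S_def T_def)
    have "\<bar>V\<bar> \<le> (B + 192 * \<alpha>) * S"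
    proof -
      have "(B + 192 * \<alpha>) * S = B * S + 192 * (\<alpha> * S)" by (simp add: algebra_simps)
      moreover have "0 \<le> B * S" "0 \<le> \<alpha> * S" using B0 S \<alpha> by auto
      ultimately show ?thesis using T T0 unfolding V abs_le_iff by linarith
    qed
    then have "V\<^sup>2 \<le> ((B + 192 * \<alpha>) * S)\<^sup>2" using S B0 \<alpha> by (simp add: power2_le_iff_abs_le)
    also have "\<dots> = (B + 192 * \<alpha>)\<^sup>2 * S\<^sup>2" by (simp add: power_mult_distrib)
    also have "\<dots> \<le> (B + 192 * \<alpha>)\<^sup>2 * (5 * R)"
      unfolding S_def R_def \<mu>1_def \<rho>_def
      by (intro mult_left_mono sum_scales_sq_le[of d, OF pos half]) (use t0 ab in auto)
    finally show ?thesis .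
  qed
  have q2: "(\<Sum>i\<in>?I. (q i)\<^sup>2) \<le> 10 * (B + 192 * \<alpha>)\<^sup>2 * R + 32768 * (\<beta> * E)"
  proof -
    have "(\<Sum>i\<in>?I. (q i)\<^sup>2) \<le> 2 * (\<Sum>i\<in>?I. (V * snd i)\<^sup>2)
        + 2 * (\<Sum>i\<in>?I. ((- 128) * (\<Sum>k=a..<b. \<mu> (Suc k) ^ 3 * g k * p k i))\<^sup>2)"
      unfolding q by (rule sum_sq_add_le)
    also have "(\<Sum>i\<in>?I. (V * snd i)\<^sup>2) = V\<^sup>2"
      by (simp add: power_mult_distrib sum_snd_sq_Basis flip: sum_distrib_left)
    also have "(\<Sum>i\<in>?I. ((- 128) * (\<Sum>k=a..<b. \<mu> (Suc k) ^ 3 * g k * p k i))\<^sup>2)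
        = 16384 * (\<Sum>i\<in>?I. (\<Sum>k=a..<b. \<mu> (Suc k) ^ 3 * g k * p k i)\<^sup>2)"
      by (simp add: power_mult_distrib flip: sum_distrib_left)
    finally have 1: "(\<Sum>i\<in>?I. (q i)\<^sup>2) \<le> 2 * V\<^sup>2 +
        2 * (16384 * (\<Sum>i\<in>?I. (\<Sum>k=a..<b. \<mu> (Suc k) ^ 3 * g k * p k i)\<^sup>2))" .
    have "(\<Sum>i\<in>?I. (\<Sum>k=a..<b. \<mu> (Suc k) ^ 3 * g k * p k i)\<^sup>2)
        \<le> (\<Sum>k=a..<b. \<mu> (Suc k) ^ 3 * (g k)\<^sup>2) * E"
      unfolding E_def X_def by (rule weighted_Cauchy_Schwarz) (use \<mu> in auto)
    also have "\<dots> \<le> \<beta> * E"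
      using tail_sum E by (intro mult_right_mono) (simp_all add: \<mu>_def g_def t_def)
    finally show ?thesis using 1 V2 by linarith
  qed
  \<comment> \<open>The full gradient is split at the first layer whose next scale lies below
    \<open>t\<close>. Beyond it the weight is at least 1/2, so \<open>E\<close> controls the tail;
    before it the gradients sum to at most \<open>\<gamma> / (d m)\<^sup>2\<close>, and
    \<open>t \<le> d m\<close> lets \<open>R\<close> pay. If \<open>t < d b\<close> there is no such
    layer and \<open>R\<close> pays for everything.\<close>
  have Xa: "X a \<le> 16 * E + 16 * (\<gamma> * R)"
  proof -
    have E_ge: "X k \<le> 8 * E" if k: "k \<in> {a..<b}" and dk: "d (Suc k) \<le> t" for k
    proof -
      have "1 / 2 \<le> \<mu> (Suc k)" using dk t0 pos[of "Suc k"] by (simp add: \<mu>_def field_simps)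
      then have "(1 / 2) ^ 3 \<le> \<mu> (Suc k) ^ 3" by (intro power_mono) auto
      then have "1 / 8 * X k \<le> \<mu> (Suc k) ^ 3 * X k" using X by (intro mult_right_mono) (auto simp: eval_nat_numeral)
      also have "\<dots> \<le> E" unfolding E_def using k X \<mu> by (intro member_le_sum) auto
      finally show ?thesis by simp
    qed
    have R_ge: "\<gamma> / (d m)\<^sup>2 \<le> 8 * (\<gamma> * R)" if m: "m \<in> {a..b}" and tm: "t \<le> d m" for m
    proof -
      have "(t + d m) ^ 3 \<le> (2 * d m) ^ 3" using tm t0 by (intro power_mono) auto
      then have "d m / (2 * d m) ^ 3 \<le> \<rho> m"
        unfolding \<rho>_def using t0 pos[of m] by (intro divide_left_mono mult_pos_pos zero_less_power) auto
      also have "\<dots> \<le> R" unfolding R_def using m \<rho> by (intro member_le_sum) auto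
      finally have "\<gamma> * (d m / (2 * d m) ^ 3) \<le> \<gamma> * R" using \<gamma> by (intro mult_left_mono)
      moreover have "\<gamma> * (d m / (2 * d m) ^ 3) = \<gamma> / (d m)\<^sup>2 / 8"
        using pos[of m] by (simp add: eval_nat_numeral)
      ultimately show ?thesis by simp
    qed
    show ?thesis
    proof (cases "t < d b")
      case True
      have "X a \<le> \<gamma> / (d b)\<^sup>2" using grad[of b] ab by (simp add: X_def p_def)
      also have "\<dots> \<le> 8 * (\<gamma> * R)" using R_ge[of b] True ab by simp
      finally show ?thesis using E mult_nonneg_nonneg[OF \<gamma> R] by linarith
    next
      case False
      define m where "m = (LEAST k. a \<le> k \<and> d (Suc k) \<le> t)"
      have ex: "a \<le> b - 1 \<and> d (Suc (b - 1)) \<le> t" using False ab by auto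
      have m: "a \<le> m" "d (Suc m) \<le> t" using LeastI[of "\<lambda>k. a \<le> k \<and> d (Suc k) \<le> t", OF ex] by (auto simp: m_def)
      have "m \<le> b - 1" unfolding m_def using ex by (rule Least_le)
      then have mb: "m < b" using ab by simp
      have Xm: "X m \<le> 8 * E" using E_ge m mb by auto
      show ?thesis
      proof (cases "m = a")
        case True
        then have "X a \<le> 8 * E" using Xm by simp
        then show ?thesis using E mult_nonneg_nonneg[OF \<gamma> R] by linarith
      next
        case False
        then obtain m' where m': "m = Suc m'" "a \<le> m'" using m(1) by (cases m) auto
        have "\<not> (a \<le> m' \<and> d (Suc m') \<le> t)" using not_less_Least[of m' "\<lambda>k. a \<le> k \<and> d (Suc k) \<le> t"] m'
          by (simp add: m_def)
        then have tm: "t \<le> d m" using m' by simp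
        have "p a i = (\<Sum>j=a..<m. P j i) + p m i" for i
          unfolding p_def using m(1) mb by (simp add: sum.atLeastLessThan_concat)
        then have "X a \<le> 2 * (\<Sum>i\<in>?I. (\<Sum>j=a..<m. P j i)\<^sup>2) + 2 * X m"
          unfolding X_def using sum_sq_add_le by simp
        also have "\<dots> \<le> 2 * (8 * (\<gamma> * R)) + 2 * (8 * E)"
          using grad[of m] R_ge[of m] tm m mb Xm by auto
        finally show ?thesis by simp
      qed
    qed
  qed
  define F where "F i = l * p a i + l\<^sup>2 * q i" for i
  define LF where "LF = l * 0 + l\<^sup>2 * (B * (\<Sum>k=a..b. - 2 * \<rho> k) + (- 64) * (\<Sum>k=a..<b. Lk k))"
  have lapF: "has_lap (\<lambda>z. l * (\<Sum>j=a..<b. f j z) + l\<^sup>2 * corrector d f B a b z) z F LF"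
    unfolding F_def[abs_def] LF_def by (intro has_lap_add has_lap_cmult lapg lapQ)
  \<comment> \<open>The budget, in units of \<open>l\<^sup>2\<close>: \<open>2 * X a\<close> costs
    \<open>32 * E + 32 * \<gamma> * R\<close>, and the corrector's own gradient costs
    \<open>B * R + 32 * E\<close> by the smallness of \<open>l\<close>. The factor 64 in the
    corrector cancels all of \<open>E\<close> and returns \<open>64 * 36 * \<alpha> * R\<close>; of
    the gain \<open>2 * B * R\<close>, one \<open>B * R\<close> is left to cover
    \<open>(2304 * \<alpha> + 32 * \<gamma>) * R\<close>.\<close>
  have "LF + (\<Sum>i\<in>?I. (F i)\<^sup>2) \<le> 0"
  proof -
    have "(\<Sum>i\<in>?I. (F i)\<^sup>2) \<le> 2 * (\<Sum>i\<in>?I. (l * p a i)\<^sup>2) + 2 * (\<Sum>i\<in>?I. (l\<^sup>2 * q i)\<^sup>2)"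
      unfolding F_def by (rule sum_sq_add_le)
    also have "\<dots> = l\<^sup>2 * (2 * X a + 2 * l\<^sup>2 * (\<Sum>i\<in>?I. (q i)\<^sup>2))"
      by (simp add: X_def power_mult_distrib power2_eq_square[of "l\<^sup>2"] algebra_simps flip: sum_distrib_left)
    also have "\<dots> \<le> l\<^sup>2 * (2 * (16 * E + 16 * (\<gamma> * R))
        + 2 * l\<^sup>2 * (10 * (B + 192 * \<alpha>)\<^sup>2 * R + 32768 * (\<beta> * E)))"
      by (intro mult_left_mono add_mono Xa q2) auto
    also have "2 * (16 * E + 16 * (\<gamma> * R)) + 2 * l\<^sup>2 * (10 * (B + 192 * \<alpha>)\<^sup>2 * R + 32768 * (\<beta> * E))
       = 32 * E + 32 * \<gamma> * R + (20 * l\<^sup>2 * (B + 192 * \<alpha>)\<^sup>2) * R + 32 * (2048 * l\<^sup>2 * \<beta>) * E"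
      by (simp add: algebra_simps)
    also have "l\<^sup>2 * \<dots> \<le> l\<^sup>2 * (32 * E + 32 * \<gamma> * R + B * R + 32 * 1 * E)"
      using l1 l2 E R by (intro mult_left_mono add_mono mult_right_mono) auto
    finally have 1: "(\<Sum>i\<in>?I. (F i)\<^sup>2) \<le> l\<^sup>2 * (64 * E + 32 * \<gamma> * R + B * R)" by (simp add: algebra_simps)
    have "LF = l\<^sup>2 * (- 2 * B * R - 64 * (\<Sum>k=a..<b. Lk k))"
      by (simp add: LF_def R_def sum_negf flip: sum_distrib_left)
    also have "\<dots> \<le> l\<^sup>2 * (- 2 * B * R - 64 * (E - 36 * \<alpha> * R))"
      using sumLk by (intro mult_left_mono) auto
    finally have "LF + (\<Sum>i\<in>?I. (F i)\<^sup>2) \<le> l\<^sup>2 * ((2304 * \<alpha> + 32 * \<gamma> - B) * R)"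
      using 1 by (simp add: algebra_simps)
    also have "\<dots> \<le> 0" using B R by (intro mult_nonneg_nonpos mult_nonpos_nonneg) auto
    finally show ?thesis .
  qed
  then have "exp (l * (\<Sum>j=a..<b. f j z) + l\<^sup>2 * corrector d f B a b z) * (LF + (\<Sum>i\<in>?I. (F i)\<^sup>2)) \<le> 0"
    by (intro mult_nonneg_nonpos) auto
  then show ?thesis using has_lap_exp[OF lapF] by blast
qed

section \<open>Comparison on sawtooth domains\<close>

text \<open>Turns an integral into a finite sum over sample points. It serves twice: for the Poisson
  integral over a ball and for the Stieltjes integral over a layer.\<close>

lemma compact_small_partition:
  fixes Y :: "'b::metric_space set"
  assumes "compact Y" "\<rho> > 0"
  obtains k :: nat and a A where "\<And>i. i < k \<Longrightarrow> a i \<in> Y" "\<And>i. i < k \<Longrightarrow> A i \<in> sets borel"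
    "\<And>i. i < k \<Longrightarrow> A i \<subseteq> ball (a i) \<rho>" "disjoint_family_on A {..<k}" "(\<Union>i<k. A i) = Y"
proof -
  have "\<And>c. c \<in> Y \<Longrightarrow> open (ball c \<rho>)" "Y \<subseteq> (\<Union>c\<in>Y. ball c \<rho>)" using assms by auto
  from compactE_image[OF assms(1) this] obtain C
    where C: "C \<subseteq> Y" "finite C" "Y \<subseteq> (\<Union>c\<in>C. ball c \<rho>)" by metis
  obtain h where h: "bij_betw h {0..<card C} C" using ex_bij_betw_nat_finite[OF C(2)] by blast
  define A where "A i = (Y \<inter> ball (h i) \<rho>) - (\<Union>j<i. ball (h j) \<rho>)" for i
  have hC: "h ` {..<card C} = C" using h by (auto simp: bij_betw_def atLeast0LessThan)
  show thesis
  proof (rule that[of "card C" h A])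
    show "h i \<in> Y" if "i < card C" for i using that hC C(1) by blast
    show "A i \<in> sets borel" for i :: nat
      unfolding A_def using compact_imp_closed[OF assms(1)]
      by (intro sets.Diff sets.Int borel_closed borel_open open_UN) auto
    show "A i \<subseteq> ball (h i) \<rho>" for i :: nat by (auto simp: A_def)
    show "disjoint_family_on A {..<card C}"
      unfolding disjoint_family_on_def
    proof (intro ballI impI)
      fix i j :: nat assume "i \<noteq> j"
      then show "A i \<inter> A j = {}" by (cases i j rule: linorder_cases) (auto simp: A_def)
    qed
    show "(\<Union>i<card C. A i) = Y"
    proof (intro equalityI subsetI)
      fix y assume y: "y \<in> Y"
      then obtain c where c: "c \<in> C" "y \<in> ball c \<rho>" using C(3) by blast
      then obtain j where "j < card C" "c = h j" using hC by (metis imageE lessThan_iff)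
      then have ex: "\<exists>i. i < card C \<and> y \<in> ball (h i) \<rho>" using c by blast
      define i where "i = (LEAST i. i < card C \<and> y \<in> ball (h i) \<rho>)"
      have i: "i < card C" "y \<in> ball (h i) \<rho>" using LeastI_ex[OF ex] by (auto simp: i_def)
      have "y \<notin> ball (h j) \<rho>" if "j < i" for j
        using not_less_Least[of j "\<lambda>i. i < card C \<and> y \<in> ball (h i) \<rho>"] that i(1) by (auto simp: i_def)
      then have "y \<in> A i" using i y by (auto simp: A_def)
      then show "y \<in> (\<Union>i<card C. A i)" using i by auto
    qed (auto simp: A_def)
  qed
qed

section \<open>Poisson kernel of the half-space and its lower bound on a sawtooth\<close>

text \<open>The Poisson kernel with pole at the origin, without its normalising constant.\<close>

definition poisson :: "'a::euclidean_space \<times> real \<Rightarrow> real" where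
  "poisson z = snd z / norm z ^ DIM('a \<times> real)"

text \<open>Let N be the dimension of the half-space and t the height, so that the kernel is t times
  |z|^(-N). The Laplacian of |z|^(-N) is 2N |z|^(-N-2), and t times it is cancelled by the gradient
  cross term -2N t |z|^(-N-2).\<close>

lemma poisson_harmonic:
  fixes z :: "'a::euclidean_space \<times> real"
  assumes "snd z > 0"
  shows "\<exists>p. has_lap poisson z p 0"
proof -
  define N where "N = real DIM('a \<times> real)"
  define \<rho> where "\<rho> = (norm z)\<^sup>2"
  have "z \<noteq> 0" using assms by auto
  then have \<rho>: "\<rho> > 0" by (simp add: \<rho>_def)
  define g' where "g' y = - (N / 2) * y powr (- (N / 2) - 1)" for y :: real
  define r where "r = (N / 2) * (N / 2 + 1) * \<rho> powr (- (N / 2) - 2)"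
  have D: "(g' has_real_derivative r) (at \<rho>)"
  proof -
    have "((\<lambda>y. y powr (- (N / 2) - 1)) has_real_derivative (- (N / 2) - 1) * \<rho> powr (- (N / 2) - 1 - 1)) (at \<rho>)"
      by (rule has_real_derivative_powr[OF \<rho>])
    from DERIV_cmult[OF this, of "- (N / 2)"] show ?thesis
      unfolding g'_def[abs_def] r_def by (simp add: algebra_simps)
  qed
  have "\<forall>\<^sub>F y in nhds \<rho>. y > 0" using \<rho> by (intro order_tendstoD(1)[OF filterlim_ident])
  then have ev: "\<forall>\<^sub>F y in nhds \<rho>. ((\<lambda>y. y powr (- (N / 2))) has_real_derivative g' y) (at y)"
    by eventually_elim (use has_real_derivative_powr[of _ "- (N / 2)"] in \<open>simp add: g'_def\<close>)
  have 1: "has_lap (\<lambda>z. ((norm z)\<^sup>2) powr (- (N / 2))) z (\<lambda>b. g' \<rho> * (2 * (z \<bullet> b)))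
      (r * (\<Sum>b\<in>Basis. (2 * (z \<bullet> b))\<^sup>2) + g' \<rho> * (2 * N))"
    unfolding \<rho>_def N_def
    by (rule has_lap_compose[OF has_lap_norm_sq, where g="\<lambda>y. y powr (- (real DIM('a \<times> real) / 2))"])
       (use ev D in \<open>simp_all add: \<rho>_def N_def\<close>)
  have s1: "(\<Sum>b\<in>Basis. (2 * (z \<bullet> b))\<^sup>2) = 4 * \<rho>"
    unfolding \<rho>_def power2_norm_eq_inner euclidean_inner[of z z]
    by (simp add: power_mult_distrib power2_eq_square flip: sum_distrib_left)
  have "(\<Sum>b\<in>Basis. snd b * (z \<bullet> b)) = (0, 1) \<bullet> z"
    by (subst euclidean_inner) (simp add: inner_prod_def[of "(0, 1)"])
  then have s2': "(\<Sum>b\<in>Basis. snd b * (z \<bullet> b)) = snd z" by (simp add: inner_prod_def)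
  have "(\<Sum>b\<in>Basis. snd b * (g' \<rho> * (2 * (z \<bullet> b)))) = (\<Sum>b\<in>Basis. (g' \<rho> * 2) * (snd b * (z \<bullet> b)))"
    by (rule sum.cong) (simp_all only: mult_ac)
  also have "\<dots> = g' \<rho> * (2 * snd z)"
    by (simp only: s2' mult.assoc flip: sum_distrib_left)
  finally have s2: "(\<Sum>b\<in>Basis. snd b * (g' \<rho> * (2 * (z \<bullet> b)))) = g' \<rho> * (2 * snd z)" .
  have s3: "r * (4 * \<rho>) + g' \<rho> * (2 * N) = - 2 * g' \<rho> * 2"
  proof -
    have e: "\<rho> powr (- (N / 2) - 2) * \<rho> = \<rho> powr (- (N / 2) - 1)"
    proof -
      have "- (N / 2) - 1 = (- (N / 2) - 2) + 1" by simp
      then show ?thesis using \<rho> powr_add[of \<rho> "- (N / 2) - 2" 1] by (simp only: powr_one)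
    qed
    have "r * (4 * \<rho>) = 4 * ((N / 2) * (N / 2 + 1)) * (\<rho> powr (- (N / 2) - 2) * \<rho>)"
      by (simp add: r_def)
    then show ?thesis unfolding e g'_def by (simp add: algebra_simps)
  qed
  from has_lap_mult[OF has_lap_snd[of z] 1]
  have "\<exists>p. has_lap (\<lambda>z. snd z * ((norm z)\<^sup>2) powr (- (N / 2))) z p
     (0 * ((norm z)\<^sup>2) powr (- (N / 2)) + 2 * (g' \<rho> * (2 * snd z)) + snd z * (- 2 * g' \<rho> * 2))"
    unfolding s1 s2 s3 by blast
  moreover have "snd w * ((norm w)\<^sup>2) powr (- (N / 2)) = poisson w" for w :: "'a \<times> real"
  proof (cases "w = 0")
    case False
    then have "((norm w)\<^sup>2) powr (- (N / 2)) = norm w powr (- N)"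
      by (simp add: powr_powr flip: powr_numeral)
    also have "\<dots> = inverse (norm w ^ DIM('a \<times> real))"
      using False unfolding N_def by (simp add: powr_minus powr_realpow del: DIM_prod)
    finally have eq: "((norm w)\<^sup>2) powr (- (N / 2)) = inverse (norm w ^ DIM('a \<times> real))" .
    show ?thesis unfolding eq poisson_def by (simp only: divide_inverse)
  qed (simp add: poisson_def)
  ultimately show ?thesis by simp
qed

lemma poisson_nonneg: "snd z \<ge> 0 \<Longrightarrow> poisson z \<ge> 0"
  by (simp add: poisson_def)

lemma poisson_le:
  fixes z :: "'a::euclidean_space \<times> real"
  assumes "snd z > 0"
  shows "poisson z \<le> 1 / snd z ^ DIM('a)"
proof -
  have "snd z \<le> norm z" using norm_snd_le[of "snd z" "fst z"] assms by simp
  then have "snd z ^ DIM('a \<times> real) \<le> norm z ^ DIM('a \<times> real)" using assms by (intro power_mono) auto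
  then have "poisson z \<le> snd z / snd z ^ DIM('a \<times> real)"
    unfolding poisson_def using assms \<open>snd z \<le> norm z\<close> by (intro divide_left_mono mult_pos_pos zero_less_power) auto
  then show ?thesis using assms by simp
qed

lemma poisson_ge:
  fixes x :: "'a::euclidean_space"
  assumes t: "t > 0" and x: "norm x \<le> c * t"
  shows "poisson (x, t) \<ge> 1 / (sqrt (c\<^sup>2 + 1) ^ DIM('a \<times> real) * t ^ DIM('a))"
proof -
  have "norm (x, t) = sqrt ((norm x)\<^sup>2 + t\<^sup>2)" by (simp add: norm_Pair)
  also have "\<dots> \<le> sqrt ((c * t)\<^sup>2 + t\<^sup>2)" using x by (intro real_sqrt_le_mono add_right_mono power_mono) auto
  also have "(c * t)\<^sup>2 + t\<^sup>2 = (c\<^sup>2 + 1) * t\<^sup>2" by (simp add: power_mult_distrib distrib_right)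
  also have "sqrt \<dots> = sqrt (c\<^sup>2 + 1) * t" using t by (simp add: real_sqrt_mult)
  finally have "norm (x, t) ^ DIM('a \<times> real) \<le> (sqrt (c\<^sup>2 + 1) * t) ^ DIM('a \<times> real)"
    by (intro power_mono) auto
  moreover have "norm (x, t) > 0" using t by (simp add: zero_prod_def)
  moreover have "sqrt (c\<^sup>2 + 1) > 0" by (simp add: add_nonneg_pos)
  ultimately have "poisson (x, t) \<ge> t / (sqrt (c\<^sup>2 + 1) * t) ^ DIM('a \<times> real)"
    unfolding poisson_def using t
    by (simp only: snd_conv) (intro divide_left_mono mult_pos_pos zero_less_power, auto)
  then show ?thesis using t by (simp add: power_mult_distrib)
qed

text \<open>Pulling the centre from \<open>x\<close> towards \<open>x0\<close> by the fraction
  \<open>\<rho> / (2 * R)\<close> makes room for half the radius inside both balls. This covers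
  lateral boundary points near the rim of the cylinder, since the complement of \<open>E\<close> is
  counted only inside \<open>ball x0 R\<close>.\<close>

lemma half_ball_subset:
  fixes x x0 :: "'a::euclidean_space"
  assumes "dist x x0 \<le> R" "0 < \<rho>" "\<rho> \<le> R"
  obtains y where "ball y (\<rho> / 2) \<subseteq> ball x \<rho> \<inter> ball x0 R"
proof -
  define y where "y = x + (\<rho> / (2 * R)) *\<^sub>R (x0 - x)"
  have R: "R > 0" using assms by simp
  have "dist x y = \<rho> / (2 * R) * dist x x0"
    using assms R by (simp add: y_def dist_norm norm_minus_commute)
  also have "\<dots> \<le> \<rho> / (2 * R) * R" using assms R by (intro mult_left_mono) auto
  also have "\<dots> = \<rho> / 2" using R by simp
  finally have 1: "dist x y \<le> \<rho> / 2" .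
  have "y - x0 = (1 - \<rho> / (2 * R)) *\<^sub>R (x - x0)" by (simp add: y_def algebra_simps)
  moreover have "0 \<le> 1 - \<rho> / (2 * R)" using assms R by (simp add: field_simps)
  ultimately have "dist x0 y = (1 - \<rho> / (2 * R)) * dist x x0"
    by (simp add: dist_norm norm_minus_commute[of x0])
  also have "\<dots> \<le> (1 - \<rho> / (2 * R)) * R"
    using assms \<open>0 \<le> 1 - \<rho> / (2 * R)\<close> by (intro mult_left_mono) auto
  also have "\<dots> = R - \<rho> / 2" using R by (simp add: field_simps)
  finally have 2: "dist x0 y \<le> R - \<rho> / 2" .
  have "ball y (\<rho> / 2) \<subseteq> ball x \<rho> \<inter> ball x0 R"
  proof
    fix w assume "w \<in> ball y (\<rho> / 2)"
    then show "w \<in> ball x \<rho> \<inter> ball x0 R"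
      using 1 2 dist_triangle[of x w y] dist_triangle[of x0 w y] by auto
  qed
  then show thesis by (rule that)
qed

text \<open>The volume of a ball of radius \<open>min M 1 * t / 2\<close> times the lower bound
  \<open>poisson_ge\<close> for slope \<open>M + 1\<close>; the powers of \<open>t\<close> cancel.
  It is the least value of the unnormalised Poisson integral at a point whose distance from
  \<open>E\<close> is \<open>M * t\<close>.\<close>

definition exit_const :: "'a::euclidean_space itself \<Rightarrow> real \<Rightarrow> real" where
  "exit_const _ M = unit_ball_vol (real DIM('a)) * (min M 1 / 2) ^ DIM('a) / sqrt ((M + 1)\<^sup>2 + 1) ^ DIM('a \<times> real)"

lemma exit_const_pos: "M > 0 \<Longrightarrow> exit_const TYPE('a::euclidean_space) M > 0"
  by (simp add: exit_const_def add_nonneg_pos)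

text \<open>
  On the lateral boundary of the sawtooth over \<open>E\<close> the Poisson integral of the complement
  of \<open>E\<close> is bounded below; the quadratic barrier handles the sides and the top of the cylinder.
  The Poisson integral is discretised so that no differentiation under the integral is needed.
\<close>

lemma sawtooth_comparison:
  fixes E :: "'a::euclidean_space set" and W :: "'a \<times> real \<Rightarrow> real"
  assumes M: "M > 0" and R: "R > 0" and \<eta>: "0 < \<eta>" "\<eta> < 1" and s: "0 < s" "s \<le> \<eta> * R"
    and E: "E \<in> sets lebesgue" "E \<noteq> {}"
    and cont: "continuous_on {z. snd z > 0} W"
    and super: "\<And>z. snd z > 0 \<Longrightarrow> infdist (fst z) E \<le> M * snd z \<Longrightarrow> \<exists>p L. has_lap W z p L \<and> L \<le> 0"
    and nonneg: "\<And>z. snd z > 0 \<Longrightarrow> W z \<ge> 0"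
    and bottom: "\<And>x. infdist x E \<le> M * s \<Longrightarrow> dist x x0 \<le> R \<Longrightarrow> W (x, s) \<ge> 1"
    and apex: "infdist x0 E \<le> M * (\<eta> * R)"
  shows "1 \<le> W (x0, \<eta> * R) + 2 * real DIM('a \<times> real) * \<eta> +
    measure lebesgue (ball x0 R - E) / (exit_const TYPE('a) M * (\<eta> * R) ^ DIM('a))"
proof -
  define A where "A = ball x0 R - E"
  have A: "A \<in> lmeasurable" unfolding A_def using E(1) by (intro fmeasurable_Diff) auto
  \<comment> \<open>Pieces lie in balls of radius \<open>s\<close>, and all heights considered are
    at least \<open>s\<close>, so replacing a point of a piece by its centre only widens the slope
    \<open>M\<close> to \<open>M + 1\<close>.\<close>
  obtain k :: nat and a and A' :: "nat \<Rightarrow> 'a set" where a: "\<And>i. i < k \<Longrightarrow> a i \<in> cball x0 R"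
    and A'b: "\<And>i. i < k \<Longrightarrow> A' i \<in> sets borel" and A'a: "\<And>i. i < k \<Longrightarrow> A' i \<subseteq> ball (a i) s"
    and dis: "disjoint_family_on A' {..<k}" and un: "(\<Union>i<k. A' i) = cball x0 R"
    using compact_small_partition[OF compact_cball[of x0 R] s(1)] by metis
  have part: "measure lebesgue (A \<inter> T) = (\<Sum>i<k. measure lebesgue (A' i \<inter> A \<inter> T))"
    if T: "T \<in> sets lebesgue" for T
  proof -
    have fin: "A' i \<inter> A \<inter> T \<in> lmeasurable" if "i < k" for i
    proof -
      have "A' i \<in> sets lebesgue" using A'b[OF that] by simp
      then have "A \<inter> (A' i \<inter> T) \<in> lmeasurable" using A T by (intro fmeasurable_Int_fmeasurable) auto
      then show ?thesis by (simp add: Int_ac)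
    qed
    have "A \<inter> T = (\<Union>i<k. A' i \<inter> A \<inter> T)" using un by (auto simp: A_def)
    then have "measure lebesgue (A \<inter> T) = measure lebesgue (\<Union>i<k. A' i \<inter> A \<inter> T)" by simp
    also have "\<dots> = (\<Sum>i<k. measure lebesgue (A' i \<inter> A \<inter> T))"
    proof (rule measure_finite_Union)
      show "disjoint_family_on (\<lambda>i. A' i \<inter> A \<inter> T) {..<k}"
        using dis unfolding disjoint_family_on_def by blast
      show "emeasure lebesgue (A' i \<inter> A \<inter> T) \<noteq> \<infinity>" if "i \<in> {..<k}" for i
        using fmeasurableD2[OF fin[of i]] that by simp
    qed (use fin fmeasurableD in \<open>auto\<close>)
    finally show ?thesis .
  qed
  define c0 where "c0 = exit_const TYPE('a) M"
  have c0: "c0 > 0" using M by (simp add: c0_def exit_const_pos)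
  define m where "m i = measure lebesgue (A' i \<inter> A)" for i
  define v where "v z = (\<Sum>i<k. m i * poisson (z + (- (a i, 0))))" for z :: "'a \<times> real"
  \<comment> \<open>With N the dimension of the half-space, this is (|x - x0|^2 + N t (2R - t)) /
    R^2. It is at least 1 on the sides and the top, at most 2 N \<eta> at the apex, and its
    Laplacian is -2 / R^2, which makes the sum \<open>H\<close> strictly superharmonic.\<close>
  define \<beta> where "\<beta> z = (1 / R\<^sup>2) * ((norm (z + (- (x0, 0))))\<^sup>2 + ((- 1) * (snd z)\<^sup>2 +
      real DIM('a \<times> real) * (2 * R * snd z + (- 1) * (snd z)\<^sup>2)))" for z :: "'a \<times> real"
  have \<beta>: "\<beta> (x, t) = ((dist x x0)\<^sup>2 + real DIM('a \<times> real) * (t * (2 * R - t))) / R\<^sup>2" for x t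
  proof -
    have "(norm ((x, t) + (- (x0, 0))))\<^sup>2 = (dist x x0)\<^sup>2 + t\<^sup>2" by (simp add: norm_Pair dist_norm)
    note eq = this
    have "(dist x x0)\<^sup>2 + t\<^sup>2 + ((- 1) * t\<^sup>2 + real DIM('a \<times> real) * (2 * R * t + (- 1) * t\<^sup>2)) =
        (dist x x0)\<^sup>2 + real DIM('a \<times> real) * (t * (2 * R - t))"
      by (simp add: algebra_simps power2_eq_square del: DIM_prod)
    then show ?thesis unfolding \<beta>_def snd_conv eq by simp
  qed
  have N1: "real DIM('a \<times> real) \<ge> 1" by simp
  define H where "H z = (W z + \<beta> z) + ((1 / c0) * v z + (- 1))" for z
  define D where "D = {z. dist (fst z) x0 \<le> R \<and> s \<le> snd z \<and> snd z \<le> R \<and> infdist (fst z) E \<le> M * snd z}"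
  have compact: "compact D"
  proof -
    have "D = (cball x0 R \<times> {s..R}) \<inter> {z. infdist (fst z) E \<le> M * snd z}"
      by (auto simp: D_def dist_commute)
    moreover have "closed {z :: 'a \<times> real. infdist (fst z) E \<le> M * snd z}"
      by (intro closed_Collect_le continuous_intros)
    ultimately show ?thesis by (auto intro!: compact_Int_closed compact_Times)
  qed
  have Dpos: "snd z > 0" if "z \<in> D" for z using that s by (auto simp: D_def)
  have v0: "v z \<ge> 0" if "snd z \<ge> 0" for z
    unfolding v_def using that by (intro sum_nonneg mult_nonneg_nonneg poisson_nonneg) (auto simp: m_def)
  have \<beta>0: "\<beta> z \<ge> 0" if "z \<in> D" for z
  proof (cases z)
    case (Pair x t)
    then have "0 \<le> t" "t \<le> R" using that s by (auto simp: D_def)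
    then have "0 \<le> t * (2 * R - t)" by (intro mult_nonneg_nonneg) auto
    then show ?thesis unfolding Pair \<beta> by (intro divide_nonneg_nonneg add_nonneg_nonneg mult_nonneg_nonneg[of "real DIM('a \<times> real)"]) auto
  qed
  have z0: "(x0, \<eta> * R) \<in> D"
    using apex s \<eta> R by (auto simp: D_def)
  have "0 \<le> H (x0, \<eta> * R)"
  proof (rule minimum_principle[OF compact _ _ z0])
    have "continuous_on D W" using cont by (rule continuous_on_subset) (use Dpos in blast)
    then show "continuous_on D H"
      unfolding H_def v_def \<beta>_def poisson_def
      using Dpos by (intro continuous_intros) (fastforce simp: prod_eq_iff)+
  next
    fix z assume z: "z \<in> D"
    obtain x t where xt: "z = (x, t)" by (cases z)
    have t: "0 < t" "s \<le> t" "t \<le> R" "dist x x0 \<le> R" "infdist x E \<le> M * t"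
      using z s by (auto simp: D_def xt)
    have Wz: "W z \<ge> 0" using nonneg[of z] t by (simp add: xt)
    have vz: "(1 / c0) * v z \<ge> 0" using v0[of z] t c0 by (simp add: xt)
    consider "t = s" | "dist x x0 = R \<or> t = R" | "t < R" "infdist x E = M * t"
      | "s < t" "t < R" "dist x x0 < R" "infdist x E < M * t" using t by linarith
    then show "0 \<le> H z \<or> (z \<in> interior D \<and> (\<exists>p L. has_lap H z p L \<and> L < 0))"
    proof cases
      case 1
      then have "W z \<ge> 1" using bottom[of x] t by (simp add: xt)
      then have "0 \<le> H z" unfolding H_def using \<beta>0[OF z] vz by linarith
      then show ?thesis ..
    next
      case 2
      have "\<beta> z \<ge> 1"
      proof -
        have "0 \<le> t * (2 * R - t)" using t by (intro mult_nonneg_nonneg) auto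
        then have 1: "t * (2 * R - t) \<le> real DIM('a \<times> real) * (t * (2 * R - t))"
          using mult_right_mono[OF N1] by fastforce
        from 2 have "R\<^sup>2 \<le> (dist x x0)\<^sup>2 + real DIM('a \<times> real) * (t * (2 * R - t))"
        proof
          assume "dist x x0 = R"
          then have "(dist x x0)\<^sup>2 = R\<^sup>2" by simp
          then show ?thesis using 1 \<open>0 \<le> t * (2 * R - t)\<close> by linarith
        next
          assume "t = R"
          then have "t * (2 * R - t) = R\<^sup>2" by (simp add: power2_eq_square)
          then show ?thesis using 1 zero_le_power2[of "dist x x0"] by linarith
        qed
        then show ?thesis unfolding xt \<beta> using R by (simp add: pos_le_divide_eq)
      qed
      then have "0 \<le> H z" unfolding H_def using Wz vz by linarith
      then show ?thesis ..
    next
      case 3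
      have "v z \<ge> c0"
      proof -
        \<comment> \<open>On the lateral boundary the ball of radius \<open>M * t\<close> misses
          \<open>E\<close>. The cap by \<open>t\<close>, itself at most \<open>R\<close>, is needed
          to apply \<open>half_ball_subset\<close>.\<close>
        define \<rho> where "\<rho> = min M 1 * t"
        have \<rho>: "0 < \<rho>" "\<rho> \<le> R" "\<rho> \<le> M * t"
        proof -
          have le: "min M 1 * t \<le> 1 * t" "min M 1 * t \<le> M * t" using t(1) by (intro mult_right_mono; simp)+
          show "0 < \<rho>" using M t by (simp add: \<rho>_def)
          show "\<rho> \<le> R" "\<rho> \<le> M * t" using le t(3) unfolding \<rho>_def by linarith+
        qed
        obtain y where y: "ball y (\<rho> / 2) \<subseteq> ball x \<rho> \<inter> ball x0 R"
          using half_ball_subset[OF t(4) \<rho>(1,2)] by blast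
        define T where "T = ball x (M * t)"
        have "T \<inter> E = {}" using 3(2) infdist_le[of _ E x] by (force simp: T_def)
        then have "ball y (\<rho> / 2) \<subseteq> A \<inter> T" 
        proof -
          have "ball x \<rho> \<subseteq> T" using \<rho> by (auto simp: T_def)
          then show ?thesis using y \<open>T \<inter> E = {}\<close> unfolding A_def by blast
        qed
        then have "measure lebesgue (ball y (\<rho> / 2)) \<le> measure lebesgue (A \<inter> T)"
          using A by (intro measure_mono_fmeasurable fmeasurable_Int_fmeasurable) (auto simp: T_def)
        then have mT: "unit_ball_vol (real DIM('a)) * (\<rho> / 2) ^ DIM('a) \<le> measure lebesgue (A \<inter> T)"
          using \<rho> by (simp add: content_ball)
        define \<kappa> where "\<kappa> = 1 / (sqrt ((M + 1)\<^sup>2 + 1) ^ DIM('a \<times> real) * t ^ DIM('a))"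
        have \<kappa>: "\<kappa> \<ge> 0" using t by (simp add: \<kappa>_def)
        have "measure lebesgue (A' i \<inter> A \<inter> T) * \<kappa> \<le> m i * poisson (z + (- (a i, 0)))" if i: "i < k" for i
        proof (cases "A' i \<inter> A \<inter> T = {}")
          case True
          then show ?thesis using poisson_nonneg[of "z + (- (a i, 0))"] t by (simp add: m_def xt)
        next
          case False
          then obtain w where "w \<in> A' i" "w \<in> T" by auto
          then have "dist x w < M * t" "dist (a i) w < s" using A'a[OF i] by (auto simp: T_def)
          then have "norm (x - a i) \<le> (M + 1) * t"
            using dist_triangle[of x "a i" w] t by (auto simp: dist_norm norm_minus_commute algebra_simps)
          from poisson_ge[OF t(1) this] have 1: "\<kappa> \<le> poisson (z + (- (a i, 0)))"
            by (simp add: \<kappa>_def xt)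
          have "A' i \<in> sets lebesgue" using A'b[OF i] by simp
          then have 2: "A' i \<inter> A \<in> lmeasurable" using A fmeasurable_Int_fmeasurable[of A lebesgue "A' i"] by (simp add: Int_commute)
          then have "measure lebesgue (A' i \<inter> A \<inter> T) \<le> m i" unfolding m_def
            by (intro measure_mono_fmeasurable sets.Int)
               (use \<open>A' i \<in> sets lebesgue\<close> fmeasurableD[OF A] in \<open>auto simp: T_def\<close>)
          then show ?thesis using 1 \<kappa> by (intro mult_mono) (auto simp: m_def)
        qed
        then have "(\<Sum>i<k. measure lebesgue (A' i \<inter> A \<inter> T) * \<kappa>) \<le> v z"
          unfolding v_def by (intro sum_mono) auto
        then have "measure lebesgue (A \<inter> T) * \<kappa> \<le> v z"
          using part[of T] by (simp add: T_def sum_distrib_right)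
        moreover have "unit_ball_vol (real DIM('a)) * (\<rho> / 2) ^ DIM('a) * \<kappa> \<le> measure lebesgue (A \<inter> T) * \<kappa>"
          using mT \<kappa> by (rule mult_right_mono)
        moreover have "unit_ball_vol (real DIM('a)) * (\<rho> / 2) ^ DIM('a) * \<kappa> = c0"
          using t by (simp add: c0_def exit_const_def \<kappa>_def \<rho>_def power_mult_distrib power_divide field_simps)
        ultimately show ?thesis by linarith
      qed
      then have "1 \<le> (1 / c0) * v z" using c0 by (simp add: field_simps)
      then have "0 \<le> H z" unfolding H_def using Wz \<beta>0[OF z] by linarith
      then show ?thesis ..
    next
      case 4
      define U where "U = {z :: 'a \<times> real. dist (fst z) x0 < R} \<inter> {z. s < snd z} \<inter> {z. snd z < R} \<inter>
          {z. infdist (fst z) E < M * snd z}"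
      have "open U" unfolding U_def
        by (intro open_Int open_Collect_less continuous_intros)
      moreover have "z \<in> U" "U \<subseteq> D" using 4 by (auto simp: U_def D_def xt)
      ultimately have int: "z \<in> interior D" by (auto intro: interiorI)
      obtain p L where W: "has_lap W z p L" "L \<le> 0" using super[of z] t by (auto simp: xt)
      have "\<exists>p. has_lap poisson (z + (- (a i, 0))) p 0" for i
        by (rule poisson_harmonic) (use t in \<open>simp add: xt\<close>)
      then obtain q where q: "\<And>i. has_lap poisson (z + (- (a i, 0))) (q i) 0" by metis
      have v: "has_lap v z (\<lambda>b. \<Sum>i<k. m i * q i b) (\<Sum>i<k. m i * 0)"
        unfolding v_def by (intro has_lap_sum has_lap_cmult has_lap_shift q)
      have sq: "has_lap (\<lambda>z. (snd z)\<^sup>2) z (\<lambda>b. 2 * snd z * snd b) (2 :: real)"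
        for z :: "'a \<times> real"
        using has_lap_power[OF has_lap_snd[of z], of 2] by (simp add: sum_snd_sq_Basis)
      have n: "has_lap (\<lambda>z. (norm (z + (- (x0, 0))))\<^sup>2) z (\<lambda>b. 2 * ((z + (- (x0, 0))) \<bullet> b))
          (2 * real DIM('a \<times> real))"
        by (rule has_lap_shift[OF has_lap_norm_sq])
      have sq': "has_lap (\<lambda>z. (- 1) * (snd z)\<^sup>2) z (\<lambda>b. (- 1) * (2 * snd z * snd b)) ((- 1) * (2 :: real))"
        by (rule has_lap_cmult[OF sq])
      have lin: "has_lap (\<lambda>z. 2 * R * snd z) z (\<lambda>b. 2 * R * snd b) (2 * R * 0)"
        by (rule has_lap_cmult[OF has_lap_snd])
      from has_lap_cmult[OF has_lap_add[OF n has_lap_add[OF sq' has_lap_cmult[OF has_lap_add[OF lin sq']]]]]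
      have b: "\<exists>p. has_lap \<beta> z p ((1 / R\<^sup>2) * (2 * real DIM('a \<times> real) + ((- 1) * 2 +
          real DIM('a \<times> real) * (2 * R * 0 + (- 1) * 2))))"
        unfolding \<beta>_def by blast
      then obtain pb where pb: "has_lap \<beta> z pb ((1 / R\<^sup>2) * (- 2))" by (auto simp del: DIM_prod)
      have "has_lap H z (\<lambda>b. (p b + pb b) + ((1 / c0) * (\<Sum>i<k. m i * q i b) + 0))
         ((L + (1 / R\<^sup>2) * (- 2)) + ((1 / c0) * (\<Sum>i<k. m i * 0) + 0))"
        unfolding H_def by (intro has_lap_add has_lap_cmult has_lap_const W(1) pb v)
      moreover have "(L + (1 / R\<^sup>2) * (- 2)) + ((1 / c0) * (\<Sum>i<k. m i * 0) + 0) < 0"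
      proof -
        have "0 < 2 / R\<^sup>2" using R by simp
        then show ?thesis using W(2) by (simp add: order.strict_trans1)
      qed
      ultimately show ?thesis using int by blast
    qed
  qed
  then have "1 \<le> W (x0, \<eta> * R) + \<beta> (x0, \<eta> * R) + (1 / c0) * v (x0, \<eta> * R)" by (simp add: H_def)
  also have "\<beta> (x0, \<eta> * R) \<le> 2 * real DIM('a \<times> real) * \<eta>"
  proof -
    have "\<beta> (x0, \<eta> * R) = real DIM('a \<times> real) * (\<eta> * (2 - \<eta>))"
      unfolding \<beta> using R by (simp add: field_simps power2_eq_square)
    also have "\<dots> \<le> real DIM('a \<times> real) * (\<eta> * 2)" using \<eta> by (intro mult_left_mono) auto
    finally show ?thesis by (simp add: mult_ac)
  qed
  also have "v (x0, \<eta> * R) \<le> measure lebesgue A / (\<eta> * R) ^ DIM('a)"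
  proof -
    have "poisson ((x0, \<eta> * R) + (- (a i, 0))) \<le> 1 / (\<eta> * R) ^ DIM('a)" for i
      using poisson_le[of "(x0, \<eta> * R) + (- (a i, 0))"] \<eta> R by simp
    then have "v (x0, \<eta> * R) \<le> (\<Sum>i<k. m i * (1 / (\<eta> * R) ^ DIM('a)))"
      unfolding v_def by (intro sum_mono mult_left_mono) (auto simp: m_def)
    also have "\<dots> = measure lebesgue A / (\<eta> * R) ^ DIM('a)"
      using part[of UNIV] by (simp add: m_def sum_divide_distrib)
    finally show ?thesis .
  qed
  finally have "1 \<le> W (x0, \<eta> * R) + 2 * real DIM('a \<times> real) * \<eta> + (1 / c0) * (measure lebesgue A / (\<eta> * R) ^ DIM('a))"
    using c0 by (simp add: divide_right_mono)
  then show ?thesis by (simp add: A_def c0_def)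
qed

section \<open>Balls of near-full density\<close>

text \<open>A weak Lebesgue density statement: one ball is enough. If every ball missed more than
  the fraction \<epsilon>, take a bounded part \<open>B'\<close> of positive measure and an open
  \<open>T\<close> around it with \<open>T - B'\<close> smaller than \<epsilon> times the measure of
  \<open>B'\<close>. Disjoint Vitali balls inside \<open>T\<close> cover almost all of
  \<open>B'\<close>, yet lose the fraction \<epsilon> to the complement of \<open>B\<close>: a
  contradiction.\<close>

lemma near_density_ball:
  fixes B :: "'a::euclidean_space set"
  assumes B: "B \<in> sets lebesgue" "\<not> negligible B" and \<epsilon>: "\<epsilon> > 0"
  obtains x R where "R > 0" "measure lebesgue (ball x R - B) \<le> \<epsilon> * measure lebesgue (ball x R)"
proof (rule ccontr)
  assume "\<not> thesis"
  then have no: "\<epsilon> * measure lebesgue (ball x R) < measure lebesgue (ball x R - B)" if "R > 0" for x R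
    using that \<open>\<And>x R. 0 < R \<Longrightarrow> measure lebesgue (ball x R - B) \<le> \<epsilon> * measure lebesgue (ball x R) \<Longrightarrow> thesis\<close>
    by (meson not_le)
  have "\<exists>r::nat. \<not> negligible (B \<inter> ball 0 (real r))"
  proof (rule ccontr)
    assume "\<nexists>r::nat. \<not> negligible (B \<inter> ball 0 (real r))"
    then have "negligible (\<Union>r::nat. B \<inter> ball 0 (real r))" by (intro negligible_countable_Union) auto
    moreover have "B \<subseteq> (\<Union>r::nat. B \<inter> ball 0 (real r))" using reals_Archimedean2 by auto
    ultimately show False using B negligible_subset by blast
  qed
  then obtain r :: nat where r: "\<not> negligible (B \<inter> ball 0 (real r))" by blast
  define B' where "B' = B \<inter> ball 0 (real r)"
  have B': "B' \<in> lmeasurable" unfolding B'_def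
    using fmeasurable_Int_fmeasurable[of "ball 0 (real r)" lebesgue B] B by (simp add: Int_commute)
  have mB': "measure lebesgue B' > 0"
    using r B' by (metis B'_def measure_le_0_iff negligible_iff_measure not_le)
  define e where "e = \<epsilon> * measure lebesgue B'"
  have e: "e > 0" using \<epsilon> mB' by (simp add: e_def)
  have "B' \<in> sets lebesgue" using B' by (rule fmeasurableD)
  from sets_lebesgue_outer_open[OF this e] obtain T where T0: "open T" "B' \<subseteq> T" "T - B' \<in> lmeasurable"
    "emeasure lebesgue (T - B') < ennreal e" by metis
  have "T = B' \<union> (T - B')" using T0 by auto
  then have "T \<in> lmeasurable" using B' T0(3) fmeasurable.Un by metis
  then have T: "open T" "B' \<subseteq> T" "T \<in> lmeasurable" "measure lebesgue (T - B') < e"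
    using T0 e emeasure_eq_measure2[OF T0(3)] by (auto simp: ennreal_less_iff)
  define K where "K = {i :: 'a \<times> real. snd i > 0 \<and> ball (fst i) (snd i) \<subseteq> T}"
  have cov: "\<exists>i. i \<in> K \<and> x \<in> ball (fst i) (snd i) \<and> snd i < d" if xd: "x \<in> B'" "d > 0" for x d
  proof -
    obtain \<rho> where \<rho>: "\<rho> > 0" "ball x \<rho> \<subseteq> T"
      using T(1,2) xd(1) unfolding open_contains_ball by (meson subsetD)
    have "ball x (min \<rho> (d / 2)) \<subseteq> T" using \<rho> by auto
    then show ?thesis using \<rho> xd by (intro exI[of _ "(x, min \<rho> (d / 2))"]) (auto simp: K_def)
  qed
  obtain C where C: "countable C" "C \<subseteq> K"
     "pairwise (\<lambda>i j. disjnt (ball (fst i) (snd i)) (ball (fst j) (snd j))) C"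
     "negligible (B' - (\<Union>i\<in>C. ball (fst i) (snd i)))"
    by (rule Vitali_covering_theorem_balls[of B' K fst snd]) (use cov in blast)+
  define V where "V = (\<Union>i\<in>C. ball (fst i) (snd i))"
  have dis: "disjoint_family_on (\<lambda>i. ball (fst i) (snd i)) C"
    using C(3) by (auto simp: pairwise_def disjoint_family_on_def disjnt_def)
  have VT: "V \<subseteq> T" using C(2) by (auto simp: V_def K_def)
  have Vo: "open V" by (auto simp: V_def)
  have Vm: "V \<in> lmeasurable" by (rule fmeasurableI2[OF T(3) VT]) (use Vo in simp)
  have e1: "emeasure lebesgue V = (\<integral>\<^sup>+i. emeasure lebesgue (ball (fst i) (snd i)) \<partial>count_space C)"
    unfolding V_def by (rule emeasure_UN_countable[OF _ C(1) dis]) auto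
  have e2: "emeasure lebesgue (V - B) = (\<integral>\<^sup>+i. emeasure lebesgue (ball (fst i) (snd i) - B) \<partial>count_space C)"
  proof -
    have "V - B = (\<Union>i\<in>C. ball (fst i) (snd i) - B)" by (auto simp: V_def)
    moreover have "disjoint_family_on (\<lambda>i. ball (fst i) (snd i) - B) C"
      using dis unfolding disjoint_family_on_def by blast
    moreover have "ball (fst i) (snd i) - B \<in> sets lebesgue" for i
      using B by (intro sets.Diff) auto
    ultimately show ?thesis
      using emeasure_UN_countable[OF _ C(1), of "\<lambda>i. ball (fst i) (snd i) - B" lebesgue] by metis
  qed
  have e3: "ennreal \<epsilon> * emeasure lebesgue (ball (fst i) (snd i)) \<le> emeasure lebesgue (ball (fst i) (snd i) - B)"
    if "i \<in> C" for i
  proof -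
    have i: "snd i > 0" using that C(2) by (auto simp: K_def)
    have 1: "ball (fst i) (snd i) - B \<in> lmeasurable" using B by (intro fmeasurable_Diff) auto
    have "ennreal \<epsilon> * emeasure lebesgue (ball (fst i) (snd i)) = ennreal (\<epsilon> * measure lebesgue (ball (fst i) (snd i)))"
      using \<epsilon> emeasure_eq_measure2[of "ball (fst i) (snd i)" lebesgue] by (simp add: ennreal_mult)
    also have "\<dots> \<le> ennreal (measure lebesgue (ball (fst i) (snd i) - B))"
      using no[OF i, of "fst i"] by (intro ennreal_leI) simp
    also have "\<dots> = emeasure lebesgue (ball (fst i) (snd i) - B)" using emeasure_eq_measure2[OF 1] by simp
    finally show ?thesis .
  qed
  have "ennreal \<epsilon> * emeasure lebesgue V =
      (\<integral>\<^sup>+i. ennreal \<epsilon> * emeasure lebesgue (ball (fst i) (snd i)) \<partial>count_space C)"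
    unfolding e1 by (rule nn_integral_cmult[symmetric]) simp
  also have "\<dots> \<le> emeasure lebesgue (V - B)"
    unfolding e2 by (rule nn_integral_mono) (use e3 in simp)
  finally have "ennreal \<epsilon> * emeasure lebesgue V \<le> emeasure lebesgue (V - B)" .
  moreover have VB: "V - B \<in> lmeasurable" using Vm B by (intro fmeasurable_Diff) auto
  ultimately have 1: "\<epsilon> * measure lebesgue V \<le> measure lebesgue (V - B)"
    using \<epsilon> emeasure_eq_measure2[OF Vm] emeasure_eq_measure2[OF VB]
    by (simp flip: ennreal_mult)
  have neg: "negligible (B' - V)" using C(4) by (simp add: V_def)
  have "measure lebesgue B' \<le> measure lebesgue (V \<union> (B' - V))"
    using B' Vm by (intro measure_mono_fmeasurable fmeasurable.Un fmeasurable_Diff) auto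
  also have "\<dots> \<le> measure lebesgue V + measure lebesgue (B' - V)"
    using neg Vm by (intro measure_Un_le) (auto intro: negligible_imp_sets)
  also have "\<dots> = measure lebesgue V" using neg by (simp add: negligible_imp_measure0)
  finally have 2: "measure lebesgue B' \<le> measure lebesgue V" .
  have "measure lebesgue (V - B) \<le> measure lebesgue (T - B')"
    using VT VB T B' by (intro measure_mono_fmeasurable fmeasurable_Diff) (auto simp: B'_def)
  also have "\<dots> < e" using T by simp
  finally have "measure lebesgue (V - B) < \<epsilon> * measure lebesgue B'" by (simp add: e_def)
  also have "\<dots> \<le> \<epsilon> * measure lebesgue V" using 2 \<epsilon> by simp
  finally show False using 1 by simp
qed

section \<open>Layered harmonic functions\<close>

lemma sum_inverse_powers_le:
  fixes \<theta> :: real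
  assumes "\<theta> \<ge> 2"
  shows "(\<Sum>j=k..<b. 1 / \<theta> ^ j) \<le> 2 / \<theta> ^ k"
proof (cases "k \<le> b")
  case True
  then have "(\<Sum>j=k..<b. 1 / \<theta> ^ j) \<le> 2 / \<theta> ^ k - 2 / \<theta> ^ b"
  proof (induction b rule: dec_induct)
    case (step b)
    have "2 / \<theta> ^ Suc b \<le> 1 / \<theta> ^ b" using assms by (simp add: field_simps)
    then show ?case using step by simp
  qed simp
  also have "\<dots> \<le> 2 / \<theta> ^ k" using assms by simp
  finally show ?thesis .
qed (use assms in simp)

lemma sum_inverse_scales_le:
  fixes d :: "nat \<Rightarrow> real"
  assumes pos: "\<And>k. d k > 0" and half: "\<And>k. d (Suc k) \<le> d k / 2" and "a \<le> m"
  shows "(\<Sum>j=a..<m. 1 / d (Suc j)) \<le> 2 / d m"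
  using \<open>a \<le> m\<close>
proof (induction m rule: dec_induct)
  case base
  then show ?case using pos[of a] by simp
next
  case (step m)
  have "2 / d m \<le> 1 / d (Suc m)" using half[of m] pos[of m] pos[of "Suc m"] by (simp add: field_simps)
  moreover have "2 / d (Suc m) = 1 / d (Suc m) + 1 / d (Suc m)" by simp
  ultimately show ?case using step by simp
qed

lemma Suc_sq_le: "(real i + 1)\<^sup>2 \<le> 4 * 2 ^ i"
proof (induction i)
  case (Suc i)
  show ?case
  proof (cases "i \<le> 1")
    case True
    then have "i = 0 \<or> i = 1" by auto
    then show ?thesis by (auto simp: power2_eq_square)
  next
    case False
    then have "2 * 2 \<le> real i * real i" by (intro mult_mono) auto
    then have "(real (Suc i) + 1)\<^sup>2 \<le> 2 * (real i + 1)\<^sup>2" by (simp add: power2_eq_square algebra_simps)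
    then show ?thesis using Suc by simp
  qed
qed simp

text \<open>Isolates what the probabilistic part needs, normalised so that neither \<open>u\<close>
  nor \<open>K\<close> occurs and all constants come from \<theta> and \<gamma>.
  \<open>bound\<close> reaches down to height 0 over the closure of \<open>S\<close>, while
  \<open>decay\<close> says that a layer is exponentially small far above its scale. The guard
  \<open>S \<noteq> {}\<close> is there because \<open>infdist\<close> to the empty set is
  0.\<close>

locale layers =
  fixes d :: "nat \<Rightarrow> real" and \<theta> \<gamma> A1 M :: real and f :: "nat \<Rightarrow> 'a::euclidean_space \<times> real \<Rightarrow> real"
    and S :: "'a set"
  assumes \<theta>: "\<theta> \<ge> 3" and A1: "A1 \<ge> 0" and M: "M > 0" and \<gamma>: "4 * real DIM('a \<times> real) * A1\<^sup>2 \<le> \<gamma>"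
    and d_pos: "\<And>k. d k > 0" and d_half: "\<And>k. d (Suc k) \<le> d k / 2"
    and S: "S \<in> sets lebesgue"
    and cont: "\<And>j. continuous_on {z. snd z \<ge> 0} (f j)"
    and bound: "\<And>j z. snd z \<ge> 0 \<Longrightarrow> infdist (fst z) S \<le> M * snd z \<Longrightarrow> S \<noteq> {} \<Longrightarrow> \<bar>f j z\<bar> \<le> \<theta>"
    and decay: "\<And>j z m. snd z > 0 \<Longrightarrow> infdist (fst z) S \<le> M * snd z \<Longrightarrow> S \<noteq> {} \<Longrightarrow> d m \<le> snd z \<Longrightarrow>
      \<bar>f j z\<bar> \<le> \<theta> ^ m / \<theta> ^ j"
    and harm: "\<And>j z. snd z > 0 \<Longrightarrow> infdist (fst z) S \<le> M * snd z \<Longrightarrow> S \<noteq> {} \<Longrightarrow>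
      \<exists>P. has_lap (f j) z P 0 \<and> (\<forall>i\<in>Basis. \<bar>P i\<bar> \<le> A1 / d (Suc j))"
begin

lemma \<gamma>0: "\<gamma> \<ge> 0"
  using \<gamma> by (rule order_trans[rotated]) auto

text \<open>\<open>al\<close>, \<open>be\<close> and \<open>B\<close> serve as the bounds
  \<open>\<alpha>\<close>, \<open>\<beta>\<close> and the factor \<open>B\<close> of
  \<open>exp_corrected_superharmonic\<close>, and \<open>lam0\<close> is the largest exponent its
  two smallness conditions allow. \<open>V\<close> acts as a variance per unit of length:
  \<open>16 * B\<close> bounds the corrector on a block and \<open>64 * be\<close> offsets its lower
  bound. \<kappa> normalises the Chernoff exponents to \<open>8 * ln i * 4 ^ l\<close>, and
  \<open>C2\<close> adds the summed thresholds and the unchained remainder.\<close>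

definition "al = 16 * \<theta>\<^sup>2"
definition "be = 192 * \<theta>\<^sup>2"
definition "B = 2304 * al + 32 * \<gamma>"
definition "lam0 = sqrt (min (B / (20 * (B + 192 * al)\<^sup>2)) (1 / (2048 * be)))"
definition "V = 16 * B + 64 * be"
definition "\<kappa> = sqrt (8 / V)"
definition "C2 = 4 * V * \<kappa> + 4 * \<theta>"

lemma al: "al > 0" using \<theta> by (simp add: al_def)
lemma be: "be > 0" using \<theta> by (simp add: be_def)
lemma B: "B > 0" using al \<gamma>0 by (simp add: B_def)
lemma V: "V > 0" using B be by (simp add: V_def)
lemma \<kappa>: "\<kappa> > 0" "V * \<kappa>\<^sup>2 = 8" using V by (auto simp: \<kappa>_def)
lemma lam0: "lam0 > 0"
proof -
  have "(B + 192 * al)\<^sup>2 > 0" using B al by simp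
  then show ?thesis using B al be by (simp add: lam0_def)
qed

definition good :: "'a \<times> real \<Rightarrow> bool" where
  "good z \<longleftrightarrow> snd z > 0 \<and> infdist (fst z) S \<le> M * snd z \<and> S \<noteq> {}"

text \<open>The index where the behaviour changes at height \<open>t\<close>: over good points,
  layers from here on decay geometrically, while earlier ones are only bounded by \<theta>.\<close>

definition layer :: "real \<Rightarrow> nat" where
  "layer t = (LEAST m. d m \<le> t)"

lemma d_le_geometric: "d (k + i) \<le> d k / 2 ^ i"
proof (induction i)
  case (Suc i)
  have "d (k + Suc i) \<le> d (k + i) / 2" using d_half[of "k + i"] by simp
  also have "\<dots> \<le> d k / 2 ^ i / 2" using Suc by (intro divide_right_mono) auto
  finally show ?case by simp
qed simp

lemma layer:
  assumes "t > 0"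
  shows "d (layer t) \<le> t" "\<And>k. k < layer t \<Longrightarrow> t < d k"
proof -
  obtain i where "d 0 / t < 2 ^ i" using real_arch_pow[of 2 "d 0 / t"] by auto
  then have "d 0 / 2 ^ i \<le> t" using assms by (simp add: field_simps)
  then have ex: "\<exists>m. d m \<le> t" using d_le_geometric[of 0 i] by (metis add_0 order_trans)
  show "d (layer t) \<le> t" unfolding layer_def using ex by (rule LeastI_ex)
  show "t < d k" if "k < layer t" for k
    using not_less_Least[of k "\<lambda>m. d m \<le> t"] that by (auto simp: layer_def)
qed

lemma tail_high:
  assumes "good z" "layer (snd z) \<le> k"
  shows "\<bar>\<Sum>j=k..<b. f j z\<bar> \<le> 2 / 2 ^ (k - layer (snd z))"
proof -
  define m where "m = layer (snd z)"
  have dm: "d m \<le> snd z" using layer(1) assms(1) by (auto simp: good_def m_def)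
  have "\<bar>\<Sum>j=k..<b. f j z\<bar> \<le> (\<Sum>j=k..<b. \<bar>f j z\<bar>)" by (rule sum_abs)
  also have "\<dots> \<le> (\<Sum>j=k..<b. \<theta> ^ m * (1 / \<theta> ^ j))"
    using decay[OF _ _ _ dm] assms(1) by (intro sum_mono) (auto simp: good_def)
  also have "\<dots> \<le> \<theta> ^ m * (2 / \<theta> ^ k)"
    unfolding sum_distrib_left[symmetric] using \<theta> by (intro mult_left_mono sum_inverse_powers_le) auto
  also have "\<dots> = 2 / \<theta> ^ (k - m)"
    using assms(2) \<theta> by (simp add: m_def power_diff)
  also have "\<dots> \<le> 2 / 2 ^ (k - m)"
    using \<theta> by (intro divide_left_mono power_mono mult_pos_pos) auto
  finally show ?thesis by (simp add: m_def)
qed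

lemma tail_low:
  assumes "good z" "k \<le> layer (snd z)"
  shows "\<bar>\<Sum>j=k..<b. f j z\<bar> \<le> \<theta> * real (layer (snd z) - k) + 2"
proof -
  define m where "m = layer (snd z)"
  have low: "\<bar>\<Sum>j=k..<c. f j z\<bar> \<le> \<theta> * real (c - k)" for c
  proof -
    have "\<bar>\<Sum>j=k..<c. f j z\<bar> \<le> (\<Sum>j=k..<c. \<bar>f j z\<bar>)" by (rule sum_abs)
    also have "\<dots> \<le> (\<Sum>j=k..<c. \<theta>)" using bound[of z] assms(1) by (intro sum_mono) (auto simp: good_def)
    finally show ?thesis by (simp add: mult.commute)
  qed
  show ?thesis
  proof (cases "b \<le> m")
    case True
    have "\<theta> * real (b - k) \<le> \<theta> * real (m - k)" using True \<theta> by (intro mult_left_mono) auto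
    then show ?thesis using low[of b] by (simp add: m_def)
  next
    case False
    then have "(\<Sum>j=k..<b. f j z) = (\<Sum>j=k..<m. f j z) + (\<Sum>j=m..<b. f j z)"
      using assms(2) by (simp add: m_def sum.atLeastLessThan_concat)
    then show ?thesis using low[of m] tail_high[OF assms(1), of m b] by (simp add: m_def)
  qed
qed

lemma interval_sum_bound:
  assumes "good z"
  shows "\<bar>\<Sum>j=a..<b. f j z\<bar> \<le> \<theta> * real (layer (snd z)) + 2"
proof (cases "a \<le> layer (snd z)")
  case True
  have "\<theta> * real (layer (snd z) - a) \<le> \<theta> * real (layer (snd z))" using \<theta> by (intro mult_left_mono) auto
  then show ?thesis using tail_low[OF assms True, of b] by simp
next
  case False
  have "2 / 2 ^ (a - layer (snd z)) \<le> (2::real)" by (simp add: divide_le_eq)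
  moreover have "0 \<le> \<theta> * real (layer (snd z))" using \<theta> by simp
  ultimately show ?thesis using tail_high[OF assms, of a b] False by simp
qed

text \<open>For \<open>k\<close> below \<open>m\<close> the tail grows at most linearly in
  \<open>m - k\<close>, so its square is at most of order \<open>2 ^ (m - k)\<close>, while the
  weight is at most \<open>4 / 2 ^ (m - k)\<close>. One weight keeps the square bounded; the two
  further weights of the cube make it summable in \<open>k\<close>. For \<open>k\<close> from
  \<open>m\<close> on the tail itself decays.\<close>

lemma weighted_tail:
  assumes g: "good z"
  defines "m \<equiv> layer (snd z)" and "\<mu> \<equiv> \<lambda>k. snd z / (snd z + d (Suc k))"
  shows "(\<Sum>j=k..<b. f j z)\<^sup>2 * \<mu> k \<le> al"
    and "\<mu> k ^ 3 * (\<Sum>j=k..<b. f j z)\<^sup>2 \<le> (if k < m then 64 * \<theta>\<^sup>2 / 2 ^ (m - k) else 4 / 2 ^ (k - m))"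
proof -
  define G where "G = (\<Sum>j=k..<b. f j z)"
  have t: "snd z > 0" using g by (simp add: good_def)
  have \<mu>: "0 \<le> \<mu> k" "\<mu> k \<le> 1" using t d_pos[of "Suc k"] by (auto simp: \<mu>_def)
  have th: "9 \<le> \<theta>\<^sup>2" using \<theta> power_mono[of 3 \<theta> 2] by simp
  have *: "G\<^sup>2 * \<mu> k \<le> al \<and> \<mu> k ^ 3 * G\<^sup>2 \<le> (if k < m then 64 * \<theta>\<^sup>2 / 2 ^ (m - k) else 4 / 2 ^ (k - m))"
  proof (cases "k < m")
    case True
    define i where "i = m - k"
    have i: "i \<ge> 1" "m = k + i" using True by (auto simp: i_def)
    have "\<bar>G\<bar> \<le> \<theta> * real i + 2" using tail_low[OF g, of k b] True by (simp add: G_def m_def i_def)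
    also have "\<dots> \<le> \<theta> * (real i + 1)" using \<theta> by (simp add: algebra_simps)
    finally have "\<bar>G\<bar>\<^sup>2 \<le> (\<theta> * (real i + 1))\<^sup>2" by (intro power_mono) auto
    then have "G\<^sup>2 \<le> \<theta>\<^sup>2 * (real i + 1)\<^sup>2" by (simp add: power_mult_distrib)
    also have "\<dots> \<le> \<theta>\<^sup>2 * (4 * 2 ^ i)" by (intro mult_left_mono Suc_sq_le) auto
    finally have G: "G\<^sup>2 \<le> \<theta>\<^sup>2 * (4 * 2 ^ i)" .
    \<comment> \<open>The height is below \<open>d (m - 1)\<close>, that is, \<open>i - 2\<close>
      halvings beyond \<open>d (Suc k)\<close>. This loss of two steps is the factor 4, and for
      \<open>i = 1\<close> the bound is trivial.\<close>
    have \<mu>i: "\<mu> k \<le> 4 / 2 ^ i"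
    proof (cases "i = 1")
      case False
      then obtain i' where i': "i = Suc (Suc i')" using i(1) by (metis Suc_le_D One_nat_def not0_implies_Suc)
      have "snd z < d (Suc k + i')" using layer(2)[OF t, of "Suc k + i'"] i i' by (simp add: m_def)
      also have "\<dots> \<le> d (Suc k) / 2 ^ i'" by (rule d_le_geometric)
      finally have "snd z / d (Suc k) \<le> 1 / 2 ^ i'" using d_pos[of "Suc k"] by (simp add: field_simps)
      moreover have "\<mu> k \<le> snd z / d (Suc k)"
        unfolding \<mu>_def using t d_pos[of "Suc k"] by (intro divide_left_mono) auto
      ultimately show ?thesis by (simp add: i')
    qed (use \<mu> in simp)
    have "G\<^sup>2 * \<mu> k \<le> (\<theta>\<^sup>2 * (4 * 2 ^ i)) * (4 / 2 ^ i)"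
      using G \<mu>i \<mu> by (intro mult_mono) auto
    then have 1: "G\<^sup>2 * \<mu> k \<le> 16 * \<theta>\<^sup>2" by simp
    have "\<mu> k ^ 3 * G\<^sup>2 = (\<mu> k * \<mu> k) * (G\<^sup>2 * \<mu> k)" by (simp add: eval_nat_numeral)
    also have "\<mu> k * \<mu> k \<le> 4 / 2 ^ i * 1" using \<mu> \<mu>i by (intro mult_mono) auto
    then have "(\<mu> k * \<mu> k) * (G\<^sup>2 * \<mu> k) \<le> (4 / 2 ^ i * 1) * (16 * \<theta>\<^sup>2)"
      using 1 \<mu> by (intro mult_mono[of "\<mu> k * \<mu> k"]) auto
    finally show ?thesis using True 1 by (simp add: al_def i_def)
  next
    case False
    define i where "i = k - m"
    have p: "(1::real) \<le> 2 ^ i" by simp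
    have "\<bar>G\<bar> \<le> 2 / 2 ^ i" using tail_high[OF g, of k b] False by (simp add: G_def m_def i_def)
    then have "\<bar>G\<bar>\<^sup>2 \<le> (2 / 2 ^ i)\<^sup>2" by (intro power_mono) auto
    then have "G\<^sup>2 \<le> (4 / 2 ^ i) * (1 / 2 ^ i)" by (simp add: power2_eq_square)
    also have "\<dots> \<le> (4 / 2 ^ i) * 1" using p by (intro mult_left_mono) auto
    finally have G: "G\<^sup>2 \<le> 4 / 2 ^ i" by simp
    also have "\<dots> \<le> 4" using p by (simp add: field_simps)
    finally have G4: "G\<^sup>2 \<le> 4" .
    have "G\<^sup>2 * \<mu> k \<le> 4 * 1" using G4 \<mu> by (intro mult_mono) auto
    then have 1: "G\<^sup>2 * \<mu> k \<le> al" using th by (simp add: al_def)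
    have "\<mu> k ^ 3 * G\<^sup>2 \<le> 1 * (4 / 2 ^ i)" using \<mu> G by (intro mult_mono power_le_one) auto
    then show ?thesis using False 1 by (simp add: i_def)
  qed
  then show "(\<Sum>j=k..<b. f j z)\<^sup>2 * \<mu> k \<le> al"
    and "\<mu> k ^ 3 * (\<Sum>j=k..<b. f j z)\<^sup>2 \<le> (if k < m then 64 * \<theta>\<^sup>2 / 2 ^ (m - k) else 4 / 2 ^ (k - m))"
    by (auto simp: G_def)
qed

lemma weighted_tail_sum:
  assumes g: "good z"
  shows "(\<Sum>k=a..<b. (snd z / (snd z + d (Suc k))) ^ 3 * (\<Sum>j=k..<b. f j z)\<^sup>2) \<le> be"
proof -
  define m where "m = layer (snd z)"
  have th: "9 \<le> \<theta>\<^sup>2" using \<theta> power_mono[of 3 \<theta> 2] by simp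
  let ?\<psi> = "\<lambda>k. if k < m then 64 * \<theta>\<^sup>2 / 2 ^ (m - k) else 4 / 2 ^ (k - m)"
  have "(\<Sum>k=a..<b. (snd z / (snd z + d (Suc k))) ^ 3 * (\<Sum>j=k..<b. f j z)\<^sup>2) \<le> (\<Sum>k=a..<b. ?\<psi> k)"
    unfolding m_def by (intro sum_mono weighted_tail(2) g)
  also have "\<dots> \<le> (\<Sum>k\<in>{..<m} \<union> {m..<m + b}. ?\<psi> k)"
    by (intro sum_mono2) auto
  also have "\<dots> = (\<Sum>k<m. ?\<psi> k) + (\<Sum>k=m..<m+b. ?\<psi> k)"
    by (intro sum.union_disjoint) auto
  also have "(\<Sum>k<m. ?\<psi> k) = 64 * \<theta>\<^sup>2 * (\<Sum>k<m. 1 / 2 ^ (m - k))"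
    by (simp add: sum_distrib_left)
  also have "(\<Sum>k<m. 1 / 2 ^ (m - k)) = (\<Sum>k=1..<Suc m. 1 / (2::real) ^ k)"
    by (rule sum.reindex_bij_witness[of _ "\<lambda>k. m - k" "\<lambda>k. m - k"]) auto
  also have "(\<Sum>k=m..<m+b. ?\<psi> k) = (\<Sum>k=m..<m+b. 4 / 2 ^ (k - m))" by (rule sum.cong) auto
  also have "\<dots> = (\<Sum>k=0..<b. 4 * (1 / 2 ^ k))"
    by (rule sum.reindex_bij_witness[of _ "\<lambda>k. k + m" "\<lambda>k. k - m"]) auto
  also have "\<dots> = 4 * (\<Sum>k=0..<b. 1 / 2 ^ k)" by (simp add: sum_distrib_left)
  also have "64 * \<theta>\<^sup>2 * (\<Sum>k=1..<Suc m. 1 / (2::real) ^ k) + 4 * (\<Sum>k=0..<b. 1 / 2 ^ k)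
      \<le> 64 * \<theta>\<^sup>2 * (2 / 2 ^ 1) + 4 * (2 / 2 ^ 0)"
    by (intro add_mono mult_left_mono sum_inverse_powers_le) auto
  also have "\<dots> \<le> be" using th by (simp add: be_def)
  finally show ?thesis .
qed

text \<open>The lower bound does not depend on the interval, so the corrector costs only a constant
  where a large sum has to be detected; the upper bound is linear in the number of layers and plays
  the role of a variance.\<close>

lemma corrector_bounds:
  assumes "good z" "a < b"
  shows "- 64 * be \<le> corrector d f B a b z" "corrector d f B a b z \<le> B * (real b - real a + 1)"
proof -
  have t: "snd z > 0" using assms by (simp add: good_def)
  have "0 \<le> B * (\<Sum>k=a..b. snd z / (snd z + d k))"
    using t d_pos B by (intro mult_nonneg_nonneg sum_nonneg) (auto intro!: divide_nonneg_pos add_pos_pos)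
  then show "- 64 * be \<le> corrector d f B a b z"
    using weighted_tail_sum[OF assms(1), where a=a and b=b] unfolding corrector_def by linarith
  have "(\<Sum>k=a..b. snd z / (snd z + d k)) \<le> (\<Sum>k=a..b. 1)"
    using t d_pos by (intro sum_mono) (auto simp: add_pos_pos less_imp_le)
  also have "\<dots> = real b - real a + 1" using assms(2) by (simp add: of_nat_diff)
  finally have "B * (\<Sum>k=a..b. snd z / (snd z + d k)) \<le> B * (real b - real a + 1)"
    using B by (intro mult_left_mono) auto
  moreover have "0 \<le> (\<Sum>k=a..<b. (snd z / (snd z + d (Suc k))) ^ 3 * (\<Sum>j=k..<b. f j z)\<^sup>2)"
    using t d_pos by (intro sum_nonneg mult_nonneg_nonneg zero_le_power zero_le_power2 divide_nonneg_pos add_pos_pos) auto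
  ultimately show "corrector d f B a b z \<le> B * (real b - real a + 1)"
    unfolding corrector_def by linarith
qed

lemma superharmonic:
  assumes g: "good z" and ab: "a < b" and l: "0 \<le> l" "l \<le> lam0"
  shows "\<exists>p L. has_lap (\<lambda>z. exp (l * (\<Sum>j=a..<b. f j z) + l\<^sup>2 * corrector d f B a b z)) z p L \<and> L \<le> 0"
proof -
  have t: "snd z > 0" using g by (simp add: good_def)
  obtain P where P: "\<And>j. has_lap (f j) z (P j) 0" "\<And>j i. i \<in> Basis \<Longrightarrow> \<bar>P j i\<bar> \<le> A1 / d (Suc j)"
    using harm[of z] g unfolding good_def by metis
  have "l\<^sup>2 \<le> lam0\<^sup>2" using l by (intro power_mono)
  also have "lam0\<^sup>2 = min (B / (20 * (B + 192 * al)\<^sup>2)) (1 / (2048 * be))"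
    unfolding lam0_def using B al be by simp
  finally have l2: "l\<^sup>2 \<le> B / (20 * (B + 192 * al)\<^sup>2)" "l\<^sup>2 \<le> 1 / (2048 * be)" by auto
  show ?thesis
  proof (rule exp_corrected_superharmonic[of d z a b f P, OF d_pos d_half t ab P(1)])
    show "(\<Sum>j=k..<b. f j z)\<^sup>2 * (snd z / (snd z + d (Suc k))) \<le> al" for k
      by (rule weighted_tail(1)[OF g])
    show "(\<Sum>k=a..<b. (snd z / (snd z + d (Suc k))) ^ 3 * (\<Sum>j=k..<b. f j z)\<^sup>2) \<le> be"
      by (rule weighted_tail_sum[OF g])
    show "(\<Sum>i\<in>Basis. (\<Sum>j=a..<m. P j i)\<^sup>2) \<le> \<gamma> / (d m)\<^sup>2" if "m \<in> {a..b}" for m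
    proof -
      have "(\<Sum>j=a..<m. P j i)\<^sup>2 \<le> 4 * A1\<^sup>2 / (d m)\<^sup>2" if i: "i \<in> Basis" for i
      proof -
        have "\<bar>\<Sum>j=a..<m. P j i\<bar> \<le> (\<Sum>j=a..<m. \<bar>P j i\<bar>)" by (rule sum_abs)
        also have "\<dots> \<le> (\<Sum>j=a..<m. A1 * (1 / d (Suc j)))" using P(2)[OF i] by (intro sum_mono) simp
        also have "\<dots> \<le> A1 * (2 / d m)"
          unfolding sum_distrib_left[symmetric] using A1 \<open>m \<in> {a..b}\<close>
          by (intro mult_left_mono sum_inverse_scales_le d_pos d_half) auto
        finally have "\<bar>\<Sum>j=a..<m. P j i\<bar>\<^sup>2 \<le> (A1 * (2 / d m))\<^sup>2" by (intro power_mono) auto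
        then show ?thesis by (simp add: power_mult_distrib power_divide mult_ac)
      qed
      then have "(\<Sum>i\<in>Basis. (\<Sum>j=a..<m. P j i)\<^sup>2) \<le> (\<Sum>i\<in>(Basis :: ('a \<times> real) set). 4 * A1\<^sup>2 / (d m)\<^sup>2)"
        by (intro sum_mono)
      also have "\<dots> = (4 * real DIM('a \<times> real) * A1\<^sup>2) / (d m)\<^sup>2" by simp
      also have "\<dots> \<le> \<gamma> / (d m)\<^sup>2" using \<gamma> by (intro divide_right_mono) auto
      finally show ?thesis .
    qed
    have "20 * l\<^sup>2 * (B + 192 * al)\<^sup>2 \<le> 20 * (B / (20 * (B + 192 * al)\<^sup>2)) * (B + 192 * al)\<^sup>2"
      using l2(1) by (intro mult_right_mono mult_left_mono) auto
    also have "\<dots> = B" using B al by simp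
    finally show "20 * l\<^sup>2 * (B + 192 * al)\<^sup>2 \<le> B" .
    show "2048 * l\<^sup>2 * be \<le> 1" using l2(2) be by (simp add: field_simps)
  qed (use al \<gamma>0 in \<open>auto simp: B_def\<close>)
qed

end

text \<open>The union bound over all levels, used with \<open>L = ln i\<close>. Since
  \<open>8 * L * 4 ^ l\<close> is at least \<open>2 * L + 4 * (l + 1)\<close> and
  \<open>exp 4\<close> is at least 32, the factor \<open>16 ^ (l + 1)\<close> is beaten with ratio
  1/2.\<close>

lemma powers_ln_summable_bound:
  fixes L :: real
  assumes "L \<ge> 1"
  shows "(\<Sum>l\<le>n. 16 ^ Suc l * exp (- 8 * L * 4 ^ l)) \<le> exp (- 2 * L)"
proof -
  have e4: "32 \<le> exp (4::real)"
  proof -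
    have "exp (1::real) \<ge> 5 / 2" using exp_lower_Taylor_quadratic[of 1] by simp
    then have "exp (1::real) ^ 4 \<ge> (5 / 2) ^ 4" by (intro power_mono) auto
    moreover have "exp (1::real) ^ 4 = exp 4" using exp_of_nat_mult[of 4 "1::real"] by simp
    ultimately show ?thesis by (simp add: power_divide)
  qed
  have summand: "16 ^ Suc l * exp (- 8 * L * 4 ^ l) \<le> exp (- 2 * L) * (1 / 2) ^ Suc l" for l
  proof -
    have "real (Suc l) \<le> 4 ^ l"
    proof (induction l)
      case (Suc l)
      have "real (Suc (Suc l)) \<le> 4 * real (Suc l)" by simp
      then show ?case using Suc by simp
    qed simp
    then have "8 * L * real (Suc l) \<le> 8 * L * 4 ^ l" using assms by (intro mult_left_mono) auto
    moreover have "2 * L + 4 * real (Suc l) \<le> 8 * L * real (Suc l)"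
    proof -
      have "1 * real (Suc l) \<le> L * real (Suc l)" "L * 1 \<le> L * real (Suc l)"
        using assms by (intro mult_right_mono mult_left_mono; simp)+
      then show ?thesis by linarith
    qed
    ultimately have "exp (- 8 * L * 4 ^ l) \<le> exp (- 2 * L + - (4 * real (Suc l)))" by simp
    also have "\<dots> = exp (- 2 * L) * exp (- (4 * real (Suc l)))" by (rule exp_add)
    also have "exp (- (4 * real (Suc l))) = 1 / exp 4 ^ Suc l"
      by (simp only: exp_minus inverse_eq_divide exp_of_nat2_mult)
    also have "\<dots> \<le> 1 / 32 ^ Suc l" using e4 by (intro divide_left_mono power_mono mult_pos_pos) auto
    finally have "exp (- 8 * L * 4 ^ l) \<le> exp (- 2 * L) * (1 / 32 ^ Suc l)" by (simp add: mult_left_mono)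
    then have "16 ^ Suc l * exp (- 8 * L * 4 ^ l) \<le> 16 ^ Suc l * (exp (- 2 * L) * (1 / 32 ^ Suc l))"
      by (intro mult_left_mono) auto
    also have "\<dots> = exp (- 2 * L) * (16 / 32) ^ Suc l" by (simp only: power_divide mult_ac times_divide_eq_right mult_1_right)
    finally show ?thesis by simp
  qed
  have "(\<Sum>l\<le>n. 16 ^ Suc l * exp (- 8 * L * 4 ^ l)) \<le> (\<Sum>l\<le>n. exp (- 2 * L) * (1 / 2) ^ Suc l)"
    by (intro sum_mono summand)
  also have "\<dots> = exp (- 2 * L) * (\<Sum>l\<le>n. (1 / 2) ^ Suc l)" by (simp add: sum_distrib_left)
  also have "(\<Sum>l\<le>n. (1 / 2) ^ Suc l) \<le> (1::real)"
  proof -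
    have "(\<Sum>l\<le>n. (1 / 2) ^ Suc l) = (1::real) - (1 / 2) ^ Suc n" by (induction n) auto
    then show ?thesis by simp
  qed
  finally show ?thesis by (simp add: mult_left_mono)
qed

context layers
begin

text \<open>
  The partial sums up to \<open>N < 16 ^ (i + 1)\<close> are chained through the base 16 digits of \<open>N\<close>: level \<open>l\<close>
  uses intervals of length at most \<open>15 * 16 ^ (i - l)\<close>. The thresholds decay like \<open>2 ^ - l\<close>, hence
  are summable in \<open>l\<close>, while the Chernoff exponents grow like \<open>4 ^ l * ln i\<close> and beat the \<open>16 ^ (l + 1)\<close>
  intervals of the level. The chaining stops at \<open>l = i div 2\<close>, so that \<open>lam\<close> stays small.
\<close>

definition lo :: "nat \<Rightarrow> nat \<Rightarrow> nat \<Rightarrow> nat" where "lo i l c = 16 ^ (Suc (i - l)) * c"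
definition hi :: "nat \<Rightarrow> nat \<Rightarrow> nat \<Rightarrow> nat \<Rightarrow> nat" where "hi i l c e = lo i l c + 16 ^ (i - l) * e"
definition lam :: "nat \<Rightarrow> nat \<Rightarrow> real" where "lam i l = \<kappa> * sqrt (ln (real i)) * 8 ^ l / 4 ^ i"
definition thr :: "nat \<Rightarrow> nat \<Rightarrow> real" where "thr i l = 2 * V * lam i l * 16 ^ (i - l)"

definition bad :: "nat \<Rightarrow> 'a set" where
  "bad i = {x. \<exists>l\<le>i div 2. \<exists>c<16 ^ l. \<exists>e\<in>{1..<16}. thr i l < (\<Sum>j=lo i l c..<hi i l c e. f j (x, 0))}"

text \<open>The prefactor is calibrated so that the gauge is at least 1 wherever the block sum
  exceeds \<open>thr i l - 1\<close>: \<open>64 * be\<close> offsets the lower bound of the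
  corrector, and the slack 1 pays for passing from the boundary to a small height.\<close>

definition gauge :: "nat \<Rightarrow> nat \<Rightarrow> nat \<Rightarrow> nat \<Rightarrow> 'a \<times> real \<Rightarrow> real" where
  "gauge i l c e z = exp ((lam i l)\<^sup>2 * (64 * be) + lam i l * (1 - thr i l)) *
     exp (lam i l * (\<Sum>j=lo i l c..<hi i l c e. f j z) + (lam i l)\<^sup>2 * corrector d f B (lo i l c) (hi i l c e) z)"

definition total_gauge :: "nat \<Rightarrow> 'a \<times> real \<Rightarrow> real" where
  "total_gauge i z = (\<Sum>l\<le>i div 2. \<Sum>c<16 ^ l. \<Sum>e\<in>{1..<16}. gauge i l c e z)"

lemma lo_less_hi: "1 \<le> e \<Longrightarrow> lo i l c < hi i l c e"
  by (simp add: hi_def)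

lemma lam_nonneg: "i \<ge> 1 \<Longrightarrow> 0 \<le> lam i l"
  using \<kappa> by (simp add: lam_def)

text \<open>The Chernoff exponent of a level. The growth \<open>4 ^ l\<close> comes from
  \<open>64 ^ l * 16 ^ (i - l) = 4 ^ l * 16 ^ i\<close>, the remaining constant from
  \<open>V * \<kappa>\<^sup>2 = 8\<close>.\<close>

lemma lam_sq:
  assumes "i \<ge> 1" "l \<le> i"
  shows "V * (lam i l)\<^sup>2 * 16 ^ (i - l) = 8 * ln (real i) * 4 ^ l"
proof -
  have sq: "((8::real) ^ l)\<^sup>2 = 64 ^ l" "((4::real) ^ i)\<^sup>2 = 16 ^ i"
    by (simp_all add: power2_eq_square flip: power_mult_distrib)
  have A: "(lam i l)\<^sup>2 = \<kappa>\<^sup>2 * ln (real i) * 64 ^ l / 16 ^ i"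
    using assms by (simp add: lam_def power_mult_distrib power_divide sq)
  have E: "(64::real) ^ l * 16 ^ (i - l) / 16 ^ i = 4 ^ l"
  proof -
    have "(16::real) ^ i = 16 ^ l * 16 ^ (i - l)" using assms(2) by (simp flip: power_add)
    moreover have "(64::real) ^ l = 4 ^ l * 16 ^ l" by (simp flip: power_mult_distrib)
    ultimately show ?thesis by simp
  qed
  have "V * (lam i l)\<^sup>2 * 16 ^ (i - l) = (V * \<kappa>\<^sup>2) * ln (real i) * ((64::real) ^ l * 16 ^ (i - l) / 16 ^ i)"
    unfolding A by (simp add: field_simps)
  then show ?thesis unfolding \<kappa>(2) E .
qed

lemma thr_eq:
  assumes "l \<le> i"
  shows "thr i l = 2 * V * \<kappa> * 4 ^ i * sqrt (ln (real i)) * (1 / 2 ^ l)"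
proof -
  have 1: "(16::real) ^ i = 16 ^ l * 16 ^ (i - l)" using assms by (simp flip: power_add)
  have 2: "(16::real) ^ i = 4 ^ i * 4 ^ i" "(16::real) ^ l = 2 ^ l * 8 ^ l"
    by (simp_all flip: power_mult_distrib)
  have "(8::real) ^ l / 4 ^ i * 16 ^ (i - l) = 4 ^ i * (1 / 2 ^ l)"
    using 1 unfolding 2 by (simp add: field_simps)
  moreover have "thr i l = 2 * V * \<kappa> * sqrt (ln (real i)) * (8 ^ l / 4 ^ i * 16 ^ (i - l))"
    by (simp add: thr_def lam_def)
  ultimately show ?thesis by simp
qed

text \<open>Stopping at half of the digits gives \<open>(8 ^ l)\<^sup>2 \<le> 8 ^ i\<close>, so the
  square of \<open>lam i l\<close> is at most a constant times \<open>ln i / 2 ^ i\<close>, which is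
  weakened to \<open>ln i / i\<close>.\<close>

lemma lam_eventually_small: "\<forall>\<^sub>F i in sequentially. \<forall>l\<le>i div 2. lam i l \<le> lam0"
proof -
  have "((\<lambda>i. ln (real i) / real i) \<longlonglongrightarrow> 0)" by (rule lim_ln_over_n)
  then have "\<forall>\<^sub>F i in sequentially. ln (real i) / real i < (lam0 / \<kappa>)\<^sup>2"
    using lam0 \<kappa> by (intro order_tendstoD(2)) auto
  moreover have "\<forall>\<^sub>F i in sequentially. i \<ge> (1::nat)" by (rule eventually_ge_at_top)
  ultimately show ?thesis
  proof eventually_elim
    case (elim i)
    show ?case
    proof (intro allI impI)
      fix l assume l: "l \<le> i div 2"
      have "(8::real) ^ (2 * l) \<le> 8 ^ i" using l by (intro power_increasing) auto
      then have 1: "((8::real) ^ l)\<^sup>2 \<le> 8 ^ i" by (simp add: power_mult mult.commute[of l 2] flip: power_mult)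
      have "((4::real) ^ i)\<^sup>2 = 16 ^ i" by (simp add: power2_eq_square flip: power_mult_distrib)
      then have "(lam i l / \<kappa>)\<^sup>2 = ln (real i) * ((8 ^ l)\<^sup>2 / 16 ^ i)"
        using elim \<kappa> by (simp add: lam_def power_mult_distrib power_divide)
      also have "\<dots> \<le> ln (real i) * (8 ^ i / 16 ^ i)"
        using elim 1 by (intro mult_left_mono divide_right_mono) auto
      also have "(8::real) ^ i / 16 ^ i = (1 / 2) ^ i" by (simp flip: power_divide)
      also have "ln (real i) * (1 / 2) ^ i \<le> ln (real i) * (1 / real i)"
      proof (rule mult_left_mono)
        have "real i \<le> 2 ^ i" using less_exp[of i] by (metis less_imp_le of_nat_le_iff of_nat_numeral of_nat_power)
        then show "(1 / 2) ^ i \<le> 1 / real i" using elim by (simp add: power_divide field_simps)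
      qed (use elim in auto)
      also have "\<dots> < (lam0 / \<kappa>)\<^sup>2" using elim by simp
      finally have "lam i l / \<kappa> < lam0 / \<kappa>" using lam0 \<kappa> by (intro power2_less_imp_less[of _ "lam0 / \<kappa>"]) auto
      then show "lam i l \<le> lam0" using \<kappa> by (simp add: divide_less_cancel)
    qed
  qed
qed

lemma total_gauge_superharmonic:
  assumes "good z" "i \<ge> 1" "\<And>l. l \<le> i div 2 \<Longrightarrow> lam i l \<le> lam0"
  shows "\<exists>p L. has_lap (total_gauge i) z p L \<and> L \<le> 0"
proof -
  have "\<exists>p L. has_lap (gauge i l c e) z p L \<and> L \<le> 0" if le: "l \<le> i div 2" "e \<in> {1..<16}" for l c e
  proof -
    obtain p L where L: "has_lap (\<lambda>z. exp (lam i l * (\<Sum>j=lo i l c..<hi i l c e. f j z) +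
        (lam i l)\<^sup>2 * corrector d f B (lo i l c) (hi i l c e) z)) z p L" "L \<le> 0"
      using superharmonic[OF assms(1) lo_less_hi[of e i l c] lam_nonneg[OF assms(2)] assms(3)[OF le(1)]] le(2) by auto
    from has_lap_cmult[OF L(1), of "exp ((lam i l)\<^sup>2 * (64 * be) + lam i l * (1 - thr i l))"] L(2)
    show ?thesis unfolding gauge_def[abs_def]
      by (intro exI conjI) (assumption, auto intro: mult_nonneg_nonpos)
  qed
  then have "\<forall>l c e. \<exists>p L. l \<le> i div 2 \<and> e \<in> {1..<16} \<longrightarrow>
      has_lap (gauge i l c e) z p L \<and> L \<le> 0" by blast
  then obtain p L where pL: "\<And>l c e. l \<le> i div 2 \<Longrightarrow> e \<in> {1..<16} \<Longrightarrow>
      has_lap (gauge i l c e) z (p l c e) (L l c e) \<and> L l c e \<le> 0" by metis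
  have "has_lap (total_gauge i) z (\<lambda>b. \<Sum>l\<le>i div 2. \<Sum>c<16 ^ l. \<Sum>e\<in>{1..<16}. p l c e b)
      (\<Sum>l\<le>i div 2. \<Sum>c<16 ^ l. \<Sum>e\<in>{1..<16}. L l c e)"
    unfolding total_gauge_def[abs_def] using pL by (intro has_lap_sum) auto
  moreover have "(\<Sum>l\<le>i div 2. \<Sum>c<16 ^ l. \<Sum>e\<in>{1..<16}. L l c e) \<le> 0"
    using pL by (intro sum_nonpos) auto
  ultimately show ?thesis by blast
qed

lemma gauge_nonneg: "gauge i l c e z \<ge> 0"
  by (simp add: gauge_def)

lemma gauge_ge_one:
  assumes g: "good z" and i: "i \<ge> 1" and e: "e \<in> {1..<16}"
    and big: "thr i l - 1 \<le> (\<Sum>j=lo i l c..<hi i l c e. f j z)"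
  shows "gauge i l c e z \<ge> 1"
proof -
  define T where "T = corrector d f B (lo i l c) (hi i l c e) z"
  have "- 64 * be \<le> T" unfolding T_def using e by (intro corrector_bounds(1)[OF g lo_less_hi]) auto
  then have "0 \<le> (lam i l)\<^sup>2 * (64 * be + T)" by simp
  moreover have "0 \<le> lam i l * (1 - thr i l + (\<Sum>j=lo i l c..<hi i l c e. f j z))"
    using lam_nonneg[OF i] big by (intro mult_nonneg_nonneg) auto
  ultimately have "0 \<le> ((lam i l)\<^sup>2 * (64 * be) + lam i l * (1 - thr i l)) +
      (lam i l * (\<Sum>j=lo i l c..<hi i l c e. f j z) + (lam i l)\<^sup>2 * T)"
    by (simp add: algebra_simps)
  then have "1 \<le> exp (((lam i l)\<^sup>2 * (64 * be) + lam i l * (1 - thr i l)) +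
      (lam i l * (\<Sum>j=lo i l c..<hi i l c e. f j z) + (lam i l)\<^sup>2 * T))" by simp
  then show ?thesis unfolding gauge_def T_def exp_add .
qed

text \<open>At a fixed point the block sum is bounded by a constant depending on the height alone,
  whatever the block. In the exponent there remain at most \<open>V\<close> times the square of
  \<open>lam i l\<close> and \<open>16 ^ (i - l)\<close> from the corrector, minus twice this amount
  from the threshold.\<close>

lemma gauge_le:
  assumes g: "good z" and i: "i \<ge> 1" and l: "l \<le> i" and e: "e \<in> {1..<16}" and small: "lam i l \<le> lam0"
  shows "gauge i l c e z \<le> exp (lam0 * (\<theta> * real (layer (snd z)) + 3)) * exp (- 8 * ln (real i) * 4 ^ l)"
proof -
  define T F where "T = corrector d f B (lo i l c) (hi i l c e) z"
    and "F = (\<Sum>j=lo i l c..<hi i l c e. f j z)"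
  define C where "C = \<theta> * real (layer (snd z)) + 3"
  define q :: real where "q = 16 ^ (i - l)"
  have q: "q \<ge> 1" by (simp add: q_def)
  have "T \<le> B * (real (hi i l c e) - real (lo i l c) + 1)"
    unfolding T_def using e by (intro corrector_bounds(2)[OF g lo_less_hi]) auto
  also have "real (hi i l c e) - real (lo i l c) = q * real e" by (simp add: hi_def q_def)
  also have "B * (q * real e + 1) \<le> B * (16 * q)"
  proof (rule mult_left_mono)
    have "real e \<le> 15" using e by auto
    then have "q * real e \<le> q * 15" using q by (intro mult_left_mono) auto
    then show "q * real e + 1 \<le> 16 * q" using q by linarith
  qed (use B in simp)
  finally have "T \<le> B * (16 * q)" .
  moreover have "64 * be * 1 \<le> 64 * be * q" using q be by (intro mult_left_mono) auto
  moreover have "V * q = B * (16 * q) + 64 * be * q" by (simp add: V_def algebra_simps)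
  ultimately have T: "64 * be + T \<le> V * q" by linarith
  have "F + 1 \<le> C" using interval_sum_bound[OF g, of "lo i l c" "hi i l c e"] by (simp add: F_def C_def)
  then have 1: "lam i l * (F + 1) \<le> lam i l * C" using lam_nonneg[OF i] by (intro mult_left_mono)
  have "0 \<le> C" using \<theta> by (simp add: C_def)
  then have 2: "lam i l * C \<le> lam0 * C" using small by (intro mult_right_mono)
  have 3: "(lam i l)\<^sup>2 * (64 * be + T) \<le> (lam i l)\<^sup>2 * (V * q)" using T by (intro mult_left_mono) auto
  have 4: "lam i l * thr i l = 2 * ((lam i l)\<^sup>2 * (V * q))" by (simp add: thr_def q_def power2_eq_square)
  have 5: "(lam i l)\<^sup>2 * (V * q) = 8 * ln (real i) * 4 ^ l"
    using lam_sq[OF i l] by (simp add: q_def mult_ac)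
  have "((lam i l)\<^sup>2 * (64 * be) + lam i l * (1 - thr i l)) + (lam i l * F + (lam i l)\<^sup>2 * T)
      = lam i l * (F + 1) + (lam i l)\<^sup>2 * (64 * be + T) - lam i l * thr i l" by (simp add: algebra_simps)
  also have "\<dots> \<le> lam0 * C + - 8 * ln (real i) * 4 ^ l" using 1 2 3 4 5 by linarith
  finally have "exp (((lam i l)\<^sup>2 * (64 * be) + lam i l * (1 - thr i l)) + (lam i l * F + (lam i l)\<^sup>2 * T))
      \<le> exp (lam0 * C + - 8 * ln (real i) * 4 ^ l)" by simp
  then show ?thesis unfolding gauge_def T_def F_def C_def exp_add .
qed

lemma total_gauge_le:
  assumes g: "good z" and i: "i \<ge> 3" and small: "\<And>l. l \<le> i div 2 \<Longrightarrow> lam i l \<le> lam0"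
  shows "total_gauge i z \<le> exp (lam0 * (\<theta> * real (layer (snd z)) + 3)) * (1 / real i ^ 2)"
proof -
  define C where "C = exp (lam0 * (\<theta> * real (layer (snd z)) + 3))"
  have L: "ln (real i) \<ge> 1" using i exp_le by (simp add: ln_ge_iff)
  have "total_gauge i z \<le> (\<Sum>l\<le>i div 2. \<Sum>c<(16::nat) ^ l. \<Sum>e\<in>{1..<(16::nat)}. C * exp (- 8 * ln (real i) * 4 ^ l))"
    unfolding total_gauge_def C_def using i by (intro sum_mono gauge_le g small) auto
  also have "\<dots> \<le> (\<Sum>l\<le>i div 2. C * (16 ^ Suc l * exp (- 8 * ln (real i) * 4 ^ l)))"
    by (intro sum_mono) (simp add: C_def)
  also have "\<dots> \<le> C * exp (- 2 * ln (real i))"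
    unfolding sum_distrib_left[symmetric] by (intro mult_left_mono powers_ln_summable_bound L) (simp add: C_def)
  also have "exp (- 2 * ln (real i)) = 1 / real i ^ 2"
  proof -
    have "exp (- 2 * ln (real i)) = inverse (exp (ln (real i)) * exp (ln (real i)))"
      by (simp add: exp_minus flip: exp_add)
    then show ?thesis using i by (simp add: power2_eq_square inverse_eq_divide)
  qed
  finally show ?thesis by (simp add: C_def)
qed

lemma chaining:
  assumes x: "x \<in> S" "x \<notin> bad i" and i: "i \<ge> 3" and N: "16 ^ i \<le> N" "N < 16 ^ Suc i"
  shows "(\<Sum>j<N. f j (x, 0)) \<le> C2 * (4 ^ i * sqrt (ln (real i)))"
proof -
  define F where "F N = (\<Sum>j<N. f j (x, 0))" for N
  \<comment> \<open>\<open>T l\<close> keeps the leading \<open>l + 1\<close> base 16 digits of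
    \<open>N\<close> and clears the others.\<close>
  define T where "T l = 16 ^ (i - l) * (N div 16 ^ (i - l))" for l
  have L: "ln (real i) \<ge> 1" using i exp_le by (simp add: ln_ge_iff)
  have thr0: "thr i l \<ge> 0" for l using lam_nonneg[of i l] V i by (simp add: thr_def)
  \<comment> \<open>\<open>bad\<close> tests only nonzero digits; for digit 0 the two endpoints
    agree and the nonnegative threshold suffices.\<close>
  have nb: "F (hi i l c e) - F (lo i l c) \<le> thr i l" if "l \<le> i div 2" "c < 16 ^ l" "e < 16" for l c e
  proof (cases "e = 0")
    case True
    then show ?thesis using thr0 by (simp add: hi_def)
  next
    case False
    then have "e \<in> {1..<16}" using that by simp
    then have "(\<Sum>j=lo i l c..<hi i l c e. f j (x, 0)) \<le> thr i l"
      using x(2) that(1,2) unfolding bad_def mem_Collect_eq by (meson not_less)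
    moreover have "F (hi i l c e) = F (lo i l c) + (\<Sum>j=lo i l c..<hi i l c e. f j (x, 0))"
      unfolding F_def by (simp add: sum.atLeastLessThan_concat hi_def flip: atLeast0LessThan)
    ultimately show ?thesis by simp
  qed
  have chain: "F (T l) \<le> (\<Sum>k\<le>l. thr i k)" if "l \<le> i div 2" for l
    using that
  proof (induction l)
    case 0
    have "N div 16 ^ i < 16" using N(2) by (simp add: less_mult_imp_div_less)
    then show ?case using nb[of 0 0 "N div 16 ^ i"] by (simp add: T_def hi_def lo_def F_def)
  next
    case (Suc l)
    define q where "q = i - Suc l"
    have q: "i - l = Suc q" using Suc.prems i by (auto simp: q_def)
    define c where "c = N div 16 ^ Suc q"
    define e where "e = (N div 16 ^ q) mod 16"
    have "N div 16 ^ q = 16 * c + e" unfolding c_def e_def power_Suc2 div_mult2_eq by simp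
    then have T: "T (Suc l) = hi i (Suc l) c e" by (simp add: T_def hi_def lo_def algebra_simps flip: q_def)
    have lo: "T l = lo i (Suc l) c" by (simp add: T_def lo_def q c_def flip: q_def)
    have "i = l + Suc q" using q by simp
    then have "N < 16 ^ Suc l * 16 ^ Suc q" using N(2) by (simp flip: power_add)
    then have "c < 16 ^ Suc l" unfolding c_def by (simp add: less_mult_imp_div_less)
    then have "F (T (Suc l)) - F (T l) \<le> thr i (Suc l)"
      unfolding T lo using Suc.prems by (intro nb) (auto simp: e_def)
    then show ?case using Suc by simp
  qed
  define h where "h = i div 2"
  define Q :: nat where "Q = 16 ^ (i - h)"
  have sumthr: "(\<Sum>k\<le>h. thr i k) \<le> 4 * V * \<kappa> * (4 ^ i * sqrt (ln (real i)))"
  proof -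
    have "(\<Sum>k\<le>h. thr i k) = (\<Sum>k=0..<Suc h. 2 * V * \<kappa> * 4 ^ i * sqrt (ln (real i)) * (1 / 2 ^ k))"
      unfolding atLeast0LessThan lessThan_Suc_atMost by (intro sum.cong refl thr_eq) (auto simp: h_def)
    also have "\<dots> \<le> 2 * V * \<kappa> * 4 ^ i * sqrt (ln (real i)) * (2 / 2 ^ 0)"
      unfolding sum_distrib_left[symmetric] using V \<kappa> L by (intro mult_left_mono sum_inverse_powers_le) auto
    finally show ?thesis by simp
  qed
  have "F N - F (T h) \<le> \<theta> * real Q"
  proof -
    have TN: "T h \<le> N" by (simp add: T_def h_def)
    have "F N = F (T h) + (\<Sum>j=T h..<N. f j (x, 0))"
      unfolding F_def using TN by (simp add: sum.atLeastLessThan_concat flip: atLeast0LessThan)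
    moreover have "(\<Sum>j=T h..<N. f j (x, 0)) \<le> (\<Sum>j=T h..<N. \<theta>)"
    proof (rule sum_mono)
      fix j
      have "\<bar>f j (x, 0)\<bar> \<le> \<theta>" using x(1) by (intro bound) auto
      then show "f j (x, 0) \<le> \<theta>" by simp
    qed
    moreover have "N - T h \<le> Q"
    proof -
      have "N - T h = N mod Q" by (simp add: T_def Q_def minus_mult_div_eq_mod)
      moreover have "N mod Q < Q" by (rule mod_less_divisor) (simp add: Q_def)
      ultimately show ?thesis by simp
    qed
    then have "\<theta> * real (N - T h) \<le> \<theta> * real Q" using \<theta> by (intro mult_left_mono) auto
    ultimately show ?thesis by (simp add: mult.commute)
  qed
  \<comment> \<open>The unchained remainder has fewer than \<open>16 ^ (i - i div 2)\<close> terms,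
    at most \<open>4 * 4 ^ i\<close>, so the trivial bound \<theta> per term already has the right
    size.\<close>
  moreover have "\<theta> * real Q \<le> 4 * \<theta> * (4 ^ i * sqrt (ln (real i)))"
  proof -
    have "2 * (i - h) \<le> Suc i" by (simp add: h_def)
    then have "(4::real) ^ (2 * (i - h)) \<le> 4 ^ Suc i" by (intro power_increasing) auto
    then have "real Q \<le> 4 * 4 ^ i * 1" by (simp add: Q_def power_mult)
    also have "\<dots> \<le> 4 * 4 ^ i * sqrt (ln (real i))" using L by (intro mult_left_mono) auto
    finally have "\<theta> * real Q \<le> \<theta> * (4 * 4 ^ i * sqrt (ln (real i)))" using \<theta> by (intro mult_left_mono) auto
    then show ?thesis by (simp add: mult_ac)
  qed
  moreover have "F (T h) \<le> (\<Sum>k\<le>h. thr i k)" by (rule chain) (simp add: h_def)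
  ultimately have "F N \<le> 4 * V * \<kappa> * (4 ^ i * sqrt (ln (real i))) + 4 * \<theta> * (4 ^ i * sqrt (ln (real i)))"
    using sumthr by linarith
  then show ?thesis by (simp add: F_def C2_def distrib_right)
qed

end

section \<open>Borel-Cantelli argument for the bad sets\<close>

context layers
begin

lemma continuous_interval_sum: "continuous_on {z. snd z \<ge> 0} (\<lambda>z. \<Sum>j=a..<b. f j z)"
  by (intro continuous_on_sum cont)

lemma continuous_boundary_sum: "continuous_on UNIV (\<lambda>x. \<Sum>j=a..<b. f j (x, 0))"
  by (rule continuous_on_compose2[OF continuous_interval_sum]) (auto intro!: continuous_intros)

lemma continuous_total_gauge: "continuous_on {z. snd z > 0} (total_gauge i)"
proof -
  have c: "continuous_on {z. snd z > 0} (\<lambda>z. \<Sum>j=a..<b. f j z)" for a b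
    by (rule continuous_on_subset[OF continuous_interval_sum]) auto
  have r: "continuous_on {z::'a \<times> real. snd z > 0} (\<lambda>z. snd z / (snd z + d k))" for k
  proof (intro continuous_on_divide continuous_on_add continuous_on_snd continuous_on_id continuous_on_const ballI)
    fix z :: "'a \<times> real" assume "z \<in> {z. snd z > 0}"
    then show "snd z + d k \<noteq> 0" using d_pos[of k] by auto
  qed
  have "continuous_on {z. snd z > 0} (corrector d f B a b)" for a b
    unfolding corrector_def[abs_def]
    by (intro continuous_on_add continuous_on_mult continuous_on_const continuous_on_sum continuous_on_power r c)
  then have "continuous_on {z. snd z > 0} (gauge i l c e)" for l c e
    unfolding gauge_def[abs_def]
    by (intro continuous_on_mult continuous_on_const continuous_on_exp continuous_on_add c)
  then show ?thesis
    unfolding total_gauge_def[abs_def] by (intro continuous_on_sum)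
qed

lemma open_bad: "open (bad i)"
proof -
  have "bad i = (\<Union>l\<in>{..i div 2}. \<Union>c\<in>{..<16 ^ l}. \<Union>e\<in>{1..<16}.
      {x. thr i l < (\<Sum>j=lo i l c..<hi i l c e. f j (x, 0))})"
    unfolding bad_def by blast
  moreover have "open {x. thr i l < (\<Sum>j=a..<b. f j (x, 0))}" for l a b
    by (intro open_Collect_less continuous_boundary_sum continuous_intros)
  ultimately show ?thesis by (simp only:) (intro open_UN ballI, assumption)
qed

text \<open>Uniform continuity on a compact slab. The radius \<open>(M + 1) * s\<close> is used
  because \<open>infdist x E \<le> M * s\<close> need not be attained, but yields a point of
  \<open>E\<close> strictly within \<open>(M + 1) * s\<close>; the tolerance 1 is the slack built
  into \<open>gauge\<close>.\<close>

lemma boundary_approximation: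
  fixes F :: "'a \<times> real \<Rightarrow> real"
  assumes "R > 0" and F: "continuous_on {z. snd z \<ge> 0} F"
  shows "\<forall>\<^sub>F s in at_right 0. \<forall>x x'. dist x x0 \<le> R \<longrightarrow> dist x x' < (M + 1) * s \<longrightarrow>
    \<bar>F (x, s) - F (x', 0)\<bar> < (1::real)"
proof -
  define K where "K = cball x0 (R + M + 1) \<times> {0..1::real}"
  have "continuous_on K F" by (rule continuous_on_subset[OF F]) (auto simp: K_def)
  then have "uniformly_continuous_on K F"
    by (rule compact_uniformly_continuous) (unfold K_def, intro compact_Times compact_cball compact_Icc)
  then obtain \<delta> where \<delta>: "\<delta> > 0" "\<And>z z'. z \<in> K \<Longrightarrow> z' \<in> K \<Longrightarrow> dist z' z < \<delta> \<Longrightarrow> dist (F z') (F z) < 1"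
    unfolding uniformly_continuous_on_def using zero_less_one by metis
  define r where "r = min 1 (\<delta> / (M + 2))"
  have r: "r > 0" using \<delta> M by (simp add: r_def)
  have "\<forall>\<^sub>F s in at_right 0. s \<in> {0<..<r}" using r by (rule eventually_at_right_real)
  then show ?thesis
  proof eventually_elim
    case (elim s)
    then have s: "0 < s" "s < 1" "s < \<delta> / (M + 2)" by (auto simp: r_def)
    show ?case
    proof (intro allI impI)
      fix x x' assume x: "dist x x0 \<le> R" "dist x x' < (M + 1) * s"
      have "(M + 1) * s \<le> (M + 1) * 1" using s M by (intro mult_left_mono) auto
      then have "dist x' x0 \<le> R + M + 1"
        using x dist_triangle[of x' x0 x] by (simp add: dist_commute)
      then have K: "(x, s) \<in> K" "(x', 0) \<in> K" using x s M by (auto simp: K_def dist_commute)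
      have "dist (x, s) (x', 0) \<le> dist x x' + dist s 0"
        unfolding dist_Pair_Pair by (rule sqrt_sum_squares_le_sum) auto
      also have "\<dots> < (M + 1) * s + s" using x s by simp
      also have "\<dots> = s * (M + 2)" by (simp add: algebra_simps)
      also have "\<dots> < \<delta>" using s(3) M by (simp add: pos_less_divide_eq)
      finally have "dist (F (x, s)) (F (x', 0)) < 1" using \<delta>(2)[OF K(2,1)] by simp
      then show "\<bar>F (x, s) - F (x', 0)\<bar> < 1" by (simp add: dist_real_def)
    qed
  qed
qed

text \<open>Otherwise the set fills almost all of some ball, and so does the part \<open>E\<close>
  of it caught by finitely many stages. The total gauge of these stages is at least 1 just above
  \<open>E\<close>, whereas at the apex it is below 1/2; each of the two barrier terms is at most
  1/4, contradicting \<open>sawtooth_comparison\<close>.\<close>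

lemma negligible_infinitely_often_bad: "negligible {x \<in> S. \<exists>\<^sub>F i in sequentially. x \<in> bad i}"
proof (rule ccontr)
  define Lm where "Lm = {x \<in> S. \<exists>\<^sub>F i in sequentially. x \<in> bad i}"
  assume "\<not> negligible {x \<in> S. \<exists>\<^sub>F i in sequentially. x \<in> bad i}"
  then have nn: "\<not> negligible Lm" by (simp add: Lm_def)
  have bad_m: "bad i \<in> sets lebesgue" for i using open_bad by simp
  have Lm_eq: "Lm = S \<inter> (\<Inter>k. \<Union>i\<in>{k..}. bad i)"
    unfolding Lm_def by (auto simp: frequently_sequentially)
  have Lm: "Lm \<in> sets lebesgue"
    unfolding Lm_eq using S bad_m by (intro sets.Int sets.countable_INT' sets.countable_UN') auto
  have Lm_bad: "\<exists>i\<ge>k. x \<in> bad i" if "x \<in> Lm" for x k using that by (auto simp: Lm_eq)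
  define \<omega> where "\<omega> = unit_ball_vol (real DIM('a))"
  define c0 where "c0 = exit_const TYPE('a) M"
  \<comment> \<open>Chosen to make the quadratic barrier exactly 1/4 at the apex.\<close>
  define \<eta> where "\<eta> = 1 / (8 * real DIM('a \<times> real))"
  \<comment> \<open>The first entry makes the Poisson barrier at most 1/4 even after the loss of a
    factor 2 in passing to finitely many stages; the second forces \<open>E\<close> to meet the
    small ball below the apex, so that the apex lies in the sawtooth.\<close>
  define \<epsilon> where "\<epsilon> = min (c0 * \<eta> ^ DIM('a) / (8 * \<omega>)) ((min M 1 * \<eta>) ^ DIM('a) / 4)"
  have pos: "\<omega> > 0" "c0 > 0" using M by (auto simp: \<omega>_def c0_def exit_const_pos)
  have \<eta>: "0 < \<eta>" "\<eta> < 1" by (auto simp: \<eta>_def)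
  have \<epsilon>: "\<epsilon> > 0" using pos \<eta> M by (simp add: \<epsilon>_def)
  obtain x0 R where R: "R > 0" and dens: "measure lebesgue (ball x0 R - Lm) \<le> \<epsilon> * measure lebesgue (ball x0 R)"
    using near_density_ball[OF Lm nn \<epsilon>] by metis
  have mb: "measure lebesgue (ball x0 R) = \<omega> * R ^ DIM('a)" using R by (simp add: content_ball \<omega>_def)
  define z0 where "z0 = (x0, \<eta> * R)"
  \<comment> \<open>The ball is fixed before the first stage \<open>i0\<close>. Hence the height of
    the apex, and with it this constant, does not change when \<open>i0\<close> is pushed out to
    make the tail of the series small.\<close>
  define C where "C = exp (lam0 * (\<theta> * real (layer (\<eta> * R)) + 3))"
  have "summable (\<lambda>i. C * (1 / real i ^ 2))"
    using inverse_power_summable[of 2, where 'a=real] by (intro summable_mult) (simp add: inverse_eq_divide)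
  then obtain k1 where k1: "\<And>m n. m \<ge> k1 \<Longrightarrow> norm (\<Sum>i=m..<n. C * (1 / real i ^ 2)) < 1 / 2"
    unfolding summable_Cauchy by (metis half_gt_zero_iff zero_less_one)
  obtain k2 where k2: "\<And>i l. i \<ge> k2 \<Longrightarrow> l \<le> i div 2 \<Longrightarrow> lam i l \<le> lam0"
    using lam_eventually_small unfolding eventually_sequentially by auto
  define i0 where "i0 = max 3 (max k1 k2)"
  have i0: "i0 \<ge> 3" "i0 \<ge> k1" "i0 \<ge> k2" by (auto simp: i0_def)
  define Ek where "Ek k = Lm \<inter> (\<Union>i\<in>{i0..<k}. bad i)" for k
  have Ek: "Ek k \<in> sets lebesgue" for k unfolding Ek_def using Lm bad_m by auto
  have "(\<lambda>k. measure lebesgue (ball x0 R - Ek k)) \<longlonglongrightarrow> measure lebesgue (\<Inter>k. ball x0 R - Ek k)"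
  proof (rule Lim_measure_decseq)
    show "range (\<lambda>k. ball x0 R - Ek k) \<subseteq> sets lebesgue" using Ek by auto
    show "decseq (\<lambda>k. ball x0 R - Ek k)" unfolding decseq_def Ek_def by fastforce
    show "emeasure lebesgue (ball x0 R - Ek i) \<noteq> \<infinity>" for i
      unfolding infinity_ennreal_def using Ek by (intro fmeasurableD2 fmeasurable_Diff) auto
  qed
  moreover have "(\<Inter>k. ball x0 R - Ek k) = ball x0 R - Lm"
  proof -
    have "\<exists>k. x \<in> Ek k" if x: "x \<in> Lm" for x
    proof -
      obtain i where "i \<ge> i0" "x \<in> bad i" using Lm_bad[OF x] by blast
      then show ?thesis using x by (intro exI[of _ "Suc i"]) (auto simp: Ek_def)
    qed
    then show ?thesis by (auto simp: Ek_def)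
  qed
  ultimately have lim: "(\<lambda>k. measure lebesgue (ball x0 R - Ek k)) \<longlonglongrightarrow> measure lebesgue (ball x0 R - Lm)" by simp
  have "measure lebesgue (ball x0 R - Lm) < 2 * \<epsilon> * (\<omega> * R ^ DIM('a))"
  proof -
    have "0 < \<epsilon> * (\<omega> * R ^ DIM('a))" using \<epsilon> pos R by simp
    then show ?thesis using dens mb by simp
  qed
  from order_tendstoD(2)[OF lim this] obtain i1
    where i1: "measure lebesgue (ball x0 R - Ek i1) < 2 * \<epsilon> * (\<omega> * R ^ DIM('a))"
    unfolding eventually_sequentially by blast
  define E where "E = Ek i1"
  have E: "E \<in> sets lebesgue" "E \<subseteq> S" using Ek by (auto simp: E_def Ek_def Lm_def)
  define \<rho> where "\<rho> = min M 1 * \<eta> * R"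
  have \<rho>: "0 < \<rho>" using M \<eta> R by (simp add: \<rho>_def)
  have \<rho>R: "\<rho> \<le> R"
  proof -
    have "min M 1 * \<eta> \<le> 1 * 1" using \<eta> M by (intro mult_mono) auto
    then have "min M 1 * \<eta> * R \<le> 1 * R" using R by (intro mult_right_mono) auto
    then show ?thesis by (simp add: \<rho>_def)
  qed
  have \<rho>M: "\<rho> \<le> M * (\<eta> * R)"
  proof -
    have "min M 1 * (\<eta> * R) \<le> M * (\<eta> * R)" using \<eta> R by (intro mult_right_mono) auto
    then show ?thesis by (simp add: \<rho>_def mult.assoc)
  qed
  have "ball x0 \<rho> \<inter> E \<noteq> {}"
  proof
    assume "ball x0 \<rho> \<inter> E = {}"
    then have "ball x0 \<rho> \<subseteq> ball x0 R - E" using \<rho>R by auto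
    then have "measure lebesgue (ball x0 \<rho>) \<le> measure lebesgue (ball x0 R - E)"
      using E by (intro measure_mono_fmeasurable fmeasurable_Diff) auto
    moreover have "measure lebesgue (ball x0 \<rho>) = \<omega> * \<rho> ^ DIM('a)"
      using \<rho> by (simp add: content_ball \<omega>_def)
    ultimately have "\<omega> * \<rho> ^ DIM('a) < 2 * \<epsilon> * (\<omega> * R ^ DIM('a))"
      using i1 unfolding E_def by linarith
    also have "\<dots> \<le> 2 * ((min M 1 * \<eta>) ^ DIM('a) / 4) * (\<omega> * R ^ DIM('a))"
      using pos R by (intro mult_right_mono mult_left_mono) (auto simp: \<epsilon>_def)
    also have "\<dots> = \<omega> * \<rho> ^ DIM('a) / 2" by (simp add: \<rho>_def power_mult_distrib)
    finally show False using pos \<rho> by simp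
  qed
  then obtain e0 where e0: "e0 \<in> E" "dist x0 e0 < \<rho>" by auto
  then have E_ne: "E \<noteq> {}" by auto
  have apex: "infdist x0 E \<le> M * (\<eta> * R)" using infdist_le[OF e0(1), of x0] e0(2) \<rho>M by linarith
  have goodE: "good z" if "snd z > 0" "infdist (fst z) E \<le> M * snd z" for z
    using that infdist_mono[OF E(2) E_ne, of "fst z"] E E_ne by (auto simp: good_def)
  define W where "W z = (\<Sum>i=i0..<i1. total_gauge i z)" for z
  have ev: "\<forall>\<^sub>F s in at_right 0. \<forall>i\<in>{i0..<i1}. \<forall>l\<in>{..i div 2}. \<forall>c\<in>{..<16 ^ l}. \<forall>e\<in>{1..<16}.
      \<forall>x x'. dist x x0 \<le> R \<longrightarrow> dist x x' < (M + 1) * s \<longrightarrow>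
        \<bar>(\<Sum>j=lo i l c..<hi i l c e. f j (x, s)) - (\<Sum>j=lo i l c..<hi i l c e. f j (x', 0))\<bar> < 1"
    by (intro eventually_ball_finite finite_atLeastLessThan finite_atMost finite_lessThan ballI
        boundary_approximation[OF R continuous_interval_sum])
  moreover have "\<forall>\<^sub>F s in at_right 0. s \<in> {0<..<\<eta> * R}"
    using \<eta> R by (intro eventually_at_right_real) simp
  ultimately have "\<forall>\<^sub>F s in at_right 0. s \<in> {0<..<\<eta> * R} \<and>
      (\<forall>i\<in>{i0..<i1}. \<forall>l\<in>{..i div 2}. \<forall>c\<in>{..<16 ^ l}. \<forall>e\<in>{1..<16}.
      \<forall>x x'. dist x x0 \<le> R \<longrightarrow> dist x x' < (M + 1) * s \<longrightarrow>
        \<bar>(\<Sum>j=lo i l c..<hi i l c e. f j (x, s)) - (\<Sum>j=lo i l c..<hi i l c e. f j (x', 0))\<bar> < 1)"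
    by eventually_elim blast
  \<comment> \<open>One height serves all blocks at once, because only finitely many stages, levels
    and digits occur.\<close>
  then obtain s where s: "0 < s" "s < \<eta> * R" and close: "\<And>i l c e x x'. i \<in> {i0..<i1} \<Longrightarrow> l \<le> i div 2 \<Longrightarrow>
      c < 16 ^ l \<Longrightarrow> e \<in> {1..<16} \<Longrightarrow> dist x x0 \<le> R \<Longrightarrow> dist x x' < (M + 1) * s \<Longrightarrow>
      \<bar>(\<Sum>j=lo i l c..<hi i l c e. f j (x, s)) - (\<Sum>j=lo i l c..<hi i l c e. f j (x', 0))\<bar> < 1"
    using eventually_happens'[OF trivial_limit_at_right_real] by (smt (verit) atMost_iff greaterThanLessThan_iff lessThan_iff)
  have "1 \<le> W (x0, \<eta> * R) + 2 * real DIM('a \<times> real) * \<eta> +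
      measure lebesgue (ball x0 R - E) / (exit_const TYPE('a) M * (\<eta> * R) ^ DIM('a))"
  proof (rule sawtooth_comparison[OF M R \<eta> s(1) less_imp_le[OF s(2)] E(1) E_ne _ _ _ _ apex])
    show "continuous_on {z. snd z > 0} W"
      unfolding W_def by (intro continuous_on_sum continuous_total_gauge)
    show "\<exists>p L. has_lap W z p L \<and> L \<le> 0" if z: "snd z > 0" "infdist (fst z) E \<le> M * snd z" for z
    proof -
      have "\<forall>i. \<exists>p L. i \<in> {i0..<i1} \<longrightarrow> has_lap (total_gauge i) z p L \<and> L \<le> 0"
      proof
        fix i
        show "\<exists>p L. i \<in> {i0..<i1} \<longrightarrow> has_lap (total_gauge i) z p L \<and> L \<le> 0"
        proof (cases "i \<in> {i0..<i1}")
          case True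
          then have "i \<ge> 1" "i \<ge> k2" using i0 by auto
          then show ?thesis using total_gauge_superharmonic[OF goodE[OF z], of i] k2 by blast
        qed blast
      qed
      then obtain p L where pL: "\<And>i. i \<in> {i0..<i1} \<Longrightarrow> has_lap (total_gauge i) z (p i) (L i) \<and> L i \<le> 0"
        by metis
      have "has_lap W z (\<lambda>b. \<Sum>i=i0..<i1. p i b) (\<Sum>i=i0..<i1. L i)"
        unfolding W_def[abs_def] using pL by (intro has_lap_sum) auto
      moreover have "(\<Sum>i=i0..<i1. L i) \<le> 0" using pL by (intro sum_nonpos) auto
      ultimately show ?thesis by blast
    qed
    show "W z \<ge> 0" for z unfolding W_def total_gauge_def by (intro sum_nonneg gauge_nonneg)
    show "W (x, s) \<ge> 1" if x: "infdist x E \<le> M * s" "dist x x0 \<le> R" for x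
    proof -
      have "infdist x E < (M + 1) * s" using x(1) s by (simp add: distrib_right)
      then obtain x' where x': "x' \<in> E" "dist x x' < (M + 1) * s"
        using E_ne unfolding infdist_def by (auto simp: cINF_less_iff)
      then obtain i l c e where i: "i \<in> {i0..<i1}" "l \<le> i div 2" "c < 16 ^ l" "e \<in> {1..<16}"
        "thr i l < (\<Sum>j=lo i l c..<hi i l c e. f j (x', 0))"
        unfolding E_def Ek_def bad_def by blast
      have "1 \<le> gauge i l c e (x, s)"
      proof (rule gauge_ge_one)
        show "good (x, s)" using goodE[of "(x, s)"] x s by simp
        show "thr i l - 1 \<le> (\<Sum>j=lo i l c..<hi i l c e. f j (x, s))"
          using close[OF i(1-4) x(2) x'(2)] i(5) by linarith
      qed (use i i0 in auto)
      also have "\<dots> \<le> (\<Sum>e\<in>{1..<16}. gauge i l c e (x, s))"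
        using i(4) by (intro member_le_sum) (auto simp: gauge_nonneg)
      also have "\<dots> \<le> (\<Sum>c<16 ^ l. \<Sum>e\<in>{1..<16}. gauge i l c e (x, s))"
        using i(3) by (intro member_le_sum[of c]) (auto intro!: sum_nonneg gauge_nonneg)
      also have "\<dots> \<le> total_gauge i (x, s)" unfolding total_gauge_def
        using i(2) by (intro member_le_sum[of l]) (auto intro!: sum_nonneg gauge_nonneg)
      also have "\<dots> \<le> W (x, s)" unfolding W_def total_gauge_def
        using i(1) by (intro member_le_sum[of i]) (auto intro!: sum_nonneg gauge_nonneg)
      finally show ?thesis .
    qed
  qed
  moreover have "W (x0, \<eta> * R) < 1 / 2"
  proof -
    have g: "good (x0, \<eta> * R)" using goodE[of "(x0, \<eta> * R)"] apex \<eta> R by simp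
    have "W (x0, \<eta> * R) \<le> (\<Sum>i=i0..<i1. C * (1 / real i ^ 2))"
      unfolding W_def
    proof (rule sum_mono)
      fix i assume "i \<in> {i0..<i1}"
      then have "i \<ge> 3" "i \<ge> k2" using i0 by auto
      then show "total_gauge i (x0, \<eta> * R) \<le> C * (1 / real i ^ 2)"
        using total_gauge_le[OF g, of i] k2 by (simp add: C_def)
    qed
    also have "\<dots> < 1 / 2" using k1[OF i0(2), of i1] by simp
    finally show ?thesis .
  qed
  moreover have "2 * real DIM('a \<times> real) * \<eta> = 1 / 4" by (simp add: \<eta>_def)
  moreover have "measure lebesgue (ball x0 R - E) / (exit_const TYPE('a) M * (\<eta> * R) ^ DIM('a)) \<le> 1 / 4"
  proof -
    have "measure lebesgue (ball x0 R - E) \<le> 2 * \<epsilon> * (\<omega> * R ^ DIM('a))" using i1 by (simp add: E_def)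
    also have "\<dots> \<le> 2 * (c0 * \<eta> ^ DIM('a) / (8 * \<omega>)) * (\<omega> * R ^ DIM('a))"
      using pos R by (intro mult_right_mono mult_left_mono) (auto simp: \<epsilon>_def)
    also have "\<dots> = 1 / 4 * (c0 * (\<eta> * R) ^ DIM('a))" using pos by (simp add: power_mult_distrib)
    finally show ?thesis using pos \<eta> R by (simp add: c0_def[symmetric] pos_divide_le_eq)
  qed
  ultimately show False by linarith
qed

lemma iterated_logarithm:
  "AE x in lebesgue. x \<in> S \<longrightarrow> (\<forall>\<^sub>F i in sequentially. \<forall>N\<in>{16 ^ i..<16 ^ Suc i}.
     (\<Sum>j<N. f j (x, 0)) \<le> C2 * (4 ^ i * sqrt (ln (real i))))"
proof -
  have "{x \<in> S. \<exists>\<^sub>F i in sequentially. x \<in> bad i} \<in> null_sets lebesgue"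
    using negligible_infinitely_often_bad by (simp add: negligible_iff_null_sets)
  then show ?thesis
  proof (rule AE_I', safe)
    fix x assume x: "x \<in> S"
      and not: "\<not> (\<forall>\<^sub>F i in sequentially. \<forall>N\<in>{16 ^ i..<16 ^ Suc i}.
        (\<Sum>j<N. f j (x, 0)) \<le> C2 * (4 ^ i * sqrt (ln (real i))))"
    show "\<exists>\<^sub>F i in sequentially. x \<in> bad i"
    proof (rule ccontr)
      assume "\<not> (\<exists>\<^sub>F i in sequentially. x \<in> bad i)"
      then have "\<forall>\<^sub>F i in sequentially. x \<notin> bad i" by (simp add: not_frequently)
      moreover have "\<forall>\<^sub>F i in sequentially. i \<ge> (3::nat)" by (rule eventually_ge_at_top)
      ultimately have "\<forall>\<^sub>F i in sequentially. \<forall>N\<in>{16 ^ i..<16 ^ Suc i}.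
        (\<Sum>j<N. f j (x, 0)) \<le> C2 * (4 ^ i * sqrt (ln (real i)))"
        by eventually_elim (use chaining[OF x] in auto)
      then show False using not by simp
    qed
  qed
qed

end

section \<open>Doubling weights\<close>

lemma differentiable_DERIV_partial:
  fixes v :: "'a::euclidean_space \<Rightarrow> real"
  assumes "v differentiable (at y)"
  shows "((\<lambda>t. v (y + t *\<^sub>R b)) has_real_derivative partial_deriv b v y) (at 0)"
proof -
  have "(\<lambda>t. y + t *\<^sub>R b) differentiable (at 0)" by (intro derivative_intros)
  then have "(v \<circ> (\<lambda>t. y + t *\<^sub>R b)) differentiable (at 0)"
    by (rule differentiable_chain_at) (use assms in simp)
  then have "(\<lambda>t. v (y + t *\<^sub>R b)) differentiable (at 0)" by (simp add: o_def)
  then show ?thesis unfolding partial_deriv_def by (simp add: DERIV_deriv_iff_real_differentiable)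
qed

lemma harmonic_on_has_lap:
  assumes u: "harmonic_on T u" and z: "z \<in> T"
  shows "has_lap u z (\<lambda>b. partial_deriv b u z) 0"
proof -
  have T: "open T" and d1: "u differentiable_on T"
    and d2: "\<And>b. b \<in> Basis \<Longrightarrow> partial_deriv b u differentiable_on T"
    and L: "(\<Sum>b\<in>Basis. partial_deriv b (partial_deriv b u) z) = 0"
    using u z by (auto simp: harmonic_on_def)
  have "jet (\<lambda>s. u (z + s *\<^sub>R b)) (partial_deriv b u z) (partial_deriv b (partial_deriv b u) z)"
    if b: "b \<in> Basis" for b
  proof (rule jetI)
    have "((\<lambda>s. z + s *\<^sub>R b) \<longlongrightarrow> z + 0 *\<^sub>R b) (nhds 0)" by (intro tendsto_intros filterlim_ident)
    then have "filterlim (\<lambda>s. z + s *\<^sub>R b) (nhds z) (nhds 0)" by simp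
    from eventually_compose_filterlim[OF eventually_nhds_in_open[OF T z] this]
    show "\<forall>\<^sub>F s in nhds 0. ((\<lambda>s. u (z + s *\<^sub>R b)) has_real_derivative partial_deriv b u (z + s *\<^sub>R b)) (at s)"
    proof eventually_elim
      case (elim s)
      then have "u differentiable (at (z + s *\<^sub>R b))" using d1 T differentiable_on_eq_differentiable_at by blast
      from differentiable_DERIV_partial[OF this, of b]
      have "((\<lambda>t. u (z + (s + t) *\<^sub>R b)) has_real_derivative partial_deriv b u (z + s *\<^sub>R b)) (at 0)"
        by (simp add: scaleR_add_left add.assoc)
      then show ?case using DERIV_at_within_shift[of "\<lambda>s. u (z + s *\<^sub>R b)" _ s 0 UNIV] by simp
    qed
    have "partial_deriv b u differentiable (at z)" using d2[OF b] T z differentiable_on_eq_differentiable_at by blast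
    then show "((\<lambda>s. partial_deriv b u (z + s *\<^sub>R b)) has_real_derivative partial_deriv b (partial_deriv b u) z) (at 0)"
      by (rule differentiable_DERIV_partial)
  qed simp
  from has_lapI[of u, OF this] show ?thesis by (simp add: L)
qed

text \<open>Intermediate values give \<open>w (d j) = \<theta> ^ j\<close>. Taking \<theta> strictly
  above the doubling constant forces the scales to halve: otherwise one doubling step would give
  \<open>w (d (Suc j)) < \<theta> ^ Suc j\<close>.\<close>

lemma doubling_scales:
  assumes w: "doubling_weight w"
  obtains \<theta> :: real and d :: "nat \<Rightarrow> real" where "\<theta> \<ge> 3" "\<And>y. y > 0 \<Longrightarrow> w y \<le> \<theta> * w (2 * y)"
    "d 0 = 1" "\<And>j. d j > 0" "\<And>j. w (d j) = \<theta> ^ j" "\<And>j. d (Suc j) \<le> d j / 2"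
proof -
  have pos: "\<And>y. y > 0 \<Longrightarrow> w y > 0" and cont: "continuous_on {0<..} w"
    and mono: "\<And>x y. 0 < x \<Longrightarrow> x \<le> y \<Longrightarrow> w y \<le> w x"
    and top: "filterlim w at_top (at_right 0)" and one: "\<And>y. y > 1 \<Longrightarrow> w y = 1"
    using w by (auto simp: doubling_weight_def monotone_on_def)
  obtain D where D: "D > 0" "\<And>y. y > 0 \<Longrightarrow> w y \<le> D * w (2 * y)"
    using w by (auto simp: doubling_weight_def)
  define \<theta> where "\<theta> = max 3 (D + 1)"
  have \<theta>: "\<theta> \<ge> 3" "\<theta> > D" by (auto simp: \<theta>_def)
  \<comment> \<open>The normalisation is imposed only for arguments above 1; continuity from the
    right carries it to 1, so that \<open>d 0\<close> can be 1.\<close>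
  have w1: "w 1 = 1"
  proof -
    have "isCont w 1" using cont by (simp add: continuous_on_eq_continuous_at)
    then have "(w \<longlongrightarrow> w 1) (at_right 1)" by (simp add: isCont_def filterlim_at_split)
    moreover have "\<forall>\<^sub>F y in at_right 1. 1 = w y" using one by (auto simp: eventually_at_filter)
    then have "(w \<longlongrightarrow> 1) (at_right 1)" using Lim_transform_eventually tendsto_const by blast
    ultimately show ?thesis using tendsto_unique[OF trivial_limit_at_right_real] by blast
  qed
  have "\<exists>y. 0 < y \<and> y \<le> 1 \<and> w y = \<theta> ^ j \<and> (j = 0 \<longrightarrow> y = 1)" for j
  proof (cases "j = 0")
    case False
    have "\<forall>\<^sub>F y in at_right 0. \<theta> ^ j \<le> w y" using top by (simp add: filterlim_at_top)
    moreover have "\<forall>\<^sub>F y in at_right 0. y \<in> {0<..<(1::real)}" by (rule eventually_at_right_real) simp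
    ultimately have "\<forall>\<^sub>F y in at_right 0. \<theta> ^ j \<le> w y \<and> y \<in> {0<..<(1::real)}" by (rule eventually_conj)
    then obtain a where a: "\<theta> ^ j \<le> w a" "0 < a" "a < 1"
      using eventually_happens'[OF trivial_limit_at_right_real] by fastforce
    have "continuous_on {a..1} w" using cont by (rule continuous_on_subset) (use a in auto)
    moreover have "w 1 \<le> \<theta> ^ j" using w1 \<theta> by (simp add: one_le_power)
    ultimately obtain y where "a \<le> y" "y \<le> 1" "w y = \<theta> ^ j"
      using IVT2'[of w 1 "\<theta> ^ j" a] a by auto
    then show ?thesis using a False by (intro exI[of _ y]) auto
  qed (use w1 in auto)
  then obtain d where d: "\<And>j. 0 < d j \<and> d j \<le> 1 \<and> w (d j) = \<theta> ^ j \<and> (j = 0 \<longrightarrow> d j = 1)" by metis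
  have half: "d (Suc j) \<le> d j / 2" for j
  proof (rule ccontr)
    assume "\<not> d (Suc j) \<le> d j / 2"
    then have "w (d (Suc j)) \<le> w (d j / 2)" using d[of j] by (intro mono) auto
    also have "\<dots> \<le> D * w (d j)" using D(2)[of "d j / 2"] d[of j] by simp
    also have "\<dots> < \<theta> * \<theta> ^ j" using d[of j] \<theta> by (simp add: mult_strict_right_mono)
    finally show False using d[of "Suc j"] by simp
  qed
  have "w y \<le> \<theta> * w (2 * y)" if "y > 0" for y
  proof -
    have "D * w (2 * y) \<le> \<theta> * w (2 * y)" using \<theta> pos[of "2 * y"] that by (intro mult_right_mono) auto
    then show ?thesis using D(2)[OF that] by simp
  qed
  then show thesis using that[of \<theta> d] \<theta> d half by auto
qed

section \<open>Stieltjes integrals over the layers of a weight\<close>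

context
  fixes w :: "real \<Rightarrow> real" and u :: "'a::euclidean_space \<times> real \<Rightarrow> real"
  assumes w: "doubling_weight w" and ucont: "continuous_on (UNIV \<times> {0<..}) u"
begin

private abbreviation "\<mu> \<equiv> interval_measure (recip_weight w)"

lemma recip_weight_mono: "x \<le> y \<Longrightarrow> recip_weight w x \<le> recip_weight w y"
  using mono_recip_weight[OF w] by (rule monoD)

lemma emeasure_weight_Ioc: "p \<le> q \<Longrightarrow> emeasure \<mu> {p<..q} = ennreal (recip_weight w q - recip_weight w p)"
  by (rule emeasure_interval_measure_Ioc)
     (auto intro: recip_weight_mono continuous_at_imp_continuous_at_within isCont_recip_weight[OF w])

lemma emeasure_weight_Icc: "p \<le> q \<Longrightarrow> emeasure \<mu> {p..q} = ennreal (recip_weight w q - recip_weight w p)"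
  by (rule emeasure_interval_measure_Icc)
     (auto intro: recip_weight_mono continuous_at_imp_continuous_on isCont_recip_weight[OF w])

lemma measure_weight_le:
  assumes "0 < p" "p \<le> q"
  shows "measure \<mu> {p<..q} \<le> 1 / w q" "measure \<mu> {p..q} \<le> 1 / w q"
proof -
  have "w p > 0" using w assms by (auto simp: doubling_weight_def)
  then have "recip_weight w q - recip_weight w p \<le> 1 / w q" using assms by (simp add: recip_weight_def)
  then show "measure \<mu> {p<..q} \<le> 1 / w q" "measure \<mu> {p..q} \<le> 1 / w q"
    using emeasure_weight_Ioc[OF assms(2)] emeasure_weight_Icc[OF assms(2)] recip_weight_mono[OF assms(2)]
    by (auto simp: measure_def)
qed

lemma set_integrable_slice:
  assumes "0 < p" "A \<subseteq> {p..q}" "A \<in> sets borel"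
  shows "set_integrable \<mu> A (\<lambda>y. u (x, y))"
proof (cases "p \<le> q")
  case True
  have c: "continuous_on {p..q} (\<lambda>y. u (x, y))"
    by (rule continuous_on_compose2[OF ucont]) (use assms in \<open>auto intro!: continuous_intros\<close>)
  then have "compact ((\<lambda>y. u (x, y)) ` {p..q})" by (rule compact_continuous_image) simp
  then obtain b where b: "\<And>y. y \<in> {p..q} \<Longrightarrow> norm (u (x, y)) \<le> b"
    using compact_imp_bounded bounded_iff by (metis imageI)
  have "set_integrable \<mu> {p..q} (\<lambda>y. u (x, y))"
    unfolding set_integrable_def
  proof (rule integrableI_bounded_set[where A="{p..q}" and B=b])
    show "(\<lambda>y. indicat_real {p..q} y *\<^sub>R u (x, y)) \<in> borel_measurable \<mu>"
      using borel_measurable_continuous_on_indicator[OF _ c] by simp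
    show "emeasure \<mu> {p..q} < \<infinity>" using emeasure_weight_Icc[OF True] by simp
  qed (use b in auto)
  then show ?thesis by (rule set_integrable_subset) (use assms in auto)
qed (use assms in \<open>auto simp: set_integrable_def\<close>)

lemma set_integral_slice_le:
  assumes "0 < p" "p \<le> q" "\<And>y. y \<in> {p..q} \<Longrightarrow> \<bar>u (x, y)\<bar> \<le> b"
  shows "\<bar>LINT y:{p..q}|\<mu>. u (x, y)\<bar> \<le> b * measure \<mu> {p..q}"
proof -
  have fin: "emeasure \<mu> {p..q} < \<infinity>" using emeasure_weight_Icc[OF assms(2)] by simp
  have "\<bar>LINT y:{p..q}|\<mu>. u (x, y)\<bar> \<le> (LINT y|\<mu>. b * indicator {p..q} y)"
    unfolding set_lebesgue_integral_def real_norm_def[symmetric]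
  proof (rule Bochner_Integration.integral_norm_bound_integral)
    show "integrable \<mu> (\<lambda>y. indicat_real {p..q} y *\<^sub>R u (x, y))"
      using set_integrable_slice[OF assms(1), of "{p..q}" q x] by (simp add: set_integrable_def)
    show "integrable \<mu> (\<lambda>y. b * indicator {p..q} y)" using fin by (intro integrable_mult_right integrable_real_indicator) auto
    show "norm (indicat_real {p..q} y *\<^sub>R u (x, y)) \<le> b * indicator {p..q} y" for y
      using assms(3)[of y] by (auto simp: indicator_def)
  qed
  also have "\<dots> = b * measure \<mu> {p..q}" by simp
  finally show ?thesis .
qed

text \<open>
  With a finite sum in place of the Stieltjes integral over a layer, the harmonicity of the
  layer functions needs no differentiation under the integral.
\<close>

lemma layer_discretization:
  assumes p: "0 < p" "p \<le> q" and "\<epsilon> > 0"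
  shows "\<exists>(k::nat) y c. (\<forall>i<k. p \<le> y i \<and> 0 \<le> c i) \<and> (\<Sum>i<k. c i) \<le> 1 / w q \<and>
    (\<forall>x. norm x \<le> r \<longrightarrow> \<bar>(\<Sum>i<k. c i * u (x, y i)) - (LINT y:{p<..q}|\<mu>. u (x, y))\<bar> \<le> \<epsilon>)"
proof -
  have "w q > 0" using w p by (auto simp: doubling_weight_def)
  \<comment> \<open>The mass of the layer is at most \<open>1 / w q\<close>, so an oscillation of
    \<open>\<epsilon> * w q\<close> gives total error \<epsilon>.\<close>
  define e where "e = \<epsilon> * w q"
  have e: "e > 0" using \<open>w q > 0\<close> \<open>\<epsilon> > 0\<close> by (simp add: e_def)
  define Kc where "Kc = cball (0::'a) r \<times> {p..q}"
  have "continuous_on Kc u" by (rule continuous_on_subset[OF ucont]) (use p in \<open>auto simp: Kc_def\<close>)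
  then have "uniformly_continuous_on Kc u"
    by (rule compact_uniformly_continuous) (unfold Kc_def, intro compact_Times compact_cball compact_Icc)
  then obtain \<delta> where \<delta>: "\<delta> > 0" "\<And>z z'. z \<in> Kc \<Longrightarrow> z' \<in> Kc \<Longrightarrow> dist z' z < \<delta> \<Longrightarrow> dist (u z') (u z) < e"
    unfolding uniformly_continuous_on_def using e by metis
  obtain k :: nat and y and A where y: "\<And>i. i < k \<Longrightarrow> y i \<in> {p..q}" and Ab: "\<And>i. i < k \<Longrightarrow> A i \<in> sets borel"
    and Ay: "\<And>i. i < k \<Longrightarrow> A i \<subseteq> ball (y i) \<delta>" and dis: "disjoint_family_on A {..<k}"
    and un: "(\<Union>i<k. A i) = {p..q}"
    using compact_small_partition[OF compact_Icc \<delta>(1), of p q] by metis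
  define I where "I = {p<..q}"
  define c where "c i = measure \<mu> (A i \<inter> I)" for i
  have Ioc: "emeasure \<mu> I < \<infinity>" using emeasure_weight_Ioc[OF p(2)] by (simp add: I_def)
  have m: "A i \<inter> I \<in> sets \<mu>" if "i < k" for i using Ab[OF that] by (simp add: I_def)
  have fin: "emeasure \<mu> (A i \<inter> I) < \<infinity>" if "i < k" for i
    using emeasure_mono[of "A i \<inter> I" I \<mu>] Ioc by (simp add: I_def le_less_trans)
  have sumc: "(\<Sum>i<k. c i) = measure \<mu> I"
  proof -
    have "(\<Sum>i<k. c i) = measure \<mu> (\<Union>i\<in>{..<k}. A i \<inter> I)"
      unfolding c_def
    proof (rule measure_finite_Union[symmetric])
      show "disjoint_family_on (\<lambda>i. A i \<inter> I) {..<k}" using dis unfolding disjoint_family_on_def by blast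
    qed (use m fin in \<open>auto simp: less_top\<close>)
    also have "(\<Union>i\<in>{..<k}. A i \<inter> I) = I" using un by (auto simp: I_def)
    finally show ?thesis .
  qed
  have mI: "measure \<mu> I \<le> 1 / w q" using measure_weight_le[OF p] by (simp add: I_def)
  have "\<bar>(\<Sum>i<k. c i * u (x, y i)) - (LINT y:I|\<mu>. u (x, y))\<bar> \<le> \<epsilon>" if x: "norm x \<le> r" for x
  proof -
    define s where "s t = (\<Sum>i<k. indicat_real (A i \<inter> I) t * u (x, y i))" for t
    have s_int: "integrable \<mu> s" unfolding s_def[abs_def]
      using m fin by (intro Bochner_Integration.integrable_sum integrable_mult_left integrable_real_indicator) auto
    have s_eq: "(LINT t|\<mu>. s t) = (\<Sum>i<k. c i * u (x, y i))"
      unfolding s_def using m fin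
      by (subst Bochner_Integration.integral_sum) (auto intro!: integrable_mult_left integrable_real_indicator simp: c_def)
    have u_int: "integrable \<mu> (\<lambda>t. indicat_real I t *\<^sub>R u (x, t))"
    proof -
      have "I \<subseteq> {p..q}" "I \<in> sets borel" by (auto simp: I_def)
      from set_integrable_slice[OF p(1) this] show ?thesis unfolding set_integrable_def .
    qed
    have "\<bar>(LINT t|\<mu>. s t) - (LINT t|\<mu>. indicat_real I t *\<^sub>R u (x, t))\<bar>
        = \<bar>LINT t|\<mu>. s t - indicat_real I t *\<^sub>R u (x, t)\<bar>"
      using s_int u_int by simp
    also have "\<dots> \<le> (LINT t|\<mu>. e * indicator I t)"
      unfolding real_norm_def[symmetric]
    proof (rule Bochner_Integration.integral_norm_bound_integral)
      show "integrable \<mu> (\<lambda>t. s t - indicat_real I t *\<^sub>R u (x, t))" using s_int u_int by simp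
      show "integrable \<mu> (\<lambda>t. e * indicator I t)"
        using Ioc by (intro integrable_mult_right integrable_real_indicator) (auto simp: I_def)
      fix t
      show "norm (s t - indicat_real I t *\<^sub>R u (x, t)) \<le> e * indicator I t"
      proof (cases "t \<in> I")
        case False
        then show ?thesis by (simp add: s_def)
      next
        case True
        then have "t \<in> (\<Union>i<k. A i)" using un by (auto simp: I_def)
        then obtain i where i: "i < k" "t \<in> A i" by auto
        have "indicat_real (A j \<inter> I) t = (if j = i then 1 else 0)" if "j < k" for j
          using dis i that True unfolding disjoint_family_on_def by (auto simp: indicator_def)
        then have "s t = (\<Sum>j<k. if j = i then u (x, y i) else 0)"
          unfolding s_def by (intro sum.cong) auto
        then have "s t = u (x, y i)" using i(1) by simp
        moreover have "dist (u (x, y i)) (u (x, t)) < e"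
        proof (rule \<delta>(2))
          show "(x, t) \<in> Kc" "(x, y i) \<in> Kc" using x True y[OF i(1)] by (auto simp: Kc_def I_def)
          show "dist (x, y i) (x, t) < \<delta>" using Ay[OF i(1)] i(2) by (auto simp: dist_Pair_Pair)
        qed
        ultimately show ?thesis using True by (simp add: dist_real_def)
      qed
    qed
    also have "\<dots> = e * measure \<mu> I" by simp
    also have "\<dots> \<le> e * (1 / w q)" using mI e by (intro mult_left_mono) auto
    also have "\<dots> = \<epsilon>" using \<open>w q > 0\<close> by (simp add: e_def)
    finally show ?thesis unfolding s_eq set_lebesgue_integral_def .
  qed
  then show ?thesis
    using y sumc mI unfolding I_def
    by (intro exI[of _ k] exI[of _ y] exI[of _ c]) (auto simp: c_def)
qed

text \<open>Half-open layers tile the range without overlap; the closed interval at the bottom is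
  the incomplete layer that contains \<delta>.\<close>

lemma I0_split:
  fixes d :: "nat \<Rightarrow> real"
  assumes d: "d 0 = 1" "\<And>j. d j > 0" "\<And>j. d (Suc j) \<le> d j" and \<delta>: "0 < \<delta>" "\<delta> \<le> d N"
  shows "I0 w u x \<delta> = (\<Sum>j<N. LINT y:{d (Suc j)<..d j}|\<mu>. u (x, y)) + (LINT y:{\<delta>..d N}|\<mu>. u (x, y))"
  using \<delta>(2)
proof (induction N)
  case 0
  then show ?case by (simp add: I0_def d(1))
next
  case (Suc N)
  have le: "\<delta> \<le> d N" using Suc.prems d(3)[of N] by simp
  have "{\<delta>..d N} = {\<delta>..d (Suc N)} \<union> {d (Suc N)<..d N}" using Suc.prems d(3)[of N] by auto
  then have "(LINT y:{\<delta>..d N}|\<mu>. u (x, y)) = (LINT y:{\<delta>..d (Suc N)}|\<mu>. u (x, y))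
      + (LINT y:{d (Suc N)<..d N}|\<mu>. u (x, y))"
    using set_integral_Un[of "{\<delta>..d (Suc N)}" "{d (Suc N)<..d N}" \<mu> "\<lambda>y. u (x, y)"]
      set_integrable_slice[OF \<delta>(1), of "{\<delta>..d (Suc N)}" "d N" x] set_integrable_slice[OF d(2)[of "Suc N"], of "{d (Suc N)<..d N}" "d N" x]
      d(3)[of N] by fastforce
  then show ?case using Suc.IH[OF le] by simp
qed

end

section \<open>From the layers to the Stieltjes integral\<close>

theorem theorem2:
  fixes w :: "real \<Rightarrow> real" and M :: real
  assumes "doubling_weight w" and "M > 0"
  shows "\<exists>C>0. \<forall>(u :: (real ^ 'n) \<times> real \<Rightarrow> real) (K :: real) (S :: (real ^ 'n) set).
      harmonic_on (UNIV \<times> {0<..}) u \<longrightarrow>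
      K > 0 \<longrightarrow>
      S \<in> sets lebesgue \<longrightarrow>
      emeasure lebesgue S > 0 \<longrightarrow>
      (\<forall>x0\<in>S. \<forall>x. \<forall>y>0. norm (x - x0) \<le> M * y \<longrightarrow> \<bar>u (x, y)\<bar> \<le> K * w y) \<longrightarrow>
      (AE x in lebesgue. x \<in> S \<longrightarrow>
         Limsup (at_right 0)
           (\<lambda>\<delta>. ereal (I0 w u x \<delta> / sqrt (ln (w \<delta>) * ln (ln (ln (w \<delta>))))))
         \<le> ereal (C * K))"
proof -
  let ?\<mu> = "interval_measure (recip_weight w)"
  have wpos: "\<And>y. y > 0 \<Longrightarrow> w y > 0" and wmono: "\<And>x y. 0 < x \<Longrightarrow> x \<le> y \<Longrightarrow> w y \<le> w x"
    using assms(1) by (auto simp: doubling_weight_def monotone_on_def)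
  obtain \<theta> and d :: "nat \<Rightarrow> real" where \<theta>: "\<theta> \<ge> 3" and dbl: "\<And>y. y > 0 \<Longrightarrow> w y \<le> \<theta> * w (2 * y)"
    and d0: "d 0 = 1" and dpos: "\<And>j. d j > 0" and wd: "\<And>j. w (d j) = \<theta> ^ j"
    and dhalf: "\<And>j. d (Suc j) \<le> d j / 2"
    using doubling_scales[OF assms(1)] by metis
  have dSuc: "d (Suc j) \<le> d j" for j using dhalf[of j] dpos[of j] by linarith
  \<comment> \<open>This is \<open>gradient_bound\<close> for a layer function bounded by
    \<open>\<theta>\<^sup>2\<close> on a ball of radius
    \<open>M * d (Suc j) / (2 * (1 + M))\<close>.\<close>
  define A1 where "A1 = (real DIM((real ^ 'n) \<times> real) + 1) * \<theta>\<^sup>2 * (2 * (1 + M) / M)"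
  define \<gamma> where "\<gamma> = 4 * real DIM((real ^ 'n) \<times> real) * A1\<^sup>2"
  have A1: "A1 \<ge> 0" unfolding A1_def using assms(2) by (intro mult_nonneg_nonneg) auto
  \<comment> \<open>The maximum secures positivity; the extra 1 absorbs the error terms that stay
    bounded as \<delta> tends to 0.\<close>
  define C where "C = max 0 (layers.C2 \<theta> \<gamma>) + 1"
  show ?thesis
  proof (rule exI[of _ C], intro conjI allI impI)
    show "C > 0" by (simp add: C_def)
    fix u :: "(real ^ 'n) \<times> real \<Rightarrow> real" and K :: real and S :: "(real ^ 'n) set"
    assume harm: "harmonic_on (UNIV \<times> {0<..}) u" and K: "K > 0" and S: "S \<in> sets lebesgue"
      and Spos: "emeasure lebesgue S > 0"
      and growth: "\<forall>x0\<in>S. \<forall>x. \<forall>y>0. norm (x - x0) \<le> M * y \<longrightarrow> \<bar>u (x, y)\<bar> \<le> K * w y"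
    have ne: "S \<noteq> {}" using Spos by auto
    have ucont: "continuous_on (UNIV \<times> {0<..}) u"
      using harm by (auto simp: harmonic_on_def intro: differentiable_imp_continuous_on)
    \<comment> \<open>Errors \<open>K * (1 / 2) ^ j\<close> sum to at most \<open>2 * K\<close>.
      They are guaranteed only for \<open>norm x \<le> j\<close>, but for fixed \<open>x\<close>
      this excludes finitely many layers.\<close>
    define discr where "discr j k y c \<longleftrightarrow> (\<forall>i<k. d (Suc j) \<le> y i \<and> 0 \<le> c i) \<and> (\<Sum>i<k. c i) \<le> 1 / w (d j) \<and>
        (\<forall>x. norm x \<le> real j \<longrightarrow>
          \<bar>(\<Sum>i<k. c i * u (x, y i)) - (LINT y:{d (Suc j)<..d j}|?\<mu>. u (x, y))\<bar> \<le> K * (1 / 2) ^ j)"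
      for j and k :: nat and y c :: "nat \<Rightarrow> real"
    have "\<exists>k y c. discr j k y c" for j
      unfolding discr_def by (rule layer_discretization[OF assms(1) ucont dpos dSuc]) (use K in simp)
    then obtain k :: "nat \<Rightarrow> nat" and y c :: "nat \<Rightarrow> nat \<Rightarrow> real" where kyc: "\<And>j. discr j (k j) (y j) (c j)"
      by metis
    have yc: "d (Suc j) \<le> y j i \<and> 0 \<le> c j i" if "i < k j" for j i
      using kyc[of j] that unfolding discr_def by blast
    have csum: "(\<Sum>i<k j. c j i) \<le> 1 / w (d j)" for j
      using kyc[of j] unfolding discr_def by blast
    have approx: "\<bar>(\<Sum>i<k j. c j i * u (x, y j i)) - (LINT y:{d (Suc j)<..d j}|?\<mu>. u (x, y))\<bar> \<le> K * (1 / 2) ^ j"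
      if "norm x \<le> real j" for j x
      using kyc[of j] that unfolding discr_def by blast
    \<comment> \<open>Every node is at least \<open>d (Suc j)\<close> high, so the shifted sum is
      harmonic down to height \<open>- d (Suc j)\<close>. This overshoot makes the gradient bounds
      uniform up to the boundary.\<close>
    define f where "f j z = (\<Sum>i<k j. (c j i / K) * u (z + (0, y j i)))" for j z
    have ypos: "y j i > 0" if "i < k j" for j i using yc[OF that] dpos[of "Suc j"] by linarith
    \<comment> \<open>The strict inequality produces an actual apex in \<open>S\<close>, although
      the infimum need not be attained; the positive shift by a node supplies the
      strictness.\<close>
    have u_le: "\<bar>u (x, t)\<bar> \<le> K * w t" if t: "t > 0" "infdist x S < M * t" for x t
    proof -
      obtain x0 where "x0 \<in> S" "dist x x0 < M * t"
        using t(2) ne unfolding infdist_def by (auto simp: cINF_less_iff)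
      then show ?thesis using growth t(1) by (simp add: dist_norm)
    qed
    have f_le: "\<bar>f j z\<bar> \<le> b / \<theta> ^ j"
      if b: "\<And>i. i < k j \<Longrightarrow> \<bar>u (z + (0, y j i))\<bar> \<le> K * b" "0 \<le> b" for j z b
    proof -
      have "\<bar>f j z\<bar> \<le> (\<Sum>i<k j. \<bar>(c j i / K) * u (z + (0, y j i))\<bar>)" unfolding f_def by (rule sum_abs)
      also have "\<dots> \<le> (\<Sum>i<k j. c j i * b)"
      proof (rule sum_mono)
        fix i assume "i \<in> {..<k j}"
        then have i: "i < k j" by simp
        have "\<bar>(c j i / K) * u (z + (0, y j i))\<bar> = (c j i / K) * \<bar>u (z + (0, y j i))\<bar>"
          using yc[OF i] K by (simp add: abs_mult)
        also have "\<dots> \<le> (c j i / K) * (K * b)" using b(1)[OF i] yc[OF i] K by (intro mult_left_mono) auto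
        finally show "\<bar>(c j i / K) * u (z + (0, y j i))\<bar> \<le> c j i * b" using K by simp
      qed
      also have "\<dots> \<le> (1 / w (d j)) * b"
        unfolding sum_distrib_right[symmetric] using csum b(2) by (intro mult_right_mono)
      finally show ?thesis by (simp add: wd)
    qed
    have f_lap: "\<exists>p. has_lap (f j) z p 0" if z: "snd z > - d (Suc j)" for j z
    proof -
      have "has_lap (f j) z (\<lambda>b. \<Sum>i<k j. (c j i / K) * partial_deriv b u (z + (0, y j i))) (\<Sum>i<k j. (c j i / K) * 0)"
        unfolding f_def[abs_def]
      proof (intro has_lap_sum has_lap_cmult has_lap_shift harmonic_on_has_lap[OF harm])
        fix i assume "i \<in> {..<k j}"
        then have "snd z + y j i > 0" using yc[of i j] z by auto
        then show "z + (0, y j i) \<in> UNIV \<times> {0<..}" by (cases z) auto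
      qed
      then show ?thesis by auto
    qed
    have f_cont: "continuous_on {z. snd z > - d (Suc j)} (f j)" for j
      unfolding f_def[abs_def]
    proof (intro continuous_on_sum continuous_on_mult continuous_on_const)
      fix i assume "i \<in> {..<k j}"
      then have "snd z + y j i > 0" if "snd z > - d (Suc j)" for z :: "(real ^ 'n) \<times> real" using yc[of i j] that by auto
      then show "continuous_on {z. snd z > - d (Suc j)} (\<lambda>z. u (z + (0, y j i)))"
        by (intro continuous_on_compose2[OF ucont] continuous_intros) (auto simp: mem_Times_iff)
    qed
    have shift_le: "\<bar>u (z + (0, y j i))\<bar> \<le> K * w (snd z + y j i)"
      if z: "snd z \<ge> 0" "infdist (fst z) S \<le> M * snd z" and i: "i < k j" for j i z
    proof -
      have "infdist (fst z) S < M * (snd z + y j i)"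
        using z(2) mult_pos_pos[OF assms(2) ypos[OF i]] by (simp add: distrib_left)
      then show ?thesis using u_le[of "snd z + y j i" "fst z"] z(1) ypos[OF i] by (cases z) auto
    qed
    interpret layers d \<theta> \<gamma> A1 M f S
    proof
      show "\<theta> \<ge> 3" "A1 \<ge> 0" "M > 0" by fact+
      show "4 * real DIM((real ^ 'n) \<times> real) * A1\<^sup>2 \<le> \<gamma>" unfolding \<gamma>_def by (rule order_refl)
      show "d j > 0" "d (Suc j) \<le> d j / 2" for j by fact+
      show "S \<in> sets lebesgue" by fact
      show "continuous_on {z. snd z \<ge> 0} (f j)" for j
        by (rule continuous_on_subset[OF f_cont]) (use dpos[of "Suc j"] in auto)
      fix j z assume z: "infdist (fst z) S \<le> M * snd z"
      show "\<bar>f j z\<bar> \<le> \<theta>" if "snd z \<ge> 0"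
      proof -
        have "\<bar>u (z + (0, y j i))\<bar> \<le> K * \<theta> ^ Suc j" if i: "i < k j" for i
        proof -
          have "w (snd z + y j i) \<le> w (d (Suc j))"
            using dpos yc[OF i] \<open>snd z \<ge> 0\<close> by (intro wmono) auto
          then have "K * w (snd z + y j i) \<le> K * \<theta> ^ Suc j"
            unfolding wd using K by (intro mult_left_mono) auto
          then show ?thesis using shift_le[OF \<open>snd z \<ge> 0\<close> z i] by linarith
        qed
        from f_le[of j z, OF this] show ?thesis using \<theta> by simp
      qed
      show "\<bar>f j z\<bar> \<le> \<theta> ^ m / \<theta> ^ j" if "snd z > 0" "d m \<le> snd z" for m
      proof (rule f_le)
        fix i assume i: "i < k j"
        have "w (snd z + y j i) \<le> w (d m)"
          using dpos ypos[OF i] that by (intro wmono) auto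
        then have "K * w (snd z + y j i) \<le> K * \<theta> ^ m"
          unfolding wd using K by (intro mult_left_mono) auto
        then show "\<bar>u (z + (0, y j i))\<bar> \<le> K * \<theta> ^ m" using shift_le[OF _ z i] that by fastforce
      qed (use \<theta> in simp)
      show "\<exists>P. has_lap (f j) z P 0 \<and> (\<forall>i\<in>Basis. \<bar>P i\<bar> \<le> A1 / d (Suc j))" if t: "snd z > 0"
      proof -
        \<comment> \<open>A displacement of size \<open>r\<close> raises the distance to
          \<open>S\<close> by at most \<open>r\<close> and lowers the height by at most
          \<open>r\<close>. With \<open>r * (1 + M) = M * d (Suc j) / 2\<close>, half of the node
          shift compensates for both. The height stays at least \<open>d (Suc j) / 2\<close>, and
          one doubling step there gives \<open>\<theta> * \<theta> ^ Suc j\<close>.\<close>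
        define r where "r = M * d (Suc j) / (2 * (1 + M))"
        have r: "r > 0" using assms(2) dpos by (simp add: r_def)
        have r2: "r * (1 + M) = M * (d (Suc j) / 2)" using assms(2) by (simp add: r_def field_simps)
        have rd: "r \<le> d (Suc j) / 2"
        proof -
          have "M * (d (Suc j) / 2) \<le> (1 + M) * (d (Suc j) / 2)" using dpos[of "Suc j"] by (intro mult_right_mono) auto
          then have "r * (1 + M) \<le> (d (Suc j) / 2) * (1 + M)" using r2 by (simp add: mult.commute)
          then show ?thesis using assms(2) by simp
        qed
        have snd_near: "snd (z + \<xi>) > - d (Suc j)" if "norm \<xi> \<le> r" for \<xi> :: "(real ^ 'n) \<times> real"
          using norm_snd_le[of "snd \<xi>" "fst \<xi>"] that rd t dpos[of "Suc j"] by (auto simp: abs_le_iff)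
        have near: "\<bar>f j (z + \<xi>)\<bar> \<le> \<theta>\<^sup>2" if \<xi>: "norm \<xi> \<le> r" for \<xi>
        proof -
          have n1: "norm (fst \<xi>) \<le> r" using norm_fst_le[of "fst \<xi>" "snd \<xi>"] \<xi> by simp
          have n2: "\<bar>snd \<xi>\<bar> \<le> r" using norm_snd_le[of "snd \<xi>" "fst \<xi>"] \<xi> by simp
          have "\<bar>u ((z + \<xi>) + (0, y j i))\<bar> \<le> K * (\<theta> * \<theta> ^ Suc j)" if i: "i < k j" for i
          proof -
            define \<tau> where "\<tau> = snd z + snd \<xi> + y j i"
            have \<tau>: "\<tau> \<ge> d (Suc j) / 2" "\<tau> > snd z + (d (Suc j) / 2) - r"
              using n2 t rd yc[OF i] dpos[of "Suc j"] unfolding \<tau>_def abs_le_iff by linarith+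
            have \<tau>0: "\<tau> > 0" using \<tau>(1) dpos[of "Suc j"] by linarith
            have "infdist (fst z + fst \<xi>) S \<le> infdist (fst z) S + norm (fst \<xi>)"
              using infdist_triangle[of "fst z + fst \<xi>" S "fst z"] by (simp add: dist_norm)
            also have "\<dots> \<le> M * snd z + r" using z n1 by linarith
            also have "\<dots> = M * (snd z + d (Suc j) / 2 - r)" using r2 by (simp add: algebra_simps)
            also have "\<dots> < M * \<tau>" using \<tau>(2) assms(2) by simp
            finally have "\<bar>u (fst z + fst \<xi>, \<tau>)\<bar> \<le> K * w \<tau>" by (rule u_le[OF \<tau>0])
            also have "w \<tau> \<le> \<theta> * \<theta> ^ Suc j"
            proof -
              have "w \<tau> \<le> w (d (Suc j) / 2)" using \<tau>(1) dpos[of "Suc j"] by (intro wmono) auto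
              also have "\<dots> \<le> \<theta> * w (d (Suc j))" using dbl[of "d (Suc j) / 2"] dpos[of "Suc j"] by simp
              finally show ?thesis by (simp only: wd)
            qed
            finally have "\<bar>u (fst z + fst \<xi>, \<tau>)\<bar> \<le> K * (\<theta> * \<theta> ^ Suc j)" using K by simp
            moreover have "(z + \<xi>) + (0, y j i) = (fst z + fst \<xi>, \<tau>)" by (simp add: prod_eq_iff \<tau>_def)
            ultimately show ?thesis by simp
          qed
          from f_le[of j "z + \<xi>", OF this] show ?thesis using \<theta> by (simp add: power2_eq_square)
        qed
        obtain P where P: "has_lap (f j) z P 0" using f_lap[of j z] t dpos[of "Suc j"] by fastforce
        have "\<bar>P i\<bar> \<le> A1 / d (Suc j)" if i: "i \<in> Basis" for i
        proof -
          have "\<bar>P i\<bar> \<le> (real DIM((real ^ 'n) \<times> real) + 1) * \<theta>\<^sup>2 / r"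
          proof (rule gradient_bound[OF r _ near _ _ P i])
            show "\<theta>\<^sup>2 > 0" using \<theta> by simp
            show "\<exists>p. has_lap (f j) (z + \<xi>) p 0" if "norm \<xi> \<le> r" for \<xi>
              using f_lap snd_near[OF that] by blast
            show "continuous_on (cball z r) (f j)"
            proof (rule continuous_on_subset[OF f_cont])
              show "cball z r \<subseteq> {z. snd z > - d (Suc j)}"
              proof
                fix v assume "v \<in> cball z r"
                then have "norm (v - z) \<le> r" by (simp add: dist_norm norm_minus_commute)
                from snd_near[OF this] show "v \<in> {z. snd z > - d (Suc j)}" by simp
              qed
            qed
          qed
          also have "\<dots> = A1 / d (Suc j)" using assms(2) dpos[of "Suc j"] by (simp add: A1_def r_def field_simps)
          finally show ?thesis .
        qed
        then show ?thesis using P by blast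
      qed
    qed
    have C2: "C2 \<le> C - 1" by (simp add: C_def)
    have small: "\<forall>\<^sub>F \<delta> in at_right 0. I0 w u x \<delta> / sqrt (ln (w \<delta>) * ln (ln (ln (w \<delta>)))) \<le> C * K"
      if x: "x \<in> S" and lil: "\<forall>\<^sub>F i in sequentially. \<forall>N\<in>{16 ^ i..<16 ^ Suc i}.
        (\<Sum>j<N. f j (x, 0)) \<le> C2 * (4 ^ i * sqrt (ln (real i)))" for x
    proof -
      define J where "J j = (LINT y:{d (Suc j)<..d j}|?\<mu>. u (x, y))" for j
      define j0 where "j0 = nat \<lceil>norm x\<rceil>"
      \<comment> \<open>All errors independent of \<delta>: the finitely many uncontrolled layers,
        the summed discretisation errors, and the incomplete layer.\<close>
      define R where "R = (\<Sum>j<j0. \<bar>J j - K * f j (x, 0)\<bar>) + 2 * K + K * \<theta>"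
      have R: "R \<ge> 0" using K \<theta> by (auto simp: R_def intro!: add_nonneg_nonneg sum_nonneg)
      have err: "(\<Sum>j<N. J j) \<le> K * (\<Sum>j<N. f j (x, 0)) + (\<Sum>j<j0. \<bar>J j - K * f j (x, 0)\<bar>) + 2 * K" for N
      proof -
        have Kf: "K * f j (x, 0) = (\<Sum>i<k j. c j i * u (x, y j i))" for j
          using K by (simp add: f_def sum_distrib_left)
        have "\<bar>J j - K * f j (x, 0)\<bar> \<le> (if j < j0 then \<bar>J j - K * f j (x, 0)\<bar> else 0) + K * (1 / 2) ^ j" for j
        proof (cases "j < j0")
          case False
          then have "norm x \<le> real j" unfolding j0_def by linarith
          from approx[OF this] show ?thesis using False unfolding Kf J_def by (simp add: abs_minus_commute)
        qed (use K in simp)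
        then have "(\<Sum>j<N. \<bar>J j - K * f j (x, 0)\<bar>) \<le>
            (\<Sum>j<N. (if j < j0 then \<bar>J j - K * f j (x, 0)\<bar> else 0) + K * (1 / 2) ^ j)" by (intro sum_mono)
        also have "\<dots> = (\<Sum>j<N. if j < j0 then \<bar>J j - K * f j (x, 0)\<bar> else 0) + K * (\<Sum>j<N. (1 / 2) ^ j)"
          by (simp add: sum.distrib sum_distrib_left)
        also have "(\<Sum>j<N. if j < j0 then \<bar>J j - K * f j (x, 0)\<bar> else 0)
            \<le> (\<Sum>j\<in>{..<max N j0}. if j < j0 then \<bar>J j - K * f j (x, 0)\<bar> else 0)"
          by (intro sum_mono2) auto
        also have "\<dots> = (\<Sum>j<j0. \<bar>J j - K * f j (x, 0)\<bar>)"
          by (rule sum.mono_neutral_cong_right) auto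
        also have "(\<Sum>j<N. (1 / 2) ^ j) \<le> (2::real)"
          using sum_inverse_powers_le[of 2 0 N] by (simp add: atLeast0LessThan power_divide)
        finally have "(\<Sum>j<N. \<bar>J j - K * f j (x, 0)\<bar>) \<le> (\<Sum>j<j0. \<bar>J j - K * f j (x, 0)\<bar>) + K * 2"
          using K by simp
        moreover have "(\<Sum>j<N. J j) - K * (\<Sum>j<N. f j (x, 0)) \<le> (\<Sum>j<N. \<bar>J j - K * f j (x, 0)\<bar>)"
          unfolding sum_distrib_left sum_subtractf[symmetric] by (intro sum_mono) simp
        ultimately show ?thesis by linarith
      qed
      obtain i1 where i1: "\<And>i N. i \<ge> i1 \<Longrightarrow> 16 ^ i \<le> N \<Longrightarrow> N < 16 ^ Suc i \<Longrightarrow>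
          (\<Sum>j<N. f j (x, 0)) \<le> C2 * (4 ^ i * sqrt (ln (real i)))"
        using lil unfolding eventually_sequentially by (meson atLeastLessThan_iff)
      obtain i2 :: nat where i2: "R / K < 4 ^ i2" using real_arch_pow[of 4 "R / K"] by auto
      define i3 where "i3 = max 3 (max i1 i2)"
      have "\<forall>\<^sub>F \<delta> in at_right 0. \<delta> \<in> {0<..<d (16 ^ i3)}" using dpos by (rule eventually_at_right_real)
      then show ?thesis
      proof eventually_elim
        case (elim \<delta>)
        then have \<delta>: "0 < \<delta>" "\<delta> < d (16 ^ i3)" by auto
        have d_mono: "d b \<le> d a" if "a \<le> b" for a b using lift_Suc_antimono_le[of d, OF dSuc that] .
        have lay: "d (layer \<delta>) \<le> \<delta>" "\<And>m. m < layer \<delta> \<Longrightarrow> \<delta> < d m" using layer[OF \<delta>(1)] by auto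
        have big: "layer \<delta> > 16 ^ i3"
        proof (rule ccontr)
          assume "\<not> layer \<delta> > 16 ^ i3"
          then have "d (16 ^ i3) \<le> d (layer \<delta>)" by (intro d_mono) simp
          then show False using lay(1) \<delta>(2) by simp
        qed
        \<comment> \<open>\<open>N\<close> counts the complete layers above \<delta>: \<delta> lies
          below \<open>d N\<close> but not below \<open>d (Suc N)\<close>.\<close>
        define N where "N = layer \<delta> - 1"
        have layN: "layer \<delta> = Suc N" using big by (simp add: N_def)
        have N: "N \<ge> 16 ^ i3" "\<delta> < d N" "d (Suc N) \<le> \<delta>" using big lay layN by auto
        have "N \<ge> 1" using N(1) by (metis le_trans one_le_numeral one_le_power)
        then obtain i where i: "16 ^ i \<le> N" "N < 16 ^ Suc i"
          using ex_power_ivl1[of 16 N] by auto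
        have "(16::nat) ^ i3 < 16 ^ Suc i" using N(1) i(2) by linarith
        then have ii: "i \<ge> i3" by (simp add: power_strict_increasing_iff del: power_Suc)
        then have ige: "i \<ge> 3" "i \<ge> i1" "i \<ge> i2" by (auto simp: i3_def)
        have L: "ln (real i) \<ge> 1" using ige(1) exp_le by (simp add: ln_ge_iff)
        define G where "G = 4 ^ i * sqrt (ln (real i))"
        have G: "G \<ge> 4 ^ i"
        proof -
          have "(4::real) ^ i * 1 \<le> 4 ^ i * sqrt (ln (real i))" using L by (intro mult_left_mono) auto
          then show ?thesis by (simp add: G_def)
        qed
        have RG: "R \<le> K * G"
        proof -
          have "R / K \<le> 4 ^ i2" using i2 by simp
          also have "\<dots> \<le> 4 ^ i" using ige by (intro power_increasing) auto
          finally have "R / K \<le> G" using G by linarith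
          then show ?thesis using K by (simp add: field_simps)
        qed
        \<comment> \<open>On the incomplete layer \<open>w\<close> is at most
          \<open>\<theta> ^ Suc N\<close>, while the mass is at most
          \<open>1 / \<theta> ^ N\<close>.\<close>
        have tail: "\<bar>LINT y:{\<delta>..d N}|?\<mu>. u (x, y)\<bar> \<le> K * \<theta>"
        proof -
          have "\<bar>LINT y:{\<delta>..d N}|?\<mu>. u (x, y)\<bar> \<le> (K * \<theta> ^ Suc N) * measure ?\<mu> {\<delta>..d N}"
          proof (rule set_integral_slice_le[OF assms(1) ucont \<delta>(1)])
            fix y assume y: "y \<in> {\<delta>..d N}"
            have "\<bar>u (x, y)\<bar> \<le> K * w y"
              using growth x y \<delta>(1) assms(2) by auto
            also have "w y \<le> w (d (Suc N))" using y N dpos by (intro wmono) auto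
            finally show "\<bar>u (x, y)\<bar> \<le> K * \<theta> ^ Suc N" using K by (simp add: wd)
          qed (use N in auto)
          also have "\<dots> \<le> (K * \<theta> ^ Suc N) * (1 / w (d N))"
            using measure_weight_le(2)[OF assms(1) ucont \<delta>(1)] N K \<theta> by (intro mult_left_mono) auto
          also have "\<dots> = K * \<theta>" using \<theta> by (simp add: wd)
          finally show ?thesis .
        qed
        have "I0 w u x \<delta> = (\<Sum>j<N. J j) + (LINT y:{\<delta>..d N}|?\<mu>. u (x, y))"
          unfolding J_def by (rule I0_split[OF assms(1) ucont d0 dpos dSuc \<delta>(1)]) (use N in simp)
        then have "I0 w u x \<delta> \<le> K * (\<Sum>j<N. f j (x, 0)) + R"
          using err[of N] tail unfolding R_def by linarith
        also have "\<dots> \<le> K * (C2 * G) + K * G"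
          using i1[OF ige(2) i] K RG by (intro add_mono mult_left_mono) (auto simp: G_def)
        also have "\<dots> \<le> K * ((C - 1) * G) + K * G"
        proof -
          have "0 \<le> G" using G by (rule order_trans[rotated]) simp
          then show ?thesis using C2 K by (intro add_mono mult_left_mono mult_right_mono order_refl) auto
        qed
        also have "\<dots> = (C * K) * G" by (simp add: algebra_simps)
        finally have num: "I0 w u x \<delta> \<le> (C * K) * G" .
        define D where "D = sqrt (ln (w \<delta>) * ln (ln (ln (w \<delta>))))"
        have GD: "G \<le> D"
        proof -
          have e3: "exp 1 \<le> (3::real)" by (rule exp_le)
          have wN: "w \<delta> \<ge> \<theta> ^ N" using wmono[OF \<delta>(1), of "d N"] N by (simp add: wd)
          have t3: "(3::real) ^ N \<le> \<theta> ^ N" using \<theta> by (intro power_mono) auto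
          have ln3: "ln (3::real) \<ge> 1" "ln (16::real) \<ge> 1" using e3 by (simp_all add: ln_ge_iff)
          have "real N \<le> real N * ln 3" using mult_left_mono[OF ln3(1), of "real N"] by simp
          also have "\<dots> = ln (3 ^ N)" by (simp add: ln_realpow)
          also have "\<dots> \<le> ln (w \<delta>)" using wN t3 wpos[OF \<delta>(1)] by (subst ln_le_cancel_iff) auto
          finally have l1: "real N \<le> ln (w \<delta>)" .
          have "real (16 ^ i) \<le> real N" using i(1) by (simp only: of_nat_le_iff)
          moreover have "real (16 ^ i) = 16 ^ i" by simp
          ultimately have l1': "16 ^ i \<le> ln (w \<delta>)" using l1 by linarith
          have p16: "(0::real) < 16 ^ i" by simp
          have "real i \<le> real i * ln 16" using mult_left_mono[OF ln3(2), of "real i"] by simp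
          also have "\<dots> = ln (16 ^ i)" by (simp add: ln_realpow)
          also have "\<dots> \<le> ln (ln (w \<delta>))" using l1' p16 less_le_trans[OF p16 l1'] by (subst ln_le_cancel_iff)
          finally have l2: "real i \<le> ln (ln (w \<delta>))" .
          have l3: "ln (real i) \<le> ln (ln (ln (w \<delta>)))" using l2 ige(1) by (subst ln_le_cancel_iff) auto
          have "16 ^ i * ln (real i) \<le> ln (w \<delta>) * ln (ln (ln (w \<delta>)))"
            using l1' l3 L p16 by (intro mult_mono) linarith+
          then have "sqrt (16 ^ i * ln (real i)) \<le> D" unfolding D_def by (rule real_sqrt_le_mono)
          moreover have "sqrt (16 ^ i * ln (real i)) = G"
          proof -
            have "(16::real) ^ i = (4 ^ i)\<^sup>2" by (simp add: power2_eq_square flip: power_mult_distrib)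
            then show ?thesis by (simp add: G_def real_sqrt_mult)
          qed
          ultimately show ?thesis by simp
        qed
        have D0: "D > 0" using GD G by (meson less_le_trans zero_less_numeral zero_less_power)
        have "(C * K) * G \<le> (C * K) * D" using GD K by (intro mult_left_mono) (auto simp: C_def)
        then have "I0 w u x \<delta> \<le> (C * K) * D" using num by linarith
        then show ?case using D0 unfolding D_def[symmetric] by (simp add: pos_divide_le_eq)
      qed
    qed
    from iterated_logarithm show "AE x in lebesgue. x \<in> S \<longrightarrow>
         Limsup (at_right 0)
           (\<lambda>\<delta>. ereal (I0 w u x \<delta> / sqrt (ln (w \<delta>) * ln (ln (ln (w \<delta>))))))
         \<le> ereal (C * K)"
    proof (rule AE_mp, intro AE_I2 impI)
      fix x assume "x \<in> S" and
        "x \<in> S \<longrightarrow> (\<forall>\<^sub>F i in sequentially. \<forall>N\<in>{16 ^ i..<16 ^ Suc i}.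
          (\<Sum>j<N. f j (x, 0)) \<le> C2 * (4 ^ i * sqrt (ln (real i))))"
      then have "\<forall>\<^sub>F \<delta> in at_right 0. I0 w u x \<delta> / sqrt (ln (w \<delta>) * ln (ln (ln (w \<delta>)))) \<le> C * K"
        using small by blast
      then show "Limsup (at_right 0) (\<lambda>\<delta>. ereal (I0 w u x \<delta> / sqrt (ln (w \<delta>) * ln (ln (ln (w \<delta>)))))) \<le> ereal (C * K)"
        by (intro Limsup_bounded) (auto elim: eventually_mono)
    qed
  qed
qed

end
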